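(* Assume the setting of the context and suppose: (i) $\omega_0\notin\Upsilon$ and $\bigcup_{\mu\in\Upsilon}r^{-1}_\mu\cap\sigma(\mathcal{A})\subseteq\Lambda$; (ii) $\lim_{h\to0}\|R_h(z_k)-R(z_k)\|_V=0$ for every $k=1,\dots,N$; (iii) there are a constant $C_0>0$ and a linear operator $\mathcal{E}:V_h\to Y$ into a Hilbert space $Y$ such that $\|S_rv_h-S_{r,h}v_h\|_V\le C_0\|\mathcal{E}v_h\|_Y$ for all $v_h\in V_h$. Then there exist $h_0>0$ and $C>0$ such that for all $h<h_0$, $$\operatorname{gap}_V(E_h,E)\le C\|\mathcal{E}\hat e_h\|_Y,$$ where $\hat e_h$ is the normalized vector defined in the context (computed from $E_h$ only).
   Context: $\mathcal{H}$ is a complex Hilbert space, $\mathcal{A}:\operatorname{dom}(\mathcal{A})\subseteq\mathcal{H}\to\mathcal{H}$ a closed linear operator with resolvent $R(z)=(z-\mathcal{A})^{-1}$. $\Lambda$ is a finite set of isolated eigenvalues of $\mathcal{A}$ of finite algebraic multiplicity; $E=\operatorname{ran}S$, $S=\frac{1}{2\pi i}\oint_\Gamma R(z)dz$ with $\Gamma\subset\rho(\mathcal{A})$ a positively oriented simple closed contour enclosing $\Lambda$ and no other point of $\sigma(\mathcal{A})$. $r(z)=\omega_0+\sum_{j=1}^N\omega_j/(z_j-z)$ with distinct $z_j\in\rho(\mathcal{A})$; $S_r=\omega_0+\sum_j\omega_jR(z_j)$; $\Upsilon=r(\Lambda)$; $r^{-1}_\mu=\{\lambda\in\mathbb{C}\setminus\{z_1,\dots,z_N\}:r(\lambda)=\mu\}$.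 $\Theta$ is a simple closed curve enclosing $\Upsilon$ and neither the origin nor any point of $\sigma(S_r)\setminus\Upsilon$. $V$ is a Hilbert space continuously embedded in $\mathcal{H}$ with $\operatorname{dom}(\mathcal{A})\subseteq V$, $E\subset V$, $R(z)V\subseteq V$ for all $z\in\rho(\mathcal{A})$; $\|\cdot\|_V$ also denotes the induced operator norm. For $h\to0$, $V_h\subset V$ are finite-dimensional and $R_h(z_k):\mathcal{H}\to V_h$ are finite rank; $S_{r,h}=\omega_0+\sum_j\omega_jR_h(z_j)$; for $h$ small, $E_h=\operatorname{ran}\frac{1}{2\pi i}\oint_\Theta(z-S_{r,h})^{-1}dz$ (with $\Theta\subset\rho(S_{r,h})$). Given a basis $e_h^1,\dots,e_h^L$ of $E_h$, let $G_{ij}=(\mathcal{E}e_h^j,\mathcal{E}e_h^i)_Y$ and $M_{ij}=(e_h^j,e_h^i)_V$; let $\hat x$ be an eigenvector of the largest eigenvalue $\hat\lambda=\max\sigma(M^{-1}G)$ of $Gx=\lambda Mx$, $\tilde e_h=\sum_i\hat x_ie_h^i$, $\hat e_h=\tilde e_h/\|\tilde e_h\|_V$. Gap: $\delta(U,W)=\sup_{u\in U,\|u\|_V=1}\operatorname{dist}_V(u,W)$, $\operatorname{gap}_V(U,W)=\max(\delta(U,W),\delta(W,U))$. *)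

theory Defs
  imports "HOL-Complex_Analysis.Complex_Analysis"
begin

class complex_vector = real_vector +
  fixes scaleC :: "complex \<Rightarrow> 'a \<Rightarrow> 'a" (infixr \<open>*\<^sub>C\<close> 75)
  assumes scaleC_add_right: "a *\<^sub>C (x + y) = a *\<^sub>C x + a *\<^sub>C y"
    and scaleC_add_left: "(a + b) *\<^sub>C x = a *\<^sub>C x + b *\<^sub>C x"
    and scaleC_scaleC: "a *\<^sub>C (b *\<^sub>C x) = (a * b) *\<^sub>C x"
    and scaleC_one: "1 *\<^sub>C x = x"
    and scaleR_scaleC: "scaleR r x = complex_of_real r *\<^sub>C x"

class complex_normed_vector = complex_vector + real_normed_vector +
  assumes norm_scaleC: "norm (a *\<^sub>C x) = cmod a * norm x"

text \<open>Inner product, linear in the FIRST argument and conjugate linear in the second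
  (the convention of the paper: G_ij = (E e_j, E e_i)_Y).\<close>
class complex_inner = complex_normed_vector +
  fixes cinner :: "'a \<Rightarrow> 'a \<Rightarrow> complex"
  assumes cinner_commute: "cinner x y = cnj (cinner y x)"
    and cinner_add_left: "cinner (x + y) z = cinner x z + cinner y z"
    and cinner_scaleC_left: "cinner (a *\<^sub>C x) y = a * cinner x y"
    and cinner_self_norm: "cinner x x = complex_of_real ((norm x)\<^sup>2)"

class chilbert = complex_inner + complete_space

definition csubspace :: "'a::complex_vector set \<Rightarrow> bool" where
  "csubspace W = module.subspace scaleC W"

definition cspan :: "'a::complex_vector set \<Rightarrow> 'a set" where
  "cspan B = module.span scaleC B"

definition cdependent :: "'a::complex_vector set \<Rightarrow> bool" where
  "cdependent B = module.dependent scaleC B"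

definition cfinite_dim :: "'a::complex_vector set \<Rightarrow> bool" where
  "cfinite_dim W \<longleftrightarrow> (\<exists>B. finite B \<and> W = cspan B)"

definition clinear_on :: "'a::complex_vector set \<Rightarrow> ('a \<Rightarrow> 'b::complex_vector) \<Rightarrow> bool" where
  "clinear_on W f \<longleftrightarrow> (\<forall>x\<in>W. \<forall>y\<in>W. f (x + y) = f x + f y) \<and>
                      (\<forall>c. \<forall>x\<in>W. f (c *\<^sub>C x) = c *\<^sub>C f x)"

definition bounded_clinear_op :: "('a::complex_normed_vector \<Rightarrow> 'b::complex_normed_vector) \<Rightarrow> bool" where
  "bounded_clinear_op f \<longleftrightarrow> clinear_on UNIV f \<and> (\<exists>K. \<forall>x. norm (f x) \<le> K * norm x)"

text \<open>A (possibly unbounded) linear operator is a pair: domain D and action A on D.\<close>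
definition closed_operator :: "'a::complex_normed_vector set \<Rightarrow> ('a \<Rightarrow> 'a) \<Rightarrow> bool" where
  "closed_operator D A \<longleftrightarrow> csubspace D \<and> clinear_on D A \<and> closed {(x, A x) | x. x \<in> D}"

definition cresolvent :: "'a::complex_normed_vector set \<Rightarrow> ('a \<Rightarrow> 'a) \<Rightarrow> complex \<Rightarrow> 'a \<Rightarrow> 'a" where
  "cresolvent D A z y = (THE x. x \<in> D \<and> z *\<^sub>C x - A x = y)"

definition cresolvent_set :: "'a::complex_normed_vector set \<Rightarrow> ('a \<Rightarrow> 'a) \<Rightarrow> complex set" where
  "cresolvent_set D A = {z. (\<forall>y. \<exists>!x. x \<in> D \<and> z *\<^sub>C x - A x = y) \<and>
                              bounded_clinear_op (cresolvent D A z)}"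

definition cspectrum :: "'a::complex_normed_vector set \<Rightarrow> ('a \<Rightarrow> 'a) \<Rightarrow> complex set" where
  "cspectrum D A = UNIV - cresolvent_set D A"

definition vcontour_integral :: "(real \<Rightarrow> complex) \<Rightarrow> (complex \<Rightarrow> 'a::complex_normed_vector) \<Rightarrow> 'a" where
  "vcontour_integral \<gamma> f =
     integral {0..1} (\<lambda>t. vector_derivative \<gamma> (at t within {0..1}) *\<^sub>C f (\<gamma> t))"

definition riesz :: "'a::complex_normed_vector set \<Rightarrow> ('a \<Rightarrow> 'a) \<Rightarrow> (real \<Rightarrow> complex) \<Rightarrow> 'a \<Rightarrow> 'a" where
  "riesz D A \<gamma> x = (1 / (2 * of_real pi * \<i>)) *\<^sub>C vcontour_integral \<gamma> (\<lambda>z. cresolvent D A z x)"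

text \<open>Isolated eigenvalue of finite algebraic multiplicity (algebraic multiplicity = dimension
  of the range of the Riesz projection, as in Kato).\<close>
definition isolated_eigenvalue_finite_mult ::
    "'a::complex_normed_vector set \<Rightarrow> ('a \<Rightarrow> 'a) \<Rightarrow> complex \<Rightarrow> bool" where
  "isolated_eigenvalue_finite_mult D A lam \<longleftrightarrow>
     (\<exists>x\<in>D. x \<noteq> 0 \<and> A x = lam *\<^sub>C x) \<and>
     (\<exists>\<epsilon>>0. cball lam \<epsilon> \<inter> cspectrum D A = {lam} \<and>
            cfinite_dim (range (riesz D A (circlepath lam \<epsilon>))))"

definition rfun :: "nat \<Rightarrow> (nat \<Rightarrow> complex) \<Rightarrow> (nat \<Rightarrow> complex) \<Rightarrow> complex \<Rightarrow> complex" where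
  "rfun N \<omega> zs z = \<omega> 0 + (\<Sum>j=1..N. \<omega> j / (zs j - z))"

definition rinv :: "nat \<Rightarrow> (nat \<Rightarrow> complex) \<Rightarrow> (nat \<Rightarrow> complex) \<Rightarrow> complex \<Rightarrow> complex set" where
  "rinv N \<omega> zs \<mu> = {lam. lam \<notin> zs ` {1..N} \<and> rfun N \<omega> zs lam = \<mu>}"

text \<open>delta(U,W) = sup over unit vectors u of U of dist(u,W); the sup over an empty set
  (U = {0}) is taken to be 0.\<close>
definition sgap_delta :: "'a::real_normed_vector set \<Rightarrow> 'a set \<Rightarrow> real" where
  "sgap_delta U W = Sup (insert 0 {infdist u W | u. u \<in> U \<and> norm u = 1})"

definition sgap :: "'a::real_normed_vector set \<Rightarrow> 'a set \<Rightarrow> real" where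
  "sgap U W = max (sgap_delta U W) (sgap_delta W U)"

definition is_cbasis :: "'a::complex_vector set \<Rightarrow> nat \<Rightarrow> (nat \<Rightarrow> 'a) \<Rightarrow> bool" where
  "is_cbasis W L e \<longleftrightarrow> inj_on e {1..L} \<and> \<not> cdependent (e ` {1..L}) \<and> cspan (e ` {1..L}) = W"

definition gen_eigvals :: "nat \<Rightarrow> (nat \<Rightarrow> nat \<Rightarrow> complex) \<Rightarrow> (nat \<Rightarrow> nat \<Rightarrow> complex) \<Rightarrow> complex set" where
  "gen_eigvals L G M = {\<mu>. \<exists>y. (\<exists>i\<in>{1..L}. y i \<noteq> 0) \<and>
        (\<forall>i\<in>{1..L}. (\<Sum>j=1..L. G i j * y j) = \<mu> * (\<Sum>j=1..L. M i j * y j))}"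

text \<open>x is an eigenvector of G x = lambda M x for the largest eigenvalue lambda-hat = max sigma(M^{-1} G)
  (these eigenvalues are real, so the maximum is taken with respect to the real part).\<close>
definition is_top_gen_eigvec ::
    "nat \<Rightarrow> (nat \<Rightarrow> nat \<Rightarrow> complex) \<Rightarrow> (nat \<Rightarrow> nat \<Rightarrow> complex) \<Rightarrow> (nat \<Rightarrow> complex) \<Rightarrow> bool" where
  "is_top_gen_eigvec L G M x \<longleftrightarrow>
     (\<exists>lam. lam \<in> gen_eigvals L G M \<and> (\<forall>\<mu>\<in>gen_eigvals L G M. Re \<mu> \<le> Re lam) \<and>
        (\<exists>i\<in>{1..L}. x i \<noteq> 0) \<and>
        (\<forall>i\<in>{1..L}. (\<Sum>j=1..L. G i j * x j) = lam * (\<Sum>j=1..L. M i j * x j)))"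

definition gramM :: "(nat \<Rightarrow> 'a::complex_inner) \<Rightarrow> nat \<Rightarrow> nat \<Rightarrow> complex" where
  "gramM e i j = cinner (e j) (e i)"

definition gramG :: "('a \<Rightarrow> 'b::complex_inner) \<Rightarrow> (nat \<Rightarrow> 'a) \<Rightarrow> nat \<Rightarrow> nat \<Rightarrow> complex" where
  "gramG Eop e i j = cinner (Eop (e j)) (Eop (e i))"

definition ehat :: "nat \<Rightarrow> (nat \<Rightarrow> 'a::complex_normed_vector) \<Rightarrow> (nat \<Rightarrow> complex) \<Rightarrow> 'a" where
  "ehat L e x = (let et = (\<Sum>i=1..L. x i *\<^sub>C e i) in (1 / norm et) *\<^sub>R et)"

end

theory Submission
  imports Defs "HOL-Computational_Algebra.Fundamental_Theorem_Algebra"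
begin

text \<open>On $V$ the operators $S_{r,h}$ converge to $S_r$ in norm, so their Riesz projections $P_h$, $P$
  along \<open>\<Theta>\<close> are close. For $v \in E_h$ the resolvent difference gives
  $\|Pv - v\| \le C \sup_z \|(S_r - S_{r,h}) (z - S_{r,h})^{-1} v\|$, where the argument stays in
  $E_h \subseteq V_h$; hypothesis (iii) and the Rayleigh quotient bound for \<open>\<E>\<close> turn the right-hand
  side into a multiple of $\|v\|$ times the norm of the image of $\hat e_h$. The reverse distance
  follows because $P$ maps $E_h$ onto $E$ with a controlled right inverse.

  That $P$ has the range $E$ of the Riesz projection $Q$ of $A$ is shown by testing vector-valued
  contour integrals against inner products and using the homological Cauchy theorem for scalar
  functions. If $P'$ denotes the projection complementary to $P$, then
  $(z - A)^{-1} P'$ stays bounded near \<open>\<Lambda>\<close>, because $r(z) - S_r$ is $z - A$ times a bounded operator;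
  hence $Q P' = 0$. Conversely, for \<open>\<mu> \<in> \<Upsilon>\<close> the factorization of \<open>\<mu> - r\<close> over its zeros makes
  \<open>\<mu>\<close>$ - S_r$ invertible on the range of $1 - Q$, hence $P (1 - Q) = 0$.\<close>

section \<open>Complex Hilbert spaces and bounded operators\<close>

text \<open>All estimates live in the norm of V, but E and E_h are ranges of contour integrals on H.
  The bridge is that S_r and S_{r,h} are both omega_0 plus a map F into V: their spectra in H and in
  V agree except possibly at omega_0, and spectral subspaces become eigenspaces of the integrals on
  V. The point omega_0 decides more: (iii) is available on V_h only, and E_h lies in V_h because its
  vectors are values of F, which holds when omega_0 is regular or not encircled. The given curves
  are piecewise C1, possibly of unbounded speed, so norm bounds are taken along polynomial loops
  with the same scalar integrals. For \<Theta> the loop stays in a compact neighbourhood that is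
  regular for S_r and, by perturbation, for every S_{r,h} with small h. The orientation of \<Theta>
  is not prescribed: the winding number inside is s = 1 or s = -1, the integral Q satisfies Q^2 = s
  Q, and Q / s is the projection. Two smallness measures are kept apart: the convergence (ii) fixes
  \<open>h0\<close>, while the residual on E_h alone yields the estimate.\<close>

instance chilbert \<subseteq> banach ..

global_interpretation cvs: vector_space "scaleC :: complex \<Rightarrow> 'a \<Rightarrow> 'a::complex_vector"
  by unfold_locales
    (simp_all add: scaleC_add_right scaleC_add_left scaleC_scaleC scaleC_one)

lemma bounded_bilinear_scaleC:
  "bounded_bilinear (scaleC :: complex \<Rightarrow> 'a \<Rightarrow> 'a::complex_normed_vector)"
proof
  show "\<exists>K. \<forall>a b. norm ((a :: complex) *\<^sub>C (b :: 'a)) \<le> norm a * norm b * K"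
    by (rule exI[of _ 1]) (simp add: norm_scaleC)
qed (simp_all add: scaleC_add_left scaleC_add_right scaleR_scaleC scaleC_scaleC
    scaleR_conv_of_real mult.commute)

lemmas continuous_on_scaleC [continuous_intros] =
  bounded_bilinear.continuous_on[OF bounded_bilinear_scaleC]
lemmas tendsto_scaleC [tendsto_intros] =
  bounded_bilinear.tendsto[OF bounded_bilinear_scaleC]
lemmas bounded_linear_scaleC_left =
  bounded_bilinear.bounded_linear_left[OF bounded_bilinear_scaleC]

lemma cinner_scaleC_right: "cinner x (c *\<^sub>C y) = cnj c * cinner x y"
  and cinner_add_right: "cinner x (y + z) = cinner x y + cinner x z"
  for x y z :: "'a::complex_inner"
  using cinner_commute[of x "c *\<^sub>C y"] cinner_commute[of x y] cinner_commute[of x "y + z"]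
    cinner_commute[of x z]
  by (simp_all add: cinner_scaleC_left cinner_add_left)

lemma bounded_linear_cinner_left: "bounded_linear (\<lambda>x :: 'a::complex_inner. cinner x y)"
proof (rule bounded_linear_intro[where K = "norm y"])
  fix x :: 'a
  show "norm (cinner x y) \<le> norm x * norm y"
  proof (cases "y = 0")
    case True
    have "cinner x (0::'a) = cnj (cinner (0 *\<^sub>C 0) x)"
      using cinner_commute[of x 0] by simp
    then show ?thesis using True by (simp only: cinner_scaleC_left) simp
  next
    case False
    \<comment> \<open>The Cauchy-Schwarz inequality: \<open>x + b *\<^sub>C y\<close> is
      \<open>x\<close> minus its orthogonal projection onto the line of \<open>y\<close>, and its
      squared norm is nonnegative.\<close>
    define a where "a = cinner x y / complex_of_real ((norm y)\<^sup>2)"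
    have ny: "norm y > 0" using False by simp
    define b where "b = - a"
    have c: "cinner y x = cnj (cinner x y)" by (rule cinner_commute)
    have "complex_of_real ((norm (x + b *\<^sub>C y))\<^sup>2) = cinner (x + b *\<^sub>C y) (x + b *\<^sub>C y)"
      by (simp add: cinner_self_norm)
    also have "\<dots> = cinner x x + cnj b * cinner x y + b * cinner y x + b * cnj b * cinner y y"
      by (simp add: cinner_add_right cinner_scaleC_right cinner_add_left cinner_scaleC_left algebra_simps)
    also have "\<dots> = complex_of_real ((norm x)\<^sup>2) + cnj b * cinner x y + b * cnj (cinner x y)
        + b * cnj b * complex_of_real ((norm y)\<^sup>2)"
      by (simp only: cinner_self_norm c)
    also have "\<dots> = complex_of_real ((norm x)\<^sup>2) - cinner x y * cnj (cinner x y) / complex_of_real ((norm y)\<^sup>2)"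
      using ny by (simp add: b_def a_def field_simps power2_eq_square)
    also have "\<dots> = complex_of_real ((norm x)\<^sup>2 - (cmod (cinner x y))\<^sup>2 / (norm y)\<^sup>2)"
      by (simp add: complex_norm_square[symmetric] del: of_real_power)
    finally have "(norm (x + b *\<^sub>C y))\<^sup>2 = (norm x)\<^sup>2 - (cmod (cinner x y))\<^sup>2 / (norm y)\<^sup>2"
      using of_real_eq_iff by blast
    then have "(cmod (cinner x y))\<^sup>2 / (norm y)\<^sup>2 \<le> (norm x)\<^sup>2"
      by (metis diff_ge_0_iff_ge zero_le_power2)
    then have "(cmod (cinner x y))\<^sup>2 \<le> (norm x * norm y)\<^sup>2"
      using ny by (simp add: field_simps power_mult_distrib)
    then show ?thesis by (simp add: power2_le_iff_abs_le)
  qed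
qed (simp_all add: cinner_add_left cinner_scaleC_left scaleR_scaleC scaleR_conv_of_real)

lemmas cinner_left_simps =
  linear_simps[OF bounded_linear_cinner_left]

text \<open>Vector-valued contour integrals are compared through this: each pairing with
  \<open>u\<close> is a scalar contour integral, for which Cauchy theory is available.\<close>

lemma cinner_eqI:
  assumes "\<And>u. cinner x u = cinner y (u::'a::complex_inner)"
  shows "x = y"
proof -
  have "cinner (x - y) (x - y) = 0"
    using assms by (simp add: cinner_left_simps)
  then show ?thesis by (simp add: cinner_self_norm)
qed

lemma bounded_clinear_opI:
  assumes "\<And>x y. f (x + y) = f x + f y" "\<And>c x. f (c *\<^sub>C x) = c *\<^sub>C f x"
    and "\<And>x. norm (f x) \<le> K * norm x"
  shows "bounded_clinear_op f"
  using assms unfolding bounded_clinear_op_def clinear_on_def by blast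

context
  fixes f :: "'a::complex_normed_vector \<Rightarrow> 'b::complex_normed_vector"
  assumes f: "bounded_clinear_op f"
begin

lemma bounded_clinear_op_add: "f (x + y) = f x + f y"
  and bounded_clinear_op_scaleC: "f (c *\<^sub>C x) = c *\<^sub>C f x"
  and bounded_clinear_op_bound: "\<exists>K. \<forall>x. norm (f x) \<le> K * norm x"
  using f by (auto simp: bounded_clinear_op_def clinear_on_def)

lemma bounded_clinear_op_pos_bound: "\<exists>K>0. \<forall>x. norm (f x) \<le> K * norm x"
proof -
  obtain K where K: "\<And>x. norm (f x) \<le> K * norm x" using bounded_clinear_op_bound by blast
  have "norm (f x) \<le> (\<bar>K\<bar> + 1) * norm x" for x
    using K[of x] by (rule order_trans) (simp add: mult_right_mono)
  then show ?thesis by (intro exI[of _ "\<bar>K\<bar> + 1"]) simp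
qed

lemma bounded_clinear_op_bounded_linear: "bounded_linear f"
proof -
  obtain K where "\<And>x. norm (f x) \<le> K * norm x" using bounded_clinear_op_bound by blast
  then show ?thesis
    by (intro bounded_linear_intro[where K = K])
      (simp_all add: bounded_clinear_op_add bounded_clinear_op_scaleC scaleR_scaleC mult.commute)
qed

lemma bounded_clinear_op_diff: "f (x - y) = f x - f y"
  and bounded_clinear_op_minus: "f (- x) = - f x"
  and bounded_clinear_op_zero: "f 0 = 0"
  and bounded_clinear_op_sum: "f (sum g I) = (\<Sum>i\<in>I. f (g i))"
  using linear_simps[OF bounded_clinear_op_bounded_linear]
    Real_Vector_Spaces.linear_sum[OF bounded_linear.linear[OF bounded_clinear_op_bounded_linear]] by auto

lemmas bounded_clinear_op_simps = bounded_clinear_op_add bounded_clinear_op_scaleC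
  bounded_clinear_op_diff bounded_clinear_op_minus bounded_clinear_op_zero bounded_clinear_op_sum

end

lemma bounded_clinear_op_id: "bounded_clinear_op (\<lambda>x. x)"
  by (rule bounded_clinear_opI[where K = 1]) simp_all

lemma bounded_clinear_op_scale:
  assumes "bounded_clinear_op f" shows "bounded_clinear_op (\<lambda>x. c *\<^sub>C f x)"
proof -
  obtain K where K: "\<And>x. norm (f x) \<le> K * norm x"
    using bounded_clinear_op_bound[OF assms] by blast
  show ?thesis
  proof (rule bounded_clinear_opI[where K = "cmod c * K"])
    show "norm (c *\<^sub>C f x) \<le> cmod c * K * norm x" for x
      using mult_left_mono[OF K[of x], of "cmod c"] by (simp add: norm_scaleC mult.assoc)
  qed (simp_all add: bounded_clinear_op_simps[OF assms] scaleC_add_right scaleC_scaleC mult.commute)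
qed

lemma bounded_clinear_op_plus:
  assumes "bounded_clinear_op f" "bounded_clinear_op g"
  shows "bounded_clinear_op (\<lambda>x. f x + g x)"
proof -
  obtain K where K: "\<And>x. norm (f x) \<le> K * norm x"
    using bounded_clinear_op_bound[OF assms(1)] by blast
  obtain L where L: "\<And>x. norm (g x) \<le> L * norm x"
    using bounded_clinear_op_bound[OF assms(2)] by blast
  show ?thesis
  proof (rule bounded_clinear_opI[where K = "K + L"])
    show "norm (f x + g x) \<le> (K + L) * norm x" for x
      using norm_triangle_ineq[of "f x" "g x"] K[of x] L[of x] by (simp add: algebra_simps)
  qed (simp_all add: bounded_clinear_op_simps[OF assms(1)] bounded_clinear_op_simps[OF assms(2)]
      scaleC_add_right)
qed

lemma bounded_clinear_op_minus_op:
  assumes "bounded_clinear_op f" "bounded_clinear_op g"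
  shows "bounded_clinear_op (\<lambda>x. f x - g x)"
  using bounded_clinear_op_plus[OF assms(1) bounded_clinear_op_scale[OF assms(2), of "-1"]]
  by simp

lemma bounded_clinear_op_zero_op: "bounded_clinear_op (\<lambda>x. 0)"
  by (rule bounded_clinear_opI[where K = 0]) simp_all

lemma bounded_clinear_op_sum_op:
  assumes "\<And>i. i \<in> I \<Longrightarrow> bounded_clinear_op (f i)"
  shows "bounded_clinear_op (\<lambda>x. \<Sum>i\<in>I. f i x)"
  using assms
  by (induction I rule: infinite_finite_induct)
    (auto intro: bounded_clinear_op_plus bounded_clinear_op_zero_op)

lemma bounded_clinear_op_compose:
  assumes "bounded_clinear_op f" "bounded_clinear_op g"
  shows "bounded_clinear_op (\<lambda>x. f (g x))"
proof -
  obtain K where K: "K > 0" "\<And>x. norm (f x) \<le> K * norm x"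
    using bounded_clinear_op_pos_bound[OF assms(1)] by blast
  obtain L where L: "\<And>x. norm (g x) \<le> L * norm x"
    using bounded_clinear_op_bound[OF assms(2)] by blast
  show ?thesis
  proof (rule bounded_clinear_opI[where K = "K * L"])
    show "norm (f (g x)) \<le> K * L * norm x" for x
      using order_trans[OF K(2)[of "g x"] mult_left_mono[OF L[of x], of K]] K(1)
      by (simp add: mult.assoc)
  qed (simp_all add: bounded_clinear_op_simps[OF assms(1)] bounded_clinear_op_simps[OF assms(2)])
qed

lemmas bounded_clinear_op_intros = bounded_clinear_op_id bounded_clinear_op_scale
  bounded_clinear_op_plus bounded_clinear_op_minus_op bounded_clinear_op_zero_op
  bounded_clinear_op_sum_op

text \<open>Takes the place of the Neumann series. The contraction factor 1/2 produces the factor 2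
  in the bounds of perturbed resolvents.\<close>

lemma contraction_unique_solution:
  fixes f :: "'a::banach \<Rightarrow> 'a"
  assumes lin: "\<And>x y. f (x - y) = f x - f y" and bd: "\<And>x. norm (f x) \<le> norm x / 2"
  shows "\<exists>!x. x = y + f x" and "x = y + f x \<Longrightarrow> norm x \<le> 2 * norm y"
proof -
  have "\<exists>!x. y + f x = x"
    by (rule banach_fix_type[where c = "1/2"])
      (use bd in \<open>auto simp: dist_norm lin[symmetric]\<close>)
  then show "\<exists>!x. x = y + f x" by metis
  show "norm x \<le> 2 * norm y" if "x = y + f x"
    using norm_triangle_ineq[of y "f x"] bd[of x] that by simp
qed

text \<open>Baire category makes the sublevel set $\|Tx\| \le 1$ dense in a ball; the defect is then
  corrected geometrically, which yields an honest bound because the graph is closed.\<close>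
lemma closed_graph_bounded:
  fixes T :: "'a::banach \<Rightarrow> 'b::banach"
  assumes lin: "linear T"
    and cl: "\<And>X x y. X \<longlonglongrightarrow> x \<Longrightarrow> (\<lambda>n. T (X n)) \<longlonglongrightarrow> y \<Longrightarrow> T x = y"
  shows "\<exists>K. \<forall>x. norm (T x) \<le> K * norm x"
proof -
  define A where "A r = {x. norm (T x) \<le> r}" for r
  interpret T: linear T by (rule lin)
  have "\<exists>n::nat. interior (closure (A (real n))) \<noteq> {}"
  proof (rule ccontr)
    assume "\<not> ?thesis"
    then have e: "interior (closure (A (real n))) = {}" for n by blast
    have "Met_TC.mtopology interior_of \<Union>(range (\<lambda>n. closure (A (real n)))) = {}"
    proof (rule Met_TC.metric_Baire_category_alt)
      show "Met_TC.mcomplete TYPE('a)"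
        using complete_UNIV by (simp add: mcomplete_iff_complete)
    qed (use e in auto)
    moreover have "\<Union>(range (\<lambda>n. closure (A (real n)))) = UNIV"
    proof -
      have "x \<in> closure (A (real (nat \<lceil>norm (T x)\<rceil>)))" for x
        using closure_subset[of "A (real (nat \<lceil>norm (T x)\<rceil>))"]
        by (auto simp: A_def subset_iff real_nat_ceiling_ge)
      then show ?thesis by blast
    qed
    ultimately show False by simp
  qed
  then obtain n x0 where "x0 \<in> interior (closure (A (real n)))" by blast
  then obtain e where e: "e > 0" "ball x0 e \<subseteq> closure (A (real n))"
    using mem_interior by metis
  have n0: "real n + 1 > 0" by simp
  \<comment> \<open>A small \<open>x\<close> is the difference of \<open>x0 + x\<close> and
    \<open>x0\<close>, both in the closure of the sublevel set; subtracting moves the ball to the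
    origin and doubles the bound.\<close>
  have close: "\<exists>a. norm (x - a) < \<epsilon> \<and> norm (T a) \<le> 2 * real n" if x: "norm x < e" and "\<epsilon> > 0" for x \<epsilon>
  proof -
    have "x0 \<in> closure (A (real n))" "x0 + x \<in> closure (A (real n))"
      using e x by (auto simp: subset_iff dist_norm)
    then obtain a b where ab: "a \<in> A (real n)" "dist a x0 < \<epsilon> / 2" "b \<in> A (real n)" "dist b (x0 + x) < \<epsilon> / 2"
      using \<open>\<epsilon> > 0\<close> by (metis closure_approachable half_gt_zero)
    have "norm (x - (b - a)) = norm ((a - x0) - (b - (x0 + x)))" by (simp add: algebra_simps)
    also have "\<dots> < \<epsilon>" using norm_triangle_ineq4[of "a - x0" "b - (x0 + x)"] ab(2,4)
      by (simp add: dist_norm)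
    finally have "norm (x - (b - a)) < \<epsilon>" .
    moreover have "norm (T (b - a)) \<le> 2 * real n"
      using ab norm_triangle_ineq4[of "T b" "T a"] by (simp add: A_def T.diff)
    ultimately show ?thesis by blast
  qed
  \<comment> \<open>Vectors are rescaled to norm at most \<open>e / 2\<close>, strictly inside the
    ball of radius \<open>e\<close>; \<open>q\<close> is the resulting cost per unit of
    norm.\<close>
  define q where "q = 2 * real n / (e / 2)"
  have q0: "q \<ge> 0" using e by (simp add: q_def)
  have step: "\<exists>a. norm (x - a) \<le> \<epsilon> / 2 \<and> norm (T a) \<le> q * \<epsilon>" if "norm x \<le> \<epsilon>" "\<epsilon> > 0" for x \<epsilon>
  proof -
    define t where "t = (e / 2) / \<epsilon>"
    have t: "t > 0" using e that by (simp add: t_def)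
    have "norm (t *\<^sub>R x) \<le> t * \<epsilon>" using that t by (simp add: mult_left_mono)
    also have "\<dots> < e" using that e by (simp add: t_def)
    finally obtain a where a: "norm (t *\<^sub>R x - a) < t * (\<epsilon> / 2)" "norm (T a) \<le> 2 * real n"
      using close[of "t *\<^sub>R x" "t * (\<epsilon> / 2)"] t \<open>\<epsilon> > 0\<close> by (meson half_gt_zero mult_pos_pos)
    have "x - a /\<^sub>R t = (t *\<^sub>R x - a) /\<^sub>R t" using t by (simp add: algebra_simps)
    then have "norm (x - a /\<^sub>R t) = norm (t *\<^sub>R x - a) / t"
      using t by (simp add: divide_inverse mult.commute)
    also have "\<dots> \<le> \<epsilon> / 2" using a(1) t by (simp add: field_simps)
    finally have "norm (x - a /\<^sub>R t) \<le> \<epsilon> / 2" .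
    moreover have "norm (T (a /\<^sub>R t)) \<le> q * \<epsilon>"
    proof -
      have "norm (T (a /\<^sub>R t)) = norm (T a) / t"
        using t by (simp add: T.scale divide_inverse mult.commute)
      also have "\<dots> \<le> 2 * real n / t" using a(2) t by (simp add: divide_right_mono)
      also have "\<dots> = q * \<epsilon>" using that e by (simp add: q_def t_def)
      finally show ?thesis .
    qed
    ultimately show ?thesis by blast
  qed
  have bound1: "norm (T x) \<le> q * 2" if x: "norm x \<le> 1" for x
  proof -
    obtain c where c: "\<And>x \<epsilon>. norm x \<le> \<epsilon> \<Longrightarrow> \<epsilon> > 0 \<Longrightarrow> norm (x - c x \<epsilon>) \<le> \<epsilon> / 2 \<and> norm (T (c x \<epsilon>)) \<le> q * \<epsilon>"
      using step by metis
    \<comment> \<open>\<open>X k\<close> is the residue left after \<open>k\<close> corrections; its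
      bound halves each time, and the images of the corrections form a convergent series.\<close>
    define X where "X = rec_nat x (\<lambda>k y. y - c y ((1/2) ^ k))"
    have X0: "X 0 = x" and XS: "X (Suc k) = X k - c (X k) ((1/2) ^ k)" for k
      by (simp_all add: X_def)
    have Xb: "norm (X k) \<le> (1/2) ^ k" for k
    proof (induction k)
      case 0 then show ?case using x by (simp add: X0)
    next
      case (Suc k)
      then show ?case using c[OF Suc] by (simp add: XS)
    qed
    have Tb: "norm (T (X k - X (Suc k))) \<le> q * (1/2) ^ k" for k
      using c[OF Xb[of k]] by (simp add: XS)
    have sm: "summable (\<lambda>k. q * (1/2::real) ^ k)"
      by (intro summable_mult summable_geometric) simp
    have sT: "summable (\<lambda>k. T (X k - X (Suc k)))"
      by (rule summable_comparison_test'[OF sm]) (use Tb in auto)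
    define y where "y = (\<Sum>k. T (X k - X (Suc k)))"
    have "T x = y"
    proof (rule cl)
      have "X \<longlonglongrightarrow> 0"
        by (rule Lim_null_comparison[where g = "\<lambda>k. (1/2) ^ k"])
          (use Xb in \<open>auto intro!: always_eventually LIMSEQ_realpow_zero\<close>)
      then show "(\<lambda>n. x - X n) \<longlonglongrightarrow> x" by (auto intro!: tendsto_eq_intros)
      have "T (x - X n) = (\<Sum>k<n. T (X k - X (Suc k)))" for n
        by (simp add: T.sum[symmetric] sum_lessThan_telescope' X0)
      then show "(\<lambda>n. T (x - X n)) \<longlonglongrightarrow> y"
        using summable_LIMSEQ[OF sT] by (simp add: y_def)
    qed
    also have "norm y \<le> (\<Sum>k. q * (1/2) ^ k)"
      unfolding y_def by (rule norm_suminf_le) (use Tb sm in auto)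
    also have "(\<Sum>k. q * (1/2) ^ k) = q * 2"
      by (subst suminf_mult) (auto intro!: summable_geometric simp: suminf_geometric)
    finally show ?thesis by simp
  qed
  have "norm (T x) \<le> (q * 2) * norm x" for x
  proof (cases "x = 0")
    case False
    have "norm (T (x /\<^sub>R norm x)) \<le> q * 2" by (rule bound1) (use False in simp)
    then have "norm (T x) / norm x \<le> q * 2"
      using False by (simp add: T.scale divide_inverse mult.commute)
    then show ?thesis using False by (simp add: field_simps)
  qed simp
  then show ?thesis by blast
qed

lemma closed_graph_bounded_clinear:
  fixes T :: "'a::chilbert \<Rightarrow> 'b::chilbert"
  assumes "\<And>x y. T (x + y) = T x + T y" "\<And>c x. T (c *\<^sub>C x) = c *\<^sub>C T x"
    and "\<And>X x y. X \<longlonglongrightarrow> x \<Longrightarrow> (\<lambda>n. T (X n)) \<longlonglongrightarrow> y \<Longrightarrow> T x = y"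
  shows "bounded_clinear_op T"
proof -
  have "linear T" by (rule linearI) (simp_all add: assms(1,2) scaleR_scaleC)
  then obtain K where "\<And>x. norm (T x) \<le> K * norm x"
    using closed_graph_bounded[of T] assms(3) by blast
  then show ?thesis using assms(1,2) by (rule bounded_clinear_opI[rotated 2])
qed

section \<open>Resolvents\<close>

locale clinear_operator =
  fixes D :: "'a::chilbert set" and A :: "'a \<Rightarrow> 'a"
  assumes csubspace_dom: "csubspace D" and clinear_on_dom: "clinear_on D A"
begin

abbreviation "R \<equiv> cresolvent D A"
abbreviation "\<rho> \<equiv> cresolvent_set D A"

lemma dom_add: "x \<in> D \<Longrightarrow> y \<in> D \<Longrightarrow> x + y \<in> D"
  and dom_scaleC: "x \<in> D \<Longrightarrow> c *\<^sub>C x \<in> D"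
  using csubspace_dom unfolding csubspace_def
  by (auto intro: cvs.subspace_add cvs.subspace_scale)

lemma op_add: "x \<in> D \<Longrightarrow> y \<in> D \<Longrightarrow> A (x + y) = A x + A y"
  and op_scaleC: "x \<in> D \<Longrightarrow> A (c *\<^sub>C x) = c *\<^sub>C A x"
  using clinear_on_dom by (auto simp: clinear_on_def)

lemma resolvent_ex1: "z \<in> \<rho> \<Longrightarrow> \<exists>!x. x \<in> D \<and> z *\<^sub>C x - A x = y"
  and resolvent_bounded: "z \<in> \<rho> \<Longrightarrow> bounded_clinear_op (R z)"
  by (auto simp: cresolvent_set_def)

lemma resolvent_mem: "z \<in> \<rho> \<Longrightarrow> R z y \<in> D"
  and resolvent_eq: "z \<in> \<rho> \<Longrightarrow> z *\<^sub>C R z y - A (R z y) = y"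
  using theI'[OF resolvent_ex1, of z y] by (auto simp: cresolvent_def)

lemma resolvent_eqI: "z \<in> \<rho> \<Longrightarrow> x \<in> D \<Longrightarrow> z *\<^sub>C x - A x = y \<Longrightarrow> R z y = x"
  unfolding cresolvent_def by (rule the1_equality[OF resolvent_ex1]) auto

lemma resolvent_setI:
  assumes ex1: "\<And>y. \<exists>!x. x \<in> D \<and> z *\<^sub>C x - A x = y"
    and bd: "\<And>x. x \<in> D \<Longrightarrow> norm x \<le> K * norm (z *\<^sub>C x - A x)"
  shows "z \<in> \<rho>" and "norm (R z y) \<le> K * norm y"
proof -
  have R: "R z y \<in> D" "z *\<^sub>C R z y - A (R z y) = y" for y
    using theI'[OF ex1, of y] by (auto simp: cresolvent_def)
  have RI: "R z y = x" if "x \<in> D" "z *\<^sub>C x - A x = y" for x y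
    unfolding cresolvent_def by (rule the1_equality[OF ex1]) (use that in auto)
  show b: "norm (R z y) \<le> K * norm y" for y
    using bd[OF R(1)[of y]] by (simp add: R(2))
  have "bounded_clinear_op (R z)"
  proof (rule bounded_clinear_opI[where K = K])
    show "R z (x + y) = R z x + R z y" for x y
    proof (rule RI)
      have "z *\<^sub>C (R z x + R z y) - A (R z x + R z y)
          = (z *\<^sub>C R z x - A (R z x)) + (z *\<^sub>C R z y - A (R z y))"
        by (simp add: op_add R(1) scaleC_add_right)
      then show "z *\<^sub>C (R z x + R z y) - A (R z x + R z y) = x + y" by (simp only: R(2))
    qed (simp add: dom_add R(1))
    show "R z (c *\<^sub>C x) = c *\<^sub>C R z x" for c x
    proof (rule RI)
      have "z *\<^sub>C c *\<^sub>C R z x - A (c *\<^sub>C R z x) = c *\<^sub>C (z *\<^sub>C R z x - A (R z x))"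
        by (simp add: op_scaleC R(1) cvs.scale_right_diff_distrib mult.commute)
      then show "z *\<^sub>C c *\<^sub>C R z x - A (c *\<^sub>C R z x) = c *\<^sub>C x" by (simp only: R(2))
    qed (simp add: dom_scaleC R(1))
  qed (rule b)
  with ex1 show "z \<in> \<rho>" by (simp add: cresolvent_set_def)
qed

text \<open>Applying \<open>R z\<close> turns the equation into the fixed point problem
  \<open>x = R z y + R z (B x)\<close>, a contraction with factor \<open>M * \<eta>\<close>. It
  serves two purposes: shifting the spectral parameter and replacing the operator.\<close>

lemma perturbed_equation:
  assumes z: "z \<in> \<rho>" and M: "\<And>y. norm (R z y) \<le> M * norm y" "M \<ge> 0"
    and B: "\<And>x y. B (x - y) = B x - B y" "\<And>x. norm (B x) \<le> \<eta> * norm x" and "M * \<eta> \<le> 1 / 2"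
  shows "\<exists>!x. x \<in> D \<and> z *\<^sub>C x - A x - B x = y"
    and "x \<in> D \<Longrightarrow> norm x \<le> 2 * M * norm (z *\<^sub>C x - A x - B x)"
proof -
  have eq: "x \<in> D \<and> z *\<^sub>C x - A x - B x = y \<longleftrightarrow> x = R z y + R z (B x)" for x y
  proof -
    have "x \<in> D \<and> z *\<^sub>C x - A x - B x = y \<longleftrightarrow> x \<in> D \<and> z *\<^sub>C x - A x = y + B x"
      by (auto simp: algebra_simps)
    also have "\<dots> \<longleftrightarrow> x = R z (y + B x)"
      using resolvent_eqI[OF z] resolvent_mem[OF z] resolvent_eq[OF z] by metis
    finally show ?thesis by (simp add: bounded_clinear_op_simps[OF resolvent_bounded[OF z]])
  qed
  have lin: "R z (B (x - y)) = R z (B x) - R z (B y)" for x y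
    by (simp add: B(1) bounded_clinear_op_simps[OF resolvent_bounded[OF z]])
  have bd: "norm (R z (B x)) \<le> norm x / 2" for x
  proof -
    have "norm (R z (B x)) \<le> M * (\<eta> * norm x)"
      using order_trans[OF M(1) mult_left_mono[OF B(2) M(2)]] .
    also have "\<dots> \<le> 1 / 2 * norm x"
      using mult_right_mono[OF \<open>M * \<eta> \<le> 1 / 2\<close> norm_ge_zero[of x]] by (simp add: mult.assoc)
    finally show ?thesis by simp
  qed
  note * = contraction_unique_solution[of "\<lambda>x. R z (B x)", OF lin bd]
  show "\<exists>!x. x \<in> D \<and> z *\<^sub>C x - A x - B x = y"
    unfolding eq by (rule *(1))
  show "norm x \<le> 2 * M * norm (z *\<^sub>C x - A x - B x)" if "x \<in> D"
  proof -
    have "norm x \<le> 2 * norm (R z (z *\<^sub>C x - A x - B x))"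
      using *(2) eq that by blast
    also have "\<dots> \<le> 2 * (M * norm (z *\<^sub>C x - A x - B x))" using M(1) by simp
    finally show ?thesis by simp
  qed
qed

lemma resolvent_near:
  assumes w: "w \<in> \<rho>" and M: "\<And>y. norm (R w y) \<le> M * norm y" "M \<ge> 0" and "M * cmod (w - z) \<le> 1 / 2"
  shows "z \<in> \<rho>" and "norm (R z y) \<le> 2 * M * norm y"
proof -
  have eq: "w *\<^sub>C x - A x - (w - z) *\<^sub>C x = z *\<^sub>C x - A x" for x
    by (simp add: cvs.scale_left_diff_distrib)
  note p = perturbed_equation[OF w M, of "\<lambda>x. (w - z) *\<^sub>C x" "cmod (w - z)", unfolded eq]
  have 1: "\<exists>!x. x \<in> D \<and> z *\<^sub>C x - A x = y" for y
    by (rule p(1)) (use assms in \<open>auto simp: cvs.scale_right_diff_distrib norm_scaleC\<close>)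
  have 2: "norm x \<le> 2 * M * norm (z *\<^sub>C x - A x)" if "x \<in> D" for x
    by (rule p(2)) (use assms that in \<open>auto simp: cvs.scale_right_diff_distrib norm_scaleC\<close>)
  show "z \<in> \<rho>" "norm (R z y) \<le> 2 * M * norm y"
    using resolvent_setI[OF 1 2] by blast+
qed

lemma resolvent_locally_bounded:
  assumes "w \<in> \<rho>"
  obtains e M where "e > 0" "M > 0" "ball w e \<subseteq> \<rho>" "\<And>z y. z \<in> ball w e \<Longrightarrow> norm (R z y) \<le> M * norm y"
proof -
  obtain M where M: "M > 0" "\<And>y. norm (R w y) \<le> M * norm y"
    using bounded_clinear_op_pos_bound[OF resolvent_bounded[OF assms]] by blast
  have "M * cmod (w - z) \<le> 1 / 2" if "z \<in> ball w (1 / (2 * M))" for z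
    using that M(1) by (simp add: dist_norm field_simps)
  then show thesis
    using that[of "1 / (2 * M)" "2 * M"] resolvent_near[OF assms M(2)] M(1) by (simp add: subset_iff)
qed

lemma open_resolvent_set: "open \<rho>"
  unfolding open_contains_ball using resolvent_locally_bounded by metis

lemma resolvent_bounded_on_compact:
  assumes "compact K" "K \<subseteq> \<rho>"
  obtains M where "M > 0" "\<And>z y. z \<in> K \<Longrightarrow> norm (R z y) \<le> M * norm y"
proof -
  have "\<exists>e M. e > 0 \<and> M > 0 \<and> (\<forall>z\<in>ball w e. \<forall>y. norm (R z y) \<le> M * norm y)" if "w \<in> K" for w
    using resolvent_locally_bounded[of w] that assms(2) by (metis subsetD)
  then obtain e M where eM: "\<And>w. w \<in> K \<Longrightarrow> e w > 0" "\<And>w. w \<in> K \<Longrightarrow> M w > 0"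
    "\<And>w z y. w \<in> K \<Longrightarrow> z \<in> ball w (e w) \<Longrightarrow> norm (R z y) \<le> M w * norm y"
    by metis
  obtain F where F: "finite F" "F \<subseteq> K" "K \<subseteq> (\<Union>w\<in>F. ball w (e w))"
    using compactE_image[OF assms(1), of K "\<lambda>w. ball w (e w)"] eM(1)
    by (metis (no_types, lifting) UN_I centre_in_ball open_ball subsetI)
  \<comment> \<open>A sum dominates all of the finitely many constants; the summand 1 keeps the
    bound positive when \<open>F\<close> is empty.\<close>
  define B where "B = (\<Sum>w\<in>F. M w) + 1"
  have nn: "0 \<le> M w" if "w \<in> F" for w using eM(2) F(2) that by (meson less_imp_le subsetD)
  have B: "M w \<le> B" if "w \<in> F" for w
    using member_le_sum[of w F M] nn that F(1) by (simp add: B_def)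
  show thesis
  proof (rule that)
    show "B > 0" using sum_nonneg[of F M] nn by (simp add: B_def add.commute add_pos_nonneg)
    fix z y assume "z \<in> K"
    then obtain w where w: "w \<in> F" "z \<in> ball w (e w)" using F(3) by blast
    have "norm (R z y) \<le> M w * norm y" using eM(3) w F(2) by blast
    also have "\<dots> \<le> B * norm y" using B[OF w(1)] by (simp add: mult_right_mono)
    finally show "norm (R z y) \<le> B * norm y" .
  qed
qed

lemma resolvent_identity:
  assumes "z \<in> \<rho>" "w \<in> \<rho>"
  shows "R z y - R w y = (w - z) *\<^sub>C R z (R w y)"
proof -
  let ?u = "R w y" let ?v = "R z ?u"
  have "R z y = ?u + (w - z) *\<^sub>C ?v"
  proof (rule resolvent_eqI[OF assms(1)])
    have "A (?u + (w - z) *\<^sub>C ?v) = A ?u + (w - z) *\<^sub>C A ?v"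
      by (simp add: op_add op_scaleC resolvent_mem assms dom_scaleC)
    then have "z *\<^sub>C (?u + (w - z) *\<^sub>C ?v) - A (?u + (w - z) *\<^sub>C ?v)
       = (w *\<^sub>C ?u - A ?u) - (w - z) *\<^sub>C ?u + (w - z) *\<^sub>C (z *\<^sub>C ?v - A ?v)"
      by (simp add: scaleC_add_right cvs.scale_right_diff_distrib cvs.scale_left_diff_distrib
          algebra_simps)
    then show "z *\<^sub>C (?u + (w - z) *\<^sub>C ?v) - A (?u + (w - z) *\<^sub>C ?v) = y"
      by (simp add: resolvent_eq assms)
  qed (simp add: dom_add dom_scaleC resolvent_mem assms)
  then show ?thesis by simp
qed

lemma resolvent_commute:
  assumes "z \<in> \<rho>" "w \<in> \<rho>"
  shows "R z (R w y) = R w (R z y)"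
proof (cases "z = w")
  case False
  have "(w - z) *\<^sub>C R z (R w y) = (w - z) *\<^sub>C R w (R z y)"
    using resolvent_identity[OF assms, of y] resolvent_identity[OF assms(2,1), of y]
    by (metis cvs.scale_minus_left minus_diff_eq)
  then show ?thesis using False by simp
qed simp

lemma commute_resolvent:
  assumes B: "bounded_clinear_op B" "\<And>x. x \<in> D \<Longrightarrow> B x \<in> D" "\<And>x. x \<in> D \<Longrightarrow> A (B x) = B (A x)"
    and "z \<in> \<rho>"
  shows "R z (B y) = B (R z y)"
proof (rule resolvent_eqI)
  have "z *\<^sub>C B (R z y) - A (B (R z y)) = B (z *\<^sub>C R z y - A (R z y))"
    using B resolvent_mem assms by (simp add: bounded_clinear_op_simps[OF B(1)])
  then show "z *\<^sub>C B (R z y) - A (B (R z y)) = B y" by (simp add: resolvent_eq assms)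
qed (use B resolvent_mem assms in auto)

lemma continuous_on_resolvent: "continuous_on \<rho> (\<lambda>z. R z y)"
proof (rule continuous_at_imp_continuous_on, rule ballI)
  fix w assume w: "w \<in> \<rho>"
  obtain e M where e: "e > 0" "M > 0" "ball w e \<subseteq> \<rho>" "\<And>z y. z \<in> ball w e \<Longrightarrow> norm (R z y) \<le> M * norm y"
    using resolvent_locally_bounded[OF w] by blast
  have "((\<lambda>z. R z y - R w y) \<longlongrightarrow> 0) (at w)"
  proof (rule Lim_null_comparison)
    have "\<forall>\<^sub>F z in at w. z \<in> ball w e"
      using e(1) by (intro eventually_at_in_open') auto
    then show "\<forall>\<^sub>F z in at w. norm (R z y - R w y) \<le> cmod (w - z) * (M * norm (R w y))"
    proof eventually_elim
      case (elim z)
      then have "z \<in> \<rho>" using e(3) by blast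
      then show ?case
        using e(4)[OF elim, of "R w y"] by (simp add: resolvent_identity w norm_scaleC mult_left_mono)
    qed
    show "((\<lambda>z. cmod (w - z) * (M * norm (R w y))) \<longlongrightarrow> 0) (at w)"
      by (auto intro!: tendsto_eq_intros)
  qed
  then show "isCont (\<lambda>z. R z y) w" by (simp add: isCont_def LIM_zero_iff)
qed

text \<open>By the resolvent identity the difference quotient is exactly
  \<open>- cinner (R z (R w y)) u\<close>, so pointwise continuity of the resolvent
  suffices.\<close>

lemma holomorphic_on_cinner_resolvent: "(\<lambda>z. cinner (R z y) u) holomorphic_on \<rho>"
proof -
  have "((\<lambda>z. cinner (R z y) u) has_field_derivative - cinner (R w (R w y)) u) (at w)" if w: "w \<in> \<rho>" for w
    unfolding has_field_derivative_iff
  proof (rule Lim_transform_eventually)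
    have "isCont (\<lambda>z. R z (R w y)) w"
      using continuous_on_resolvent open_resolvent_set w continuous_on_eq_continuous_at by blast
    then have "((\<lambda>z. R z (R w y)) \<longlongrightarrow> R w (R w y)) (at w)" by (simp add: isCont_def)
    then show "((\<lambda>z. - cinner (R z (R w y)) u) \<longlongrightarrow> - cinner (R w (R w y)) u) (at w)"
      by (intro tendsto_minus bounded_linear.tendsto[OF bounded_linear_cinner_left])
    have "\<forall>\<^sub>F z in at w. z \<in> \<rho>"
      using open_resolvent_set w by (intro eventually_at_in_open') auto
    moreover have "\<forall>\<^sub>F z in at w. z \<noteq> w" by (simp add: eventually_at_filter)
    ultimately show "\<forall>\<^sub>F z in at w. - cinner (R z (R w y)) u = (cinner (R z y) u - cinner (R w y) u) / (z - w)"
    proof eventually_elim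
      case (elim z)
      have "cinner (R z y) u - cinner (R w y) u = (w - z) * cinner (R z (R w y)) u"
        using resolvent_identity[OF elim(1) w, of y] by (metis cinner_left_simps(2) cinner_scaleC_left)
      then show ?case using elim(2) by (simp add: field_simps)
    qed
  qed
  then show ?thesis
    using open_resolvent_set by (auto simp: holomorphic_on_open)
qed

end

lemma clinear_operator_bounded:
  "bounded_clinear_op (T :: 'a::chilbert \<Rightarrow> 'a) \<Longrightarrow> clinear_operator UNIV T"
  by unfold_locales (simp_all add: bounded_clinear_op_def csubspace_def cvs.subspace_UNIV)

text \<open>Bijectivity suffices by the closed graph theorem. This lets regular points be
  transferred between H and V by algebra alone.\<close>

lemma bounded_op_resolvent_setI:
  fixes T :: "'a::chilbert \<Rightarrow> 'a"
  assumes T: "bounded_clinear_op T" and ex1: "\<And>y. \<exists>!x. z *\<^sub>C x - T x = y"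
  shows "z \<in> cresolvent_set UNIV T"
proof -
  interpret clinear_operator UNIV T by (rule clinear_operator_bounded[OF T])
  define S where "S y = (THE x. z *\<^sub>C x - T x = y)" for y
  have S: "z *\<^sub>C S y - T (S y) = y" for y
    unfolding S_def by (rule theI'[OF ex1])
  have SI: "S y = x" if "z *\<^sub>C x - T x = y" for x y
    unfolding S_def by (rule the1_equality[OF ex1 that])
  note T_simps = bounded_clinear_op_simps[OF T]
  have "bounded_clinear_op S"
  proof (rule closed_graph_bounded_clinear)
    show "S (x + y) = S x + S y" for x y
    proof (rule SI)
      have "z *\<^sub>C (S x + S y) - T (S x + S y) = (z *\<^sub>C S x - T (S x)) + (z *\<^sub>C S y - T (S y))"
        by (simp add: T_simps scaleC_add_right)
      then show "z *\<^sub>C (S x + S y) - T (S x + S y) = x + y" by (simp only: S)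
    qed
    show "S (c *\<^sub>C x) = c *\<^sub>C S x" for c x
    proof (rule SI)
      have "z *\<^sub>C c *\<^sub>C S x - T (c *\<^sub>C S x) = c *\<^sub>C (z *\<^sub>C S x - T (S x))"
        by (simp add: T_simps cvs.scale_right_diff_distrib mult.commute)
      then show "z *\<^sub>C c *\<^sub>C S x - T (c *\<^sub>C S x) = c *\<^sub>C x" by (simp only: S)
    qed
    fix X x y assume X: "X \<longlonglongrightarrow> x" "(\<lambda>n. S (X n)) \<longlonglongrightarrow> y"
    have "(\<lambda>n. z *\<^sub>C S (X n) - T (S (X n))) \<longlonglongrightarrow> z *\<^sub>C y - T y"
      by (intro tendsto_intros X(2) bounded_linear.tendsto[OF bounded_clinear_op_bounded_linear[OF T]])
    then have "z *\<^sub>C y - T y = x" using X(1) LIMSEQ_unique by (simp add: S) blast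
    then show "S x = y" by (rule SI)
  qed
  then obtain K where K: "\<And>y. norm (S y) \<le> K * norm y" using bounded_clinear_op_bound by blast
  show ?thesis
  proof (rule resolvent_setI(1))
    show "\<exists>!x. x \<in> UNIV \<and> z *\<^sub>C x - T x = y" for y using ex1 by simp
    show "norm x \<le> K * norm (z *\<^sub>C x - T x)" for x
      using K[of "z *\<^sub>C x - T x"] SI[of x] by simp
  qed
qed

section \<open>Vector-valued contour integrals\<close>

text \<open>\<open>integral\<close> takes the default value 0 on a non-integrable function, so
  integrability has to be carried along before linearity is used.\<close>

definition vcontour_integrable :: "(real \<Rightarrow> complex) \<Rightarrow> (complex \<Rightarrow> 'a::complex_normed_vector) \<Rightarrow> bool" where
  "vcontour_integrable \<gamma> f \<longleftrightarrow>
     (\<lambda>t. vector_derivative \<gamma> (at t within {0..1}) *\<^sub>C f (\<gamma> t)) integrable_on {0..1}"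

lemma vcontour_integral_cong:
  assumes "\<And>z. z \<in> path_image p \<Longrightarrow> f z = g z"
  shows "vcontour_integral p f = vcontour_integral p g"
  unfolding vcontour_integral_def
  by (rule integral_cong) (use assms in \<open>auto simp: path_image_def\<close>)

lemma
  assumes "vcontour_integrable p f" "bounded_clinear_op B"
  shows vcontour_integrable_linear: "vcontour_integrable p (\<lambda>z. B (f z))"
    and vcontour_integral_linear: "vcontour_integral p (\<lambda>z. B (f z)) = B (vcontour_integral p f)"
  using integrable_linear[OF assms(1)[unfolded vcontour_integrable_def]
      bounded_clinear_op_bounded_linear[OF assms(2)]]
    integral_linear[OF assms(1)[unfolded vcontour_integrable_def]
      bounded_clinear_op_bounded_linear[OF assms(2)]]
  by (simp_all add: vcontour_integrable_def vcontour_integral_def o_def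
      bounded_clinear_op_simps[OF assms(2)])

lemma vcontour_integral_scaleC:
  "vcontour_integrable p f \<Longrightarrow> vcontour_integral p (\<lambda>z. c *\<^sub>C f z) = c *\<^sub>C vcontour_integral p f"
  using vcontour_integral_linear[OF _ bounded_clinear_op_scale[OF bounded_clinear_op_id]] .

lemma vcontour_integral_add:
  assumes "vcontour_integrable p f" "vcontour_integrable p g"
  shows "vcontour_integral p (\<lambda>z. f z + g z) = vcontour_integral p f + vcontour_integral p g"
  using integral_add assms unfolding vcontour_integrable_def vcontour_integral_def
  by (simp add: scaleC_add_right integral_add)

lemma vcontour_integral_diff:
  assumes "vcontour_integrable p f" "vcontour_integrable p g"
  shows "vcontour_integral p (\<lambda>z. f z - g z) = vcontour_integral p f - vcontour_integral p g"
  using assms unfolding vcontour_integrable_def vcontour_integral_def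
  by (simp add: cvs.scale_right_diff_distrib integral_diff)

lemma
  assumes "vcontour_integrable p f"
  shows cinner_vcontour_integral:
      "cinner (vcontour_integral p f) u = contour_integral p (\<lambda>z. cinner (f z) u)"
    and contour_integrable_cinner: "(\<lambda>z. cinner (f z) u) contour_integrable_on p"
proof -
  have "((\<lambda>t. cinner (vector_derivative p (at t within {0..1}) *\<^sub>C f (p t)) u)
      has_integral cinner (vcontour_integral p f) u) {0..1}"
    using has_integral_linear[OF integrable_integral bounded_linear_cinner_left] assms
    unfolding vcontour_integrable_def vcontour_integral_def o_def .
  then have "((\<lambda>z. cinner (f z) u) has_contour_integral cinner (vcontour_integral p f) u) p"
    by (simp add: has_contour_integral_def cinner_scaleC_left mult.commute)
  then show "cinner (vcontour_integral p f) u = contour_integral p (\<lambda>z. cinner (f z) u)"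
    "(\<lambda>z. cinner (f z) u) contour_integrable_on p"
    by (auto simp: contour_integral_unique contour_integrable_on_def)
qed

section \<open>Contour integrals along polynomial paths\<close>

lemma polynomial_path_derivative:
  fixes p :: "real \<Rightarrow> complex"
  assumes "polynomial_function p"
  obtains p' where "continuous_on {0..1} p'"
    "\<And>t. t \<in> {0..1} \<Longrightarrow> vector_derivative p (at t within {0..1}) = p' t"
proof -
  obtain p' where p': "polynomial_function p'" "\<And>x. (p has_vector_derivative p' x) (at x)"
    using has_vector_derivative_polynomial_function[OF assms] by blast
  show thesis
  proof (rule that)
    show "continuous_on {0..1} p'" by (rule continuous_on_polymonial_function[OF p'(1)])
    show "vector_derivative p (at t within {0..1}) = p' t" if "t \<in> {0..1}" for t
      using vector_derivative_at_within_ivl[OF p'(2), of 0 t 1] that by simp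
  qed
qed

lemma continuous_on_polynomial_path_integrand:
  fixes f :: "complex \<Rightarrow> 'a::complex_normed_vector"
  assumes "polynomial_function p" "continuous_on (path_image p) f"
  shows "continuous_on {0..1} (\<lambda>t. vector_derivative p (at t within {0..1}) *\<^sub>C f (p t))"
proof -
  obtain p' where p': "continuous_on {0..1} p'"
    "\<And>t. t \<in> {0..1} \<Longrightarrow> vector_derivative p (at t within {0..1}) = p' t"
    using polynomial_path_derivative[OF assms(1)] by blast
  have "continuous_on {0..1} (\<lambda>t. p' t *\<^sub>C f (p t))"
    using assms by (intro continuous_on_scaleC p' continuous_on_compose2[OF assms(2)]
        continuous_on_polymonial_function) (auto simp: path_image_def)
  then show ?thesis by (rule continuous_on_eq) (simp add: p'(2))
qed

lemma vcontour_integrable_continuous: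
  fixes f :: "complex \<Rightarrow> 'a::chilbert"
  assumes "polynomial_function p" "continuous_on (path_image p) f"
  shows "vcontour_integrable p f"
  unfolding vcontour_integrable_def
  by (rule integrable_continuous_real[OF continuous_on_polynomial_path_integrand[OF assms]])

text \<open>\<open>L\<close> bounds the speed of the path and depends on neither \<open>f\<close>
  nor \<open>M\<close>, so one constant serves every perturbed operator.\<close>

lemma vcontour_integral_bound:
  assumes "polynomial_function p"
  obtains L where "L > 0" "\<And>(f :: complex \<Rightarrow> 'a::chilbert) M. continuous_on (path_image p) f \<Longrightarrow>
     (\<And>z. z \<in> path_image p \<Longrightarrow> norm (f z) \<le> M) \<Longrightarrow> norm (vcontour_integral p f) \<le> L * M"
proof -
  obtain p' where p': "continuous_on {0..1} p'"
    "\<And>t. t \<in> {0..1} \<Longrightarrow> vector_derivative p (at t within {0..1}) = p' t"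
    using polynomial_path_derivative[OF assms(1)] by blast
  have "bounded (p' ` {0..1})"
    using compact_continuous_image[OF p'(1)] compact_imp_bounded by blast
  then obtain L where L: "L > 0" "\<And>t. t \<in> {0..1} \<Longrightarrow> norm (p' t) \<le> L"
    by (metis bounded_pos image_eqI)
  show thesis
  proof (rule that)
    fix f :: "complex \<Rightarrow> 'a" and M
    assume f: "continuous_on (path_image p) f" "\<And>z. z \<in> path_image p \<Longrightarrow> norm (f z) \<le> M"
    have "norm (integral {0..1} (\<lambda>t. vector_derivative p (at t within {0..1}) *\<^sub>C f (p t))) \<le> L * M * (1 - 0)"
    proof (rule integral_bound)
      fix t :: real assume t: "t \<in> {0..1}"
      then have "p t \<in> path_image p" by (auto simp: path_image_def)
      then show "norm (vector_derivative p (at t within {0..1}) *\<^sub>C f (p t)) \<le> L * M"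
        using t f(2) L by (simp add: norm_scaleC p'(2) mult_mono)
    qed (simp_all add: continuous_on_polynomial_path_integrand assms f)
    then show "norm (vcontour_integral p f) \<le> L * M" by (simp add: vcontour_integral_def)
  qed (rule L)
qed

lemma vcontour_integral_scaleC_const:
  fixes x :: "'a::chilbert"
  assumes "polynomial_function p" "continuous_on (path_image p) g"
  shows "vcontour_integral p (\<lambda>z. g z *\<^sub>C x) = contour_integral p g *\<^sub>C x"
proof (rule cinner_eqI)
  fix u
  obtain p' where p': "continuous_on {0..1} p'"
    "\<And>t. t \<in> {0..1} \<Longrightarrow> vector_derivative p (at t within {0..1}) = p' t"
    using polynomial_path_derivative[OF assms(1)] by blast
  have "continuous_on {0..1} (\<lambda>t. g (p t) * p' t)"
    using assms(1) by (intro continuous_on_mult p' continuous_on_compose2[OF assms(2)]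
        continuous_on_polymonial_function) (auto simp: path_image_def)
  then have "continuous_on {0..1} (\<lambda>t. g (p t) * vector_derivative p (at t within {0..1}))"
    by (rule continuous_on_eq) (simp add: p'(2))
  then have g: "g contour_integrable_on p"
    using integrable_continuous_real
    by (auto simp: contour_integrable_on_def has_contour_integral_def integrable_on_def)
  have "vcontour_integrable p (\<lambda>z. g z *\<^sub>C x)"
    by (intro vcontour_integrable_continuous assms continuous_intros)
  then show "cinner (vcontour_integral p (\<lambda>z. g z *\<^sub>C x)) u = cinner (contour_integral p g *\<^sub>C x) u"
    by (simp add: cinner_vcontour_integral cinner_scaleC_left contour_integral_rmul[OF g])
qed

section \<open>Weakly holomorphic functions along valid paths\<close>

definition weakly_holomorphic_on :: "(complex \<Rightarrow> 'a::chilbert) \<Rightarrow> complex set \<Rightarrow> bool" where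
  "weakly_holomorphic_on f U \<longleftrightarrow>
     continuous_on U f \<and> (\<forall>u. (\<lambda>z. cinner (f z) u) holomorphic_on U)"

lemma weakly_holomorphic_on_subset:
  "weakly_holomorphic_on f U \<Longrightarrow> V \<subseteq> U \<Longrightarrow> weakly_holomorphic_on f V"
  unfolding weakly_holomorphic_on_def by (meson continuous_on_subset holomorphic_on_subset)

lemma vector_derivative_linepath_Icc:
  "t \<in> {0..1} \<Longrightarrow> vector_derivative (linepath a b) (at t within {0..1}) = (b - a :: complex)"
  by (rule vector_derivative_at_within_ivl[where a = 0 and b = 1])
    (auto intro: has_vector_derivative_linepath_within)

text \<open>Weak holomorphy gives path independence of the segment integrals, since each pairing has
  a scalar primitive; norm continuity, the other half of \<open>weakly_holomorphic_on\<close>, then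
  makes the integral from the centre differentiable in norm.\<close>

lemma weakly_holomorphic_primitive:
  assumes f: "weakly_holomorphic_on f (ball a e)"
  shows "\<exists>F. \<forall>z\<in>ball a e. (F has_derivative (\<lambda>h. h *\<^sub>C f z)) (at z)"
proof -
  let ?B = "ball a e"
  define I where "I z w = vcontour_integral (linepath z w) f" for z w
  have contf: "continuous_on ?B f" using f by (simp add: weakly_holomorphic_on_def)
  have seg: "path_image (linepath z w) \<subseteq> ?B" if "z \<in> ?B" "w \<in> ?B" for z w
    using that by (simp add: closed_segment_subset)
  have poly: "polynomial_function (linepath z w)" for z w :: complex
    unfolding linepath_def by (intro polynomial_function_add polynomial_function_mult) auto
  have int: "vcontour_integrable (linepath z w) f" if "z \<in> ?B" "w \<in> ?B" for z w
    using vcontour_integrable_continuous[OF poly continuous_on_subset[OF contf seg[OF that]]] .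
  have I_diff: "I a w - I a z = I z w" if zw: "z \<in> ?B" "w \<in> ?B" for z w
  proof (rule cinner_eqI)
    fix u
    obtain g where g: "\<And>x. x \<in> ?B \<Longrightarrow> (g has_field_derivative cinner (f x) u) (at x within ?B)"
      using holomorphic_convex_primitive'[of ?B "\<lambda>z. cinner (f z) u"] f
      by (auto simp: weakly_holomorphic_on_def)
    have *: "cinner (I x y) u = g y - g x" if "x \<in> ?B" "y \<in> ?B" for x y
      using contour_integral_unique[OF contour_integral_primitive[OF g valid_path_linepath seg[OF that]]]
      unfolding I_def by (simp add: cinner_vcontour_integral[OF int[OF that]])
    have "a \<in> ?B" using zw(1) by (metis centre_in_ball dist_not_less_zero mem_ball not_less order_le_less_trans zero_le_dist)
    then show "cinner (I a w - I a z) u = cinner (I z w) u"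
      using zw by (simp add: * cinner_left_simps)
  qed
  have "(I a has_derivative (\<lambda>h. h *\<^sub>C f z)) (at z)" if z: "z \<in> ?B" for z
    unfolding has_derivative_at_alt
  proof (intro conjI allI impI bounded_linear_scaleC_left)
    fix \<epsilon> :: real assume \<epsilon>: "\<epsilon> > 0"
    have "isCont f z" using contf z by (simp add: continuous_on_eq_continuous_at)
    then obtain d where d: "d > 0" "\<And>w. dist w z < d \<Longrightarrow> dist (f w) (f z) < \<epsilon>"
      using \<epsilon> unfolding continuous_at_eps_delta by blast
    obtain d' where d': "d' > 0" "ball z d' \<subseteq> ?B" using z openE[OF open_ball] by blast
    show "\<exists>d>0. \<forall>y. norm (y - z) < d \<longrightarrow> norm (I a y - I a z - (y - z) *\<^sub>C f z) \<le> \<epsilon> * norm (y - z)"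
    proof (intro exI[of _ "min d d'"] conjI allI impI)
      fix w assume w: "norm (w - z) < min d d'"
      then have "w \<in> ball z d'" by (simp add: dist_norm norm_minus_commute)
      then have wB: "w \<in> ?B" using d'(2) by blast
      have near: "dist (linepath z w t) z < d" if "t \<in> {0..1}" for t
      proof -
        have "linepath z w t - z = t *\<^sub>R (w - z)" by (simp add: linepath_def algebra_simps)
        then have "norm (linepath z w t - z) \<le> norm (w - z)"
          using that by (simp add: mult_left_le_one_le)
        then show ?thesis using w by (simp add: dist_norm)
      qed
      have ic: "continuous_on {0..1} (\<lambda>t. (w - z) *\<^sub>C (f (linepath z w t)))"
      proof -
        have "continuous_on {0..1} (\<lambda>t. f (linepath z w t))"
          by (rule continuous_on_compose2[OF contf]) (use seg[OF z wB] in \<open>auto simp: path_image_def\<close>)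
        then show ?thesis by (intro continuous_intros)
      qed
      have "I a w - I a z = integral {0..1} (\<lambda>t. (w - z) *\<^sub>C f (linepath z w t))"
        unfolding I_diff[OF z wB] unfolding I_def vcontour_integral_def
        by (rule integral_cong) (simp add: vector_derivative_linepath_Icc)
      moreover have "(w - z) *\<^sub>C f z = integral {0..1} (\<lambda>t::real. (w - z) *\<^sub>C f z)" by simp
      ultimately have "I a w - I a z - (w - z) *\<^sub>C f z
          = integral {0..1} (\<lambda>t. (w - z) *\<^sub>C f (linepath z w t) - (w - z) *\<^sub>C f z)"
        using ic by (subst integral_diff) (auto intro: integrable_continuous_real)
      also have "norm \<dots> \<le> (cmod (w - z) * \<epsilon>) * (1 - 0)"
      proof (rule integral_bound)
        fix t :: real assume "t \<in> {0..1}"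
        then have "norm (f (linepath z w t) - f z) \<le> \<epsilon>" using less_imp_le[OF d(2)[OF near]] by (simp add: dist_norm)
        then show "norm ((w - z) *\<^sub>C f (linepath z w t) - (w - z) *\<^sub>C f z) \<le> cmod (w - z) * \<epsilon>"
          by (simp add: cvs.scale_right_diff_distrib[symmetric] norm_scaleC mult_left_mono)
      qed (auto intro!: continuous_intros ic)
      finally show "norm (I a w - I a z - (w - z) *\<^sub>C f z) \<le> \<epsilon> * norm (w - z)"
        by (simp add: mult.commute)
    qed (use d d' in auto)
  qed
  then show ?thesis by blast
qed

text \<open>A valid path may have an unbounded derivative near its break points, so integrability is
  not a matter of continuity of the integrand; it comes from local primitives.\<close>
lemma vcontour_integrable_weakly_holomorphic:
  fixes f :: "complex \<Rightarrow> 'a::chilbert"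
  assumes "valid_path \<gamma>" "path_image \<gamma> \<subseteq> U" "open U" and f: "weakly_holomorphic_on f U"
  shows "vcontour_integrable \<gamma> f"
proof -
  have cont: "continuous_on {0..1} \<gamma>"
    using valid_path_imp_path[OF assms(1)] by (simp add: path_def)
  obtain T where T: "finite T" "\<And>t. t \<in> {0..1} - T \<Longrightarrow> \<gamma> differentiable (at t)"
    using assms(1) unfolding valid_path_def piecewise_C1_differentiable_on_def C1_differentiable_on_eq
    by blast
  have "(\<lambda>t. vector_derivative \<gamma> (at t within {0..1}) *\<^sub>C f (\<gamma> t)) integrable_on cbox 0 1"
  proof (rule integrable_on_little_subintervals, rule ballI)
    fix x :: real assume x: "x \<in> cbox 0 1"
    then have "\<gamma> x \<in> U" using assms(2) by (auto simp: path_image_def)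
    then obtain e where e: "e > 0" "ball (\<gamma> x) e \<subseteq> U" using assms(3) openE by blast
    obtain F where F: "\<And>z. z \<in> ball (\<gamma> x) e \<Longrightarrow> (F has_derivative (\<lambda>h. h *\<^sub>C f z)) (at z)"
      using weakly_holomorphic_primitive[OF weakly_holomorphic_on_subset[OF f e(2)]] by blast
    obtain d where d: "d > 0" "\<And>t. t \<in> {0..1} \<Longrightarrow> dist t x < d \<Longrightarrow> dist (\<gamma> t) (\<gamma> x) < e"
      using cont x e(1) unfolding continuous_on_iff by (metis box_real(2))
    show "\<exists>d>0. \<forall>u v. x \<in> cbox u v \<and> cbox u v \<subseteq> ball x d \<and> cbox u v \<subseteq> cbox 0 1 \<longrightarrow>
      (\<lambda>t. vector_derivative \<gamma> (at t within {0..1}) *\<^sub>C f (\<gamma> t)) integrable_on cbox u v"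
    proof (intro exI[of _ d] conjI allI impI d(1))
      fix u v assume uv: "x \<in> cbox u v \<and> cbox u v \<subseteq> ball x d \<and> cbox u v \<subseteq> cbox 0 1"
      have mem: "\<gamma> t \<in> ball (\<gamma> x) e" if "t \<in> {u..v}" for t
        using uv d(2)[of t] that by (auto simp: subset_iff dist_commute)
      \<comment> \<open>The fundamental theorem of calculus asks for no bound on the derivative:
        continuity of the composed primitive and differentiability off the finite set
        \<open>T\<close> are enough.\<close>
      have "((\<lambda>t. vector_derivative \<gamma> (at t within {0..1}) *\<^sub>C f (\<gamma> t)) has_integral (F (\<gamma> v) - F (\<gamma> u))) {u..v}"
      proof (rule fundamental_theorem_of_calculus_interior_strong[OF T(1)])
        show "u \<le> v" using uv by simp
        have F': "continuous_on (ball (\<gamma> x) e) F"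
          using F by (intro continuous_at_imp_continuous_on ballI) (blast intro: has_derivative_continuous)
        show "continuous_on {u..v} (\<lambda>t. F (\<gamma> t))"
          by (rule continuous_on_compose2[OF F' continuous_on_subset[OF cont]]) (use uv mem in auto)
        fix t assume t: "t \<in> {u<..<v} - T"
        then have t01: "t \<in> {0<..<1}" using uv by (auto simp: subset_iff) (metis less_eq_real_def less_le_trans)+
        then have at: "at t within {0..1} = at t" by (simp add: at_within_Icc_at)
        have "\<gamma> differentiable (at t)" using T(2) t t01 by simp
        then have "(\<gamma> has_derivative (\<lambda>s. s *\<^sub>R vector_derivative \<gamma> (at t))) (at t)"
          using vector_derivative_works has_vector_derivative_def by blast
        moreover have "(F has_derivative (\<lambda>h. h *\<^sub>C f (\<gamma> t))) (at (\<gamma> t))"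
          using F mem t by simp
        ultimately have "(F \<circ> \<gamma> has_derivative (\<lambda>h. h *\<^sub>C f (\<gamma> t)) \<circ> (\<lambda>s. s *\<^sub>R vector_derivative \<gamma> (at t))) (at t)"
          by (rule diff_chain_at)
        then show "((\<lambda>t. F (\<gamma> t)) has_vector_derivative vector_derivative \<gamma> (at t within {0..1}) *\<^sub>C f (\<gamma> t)) (at t)"
          by (simp add: has_vector_derivative_def o_def at scaleR_scaleC scaleC_scaleC scaleR_conv_of_real)
      qed
      then show "(\<lambda>t. vector_derivative \<gamma> (at t within {0..1}) *\<^sub>C f (\<gamma> t)) integrable_on cbox u v"
        by (auto simp: integrable_on_def)
    qed
  qed
  then show ?thesis by (simp add: vcontour_integrable_def)
qed

text \<open>Nearby loops give the same integrals of functions holomorphic on \<open>U\<close>. The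
  Cauchy kernel of a point outside \<open>U\<close> is such a function, so winding numbers about
  these points survive too.\<close>

lemma polynomial_loop_approximation:
  assumes "valid_path \<gamma>" "pathfinish \<gamma> = pathstart \<gamma>" "path_image \<gamma> \<subseteq> U" "open U"
  obtains p where "polynomial_function p" "pathfinish p = pathstart p" "path_image p \<subseteq> U"
    "\<And>f. f holomorphic_on U \<Longrightarrow> contour_integral p f = contour_integral \<gamma> f"
    "\<And>z. z \<notin> U \<Longrightarrow> winding_number p z = winding_number \<gamma> z"
proof -
  have path: "path \<gamma>" using assms(1) by (rule valid_path_imp_path)
  obtain d where d: "d > 0"
    "\<And>g h. valid_path g \<Longrightarrow> valid_path h \<Longrightarrow>
       (\<And>t. t \<in> {0..1} \<Longrightarrow> norm (g t - \<gamma> t) < d \<and> norm (h t - \<gamma> t) < d) \<Longrightarrow>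
       pathfinish g = pathstart g \<Longrightarrow> pathfinish h = pathstart h \<Longrightarrow>
       path_image g \<subseteq> U \<and> path_image h \<subseteq> U \<and>
       (\<forall>f. f holomorphic_on U \<longrightarrow> contour_integral h f = contour_integral g f)"
    using contour_integral_nearby_loops[OF assms(4) path assms(3)] by metis
  obtain p where p: "polynomial_function p" "pathstart p = pathstart \<gamma>" "pathfinish p = pathfinish \<gamma>"
    "\<And>t. t \<in> {0..1} \<Longrightarrow> norm (p t - \<gamma> t) < d"
    using path_approx_polynomial_function[OF path d(1)] by blast
  have vp: "valid_path p" using p(1) by (rule valid_path_polynomial_function)
  have *: "path_image p \<subseteq> U" "\<And>f. f holomorphic_on U \<Longrightarrow> contour_integral p f = contour_integral \<gamma> f"
    using d(2)[OF assms(1) vp] p assms(2) d(1) by auto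
  show thesis
  proof (rule that)
    fix z assume z: "z \<notin> U"
    then have "(\<lambda>w. 1 / (w - z)) holomorphic_on U" by (auto intro!: holomorphic_intros)
    then show "winding_number p z = winding_number \<gamma> z"
      using z assms(1,3) * vp by (subst (1 2) winding_number_valid_path) auto
  qed (use p * assms in auto)
qed

lemma vcontour_integral_eqI:
  fixes f :: "complex \<Rightarrow> 'a::chilbert"
  assumes "valid_path \<gamma>" "valid_path p" "path_image \<gamma> \<subseteq> U" "path_image p \<subseteq> U" "open U"
    and "\<And>g. g holomorphic_on U \<Longrightarrow> contour_integral p g = contour_integral \<gamma> g"
    and f: "weakly_holomorphic_on f U"
  shows "vcontour_integral p f = vcontour_integral \<gamma> f"
  using assms by (intro cinner_eqI)
    (simp add: cinner_vcontour_integral vcontour_integrable_weakly_holomorphic weakly_holomorphic_on_def)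

section \<open>Riesz projections along polynomial loops\<close>

locale resolvent_loop = clinear_operator +
  fixes p :: "real \<Rightarrow> complex"
  assumes polynomial_loop: "polynomial_function p" "pathfinish p = pathstart p"
    and loop_subset: "path_image p \<subseteq> \<rho>"
begin

abbreviation "Q \<equiv> riesz D A p"

text \<open>The Cauchy transform of the resolvent. At points of winding number 1 it satisfies
  \<open>(\<mu> - A) (G \<mu> x) = x - Q x\<close>, even if \<open>\<mu>\<close> is
  spectral.\<close>

definition G :: "complex \<Rightarrow> 'a \<Rightarrow> 'a" where
  "G \<mu> x = (1 / (2 * of_real pi * \<i>)) *\<^sub>C vcontour_integral p (\<lambda>z. (1 / (z - \<mu>)) *\<^sub>C R z x)"

lemma valid_loop: "valid_path p"
  using polynomial_loop(1) by (rule valid_path_polynomial_function)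

lemma continuous_on_loop_resolvent [continuous_intros]: "continuous_on (path_image p) (\<lambda>z. R z x)"
  using continuous_on_resolvent loop_subset by (rule continuous_on_subset)

lemma continuous_on_loop_cauchy_kernel:
  "\<mu> \<notin> path_image p \<Longrightarrow> continuous_on (path_image p) (\<lambda>z. (1 / (z - \<mu>)) *\<^sub>C R z x)"
  by (intro continuous_intros) auto

lemma vcontour_integrable_resolvent: "vcontour_integrable p (\<lambda>z. R z x)"
  and vcontour_integrable_cauchy_kernel:
    "\<mu> \<notin> path_image p \<Longrightarrow> vcontour_integrable p (\<lambda>z. (1 / (z - \<mu>)) *\<^sub>C R z x)"
  by (intro vcontour_integrable_continuous polynomial_loop continuous_on_loop_resolvent
      continuous_on_loop_cauchy_kernel; assumption)+

lemma winding_number_loop: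
  "\<mu> \<notin> path_image p \<Longrightarrow> contour_integral p (\<lambda>w. 1 / (w - \<mu>)) = 2 * of_real pi * \<i> * winding_number p \<mu>"
  using valid_loop by (simp add: winding_number_valid_path)

lemma weighted_integral_bounded:
  assumes "continuous_on (path_image p) g"
  shows "bounded_clinear_op (\<lambda>x. c *\<^sub>C vcontour_integral p (\<lambda>z. g z *\<^sub>C R z x))"
proof (rule bounded_clinear_op_scale)
  obtain M where M: "M > 0" "\<And>z y. z \<in> path_image p \<Longrightarrow> norm (R z y) \<le> M * norm y"
    using resolvent_bounded_on_compact[OF compact_valid_path_image[OF valid_loop] loop_subset] by blast
  obtain L where L: "L > 0" "\<And>(f :: complex \<Rightarrow> 'a) M. continuous_on (path_image p) f \<Longrightarrow>
     (\<And>z. z \<in> path_image p \<Longrightarrow> norm (f z) \<le> M) \<Longrightarrow> norm (vcontour_integral p f) \<le> L * M"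
    using vcontour_integral_bound[OF polynomial_loop(1)] by blast
  have "bounded (g ` path_image p)"
    using compact_continuous_image[OF assms compact_valid_path_image[OF valid_loop]] compact_imp_bounded
    by blast
  then obtain N where N: "N > 0" "\<And>z. z \<in> path_image p \<Longrightarrow> norm (g z) \<le> N"
    by (metis bounded_pos image_eqI)
  have cont: "continuous_on (path_image p) (\<lambda>z. g z *\<^sub>C R z x)" for x
    by (intro continuous_intros assms)
  note int = vcontour_integrable_continuous[OF polynomial_loop(1) cont]
  note lin = bounded_clinear_op_simps[OF resolvent_bounded]
  show "bounded_clinear_op (\<lambda>x. vcontour_integral p (\<lambda>z. g z *\<^sub>C R z x))"
  proof (rule bounded_clinear_opI)
    fix x y c
    have "vcontour_integral p (\<lambda>z. g z *\<^sub>C R z (x + y)) = vcontour_integral p (\<lambda>z. g z *\<^sub>C R z x + g z *\<^sub>C R z y)"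
      by (rule vcontour_integral_cong) (use loop_subset in \<open>auto simp: lin scaleC_add_right\<close>)
    then show "vcontour_integral p (\<lambda>z. g z *\<^sub>C R z (x + y)) =
        vcontour_integral p (\<lambda>z. g z *\<^sub>C R z x) + vcontour_integral p (\<lambda>z. g z *\<^sub>C R z y)"
      by (simp add: vcontour_integral_add int)
    have "vcontour_integral p (\<lambda>z. g z *\<^sub>C R z (c *\<^sub>C x)) = vcontour_integral p (\<lambda>z. c *\<^sub>C (g z *\<^sub>C R z x))"
      by (rule vcontour_integral_cong) (use loop_subset in \<open>auto simp: lin mult.commute\<close>)
    then show "vcontour_integral p (\<lambda>z. g z *\<^sub>C R z (c *\<^sub>C x)) = c *\<^sub>C vcontour_integral p (\<lambda>z. g z *\<^sub>C R z x)"
      by (simp only: vcontour_integral_scaleC[OF int])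
    have "norm (vcontour_integral p (\<lambda>z. g z *\<^sub>C R z x)) \<le> L * (N * (M * norm x))"
      by (rule L(2)[OF cont]) (use M N in \<open>auto simp: norm_scaleC intro!: mult_mono\<close>)
    then show "norm (vcontour_integral p (\<lambda>z. g z *\<^sub>C R z x)) \<le> (L * N * M) * norm x"
      by (simp add: mult.assoc)
  qed
qed

lemma riesz_bounded: "bounded_clinear_op Q"
proof -
  have "riesz D A p = (\<lambda>x. (1 / (2 * of_real pi * \<i>)) *\<^sub>C vcontour_integral p (\<lambda>z. 1 *\<^sub>C R z x))"
    by (simp add: riesz_def fun_eq_iff)
  then show ?thesis using weighted_integral_bounded[of "\<lambda>z. 1"] by simp
qed

lemma cauchy_transform_bounded: "\<mu> \<notin> path_image p \<Longrightarrow> bounded_clinear_op (G \<mu>)"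
proof -
  assume "\<mu> \<notin> path_image p"
  then have "continuous_on (path_image p) (\<lambda>z. 1 / (z - \<mu>))" by (intro continuous_intros) auto
  then show ?thesis using weighted_integral_bounded unfolding G_def by blast
qed

lemma cauchy_transform_locally_bounded:
  assumes "\<mu> \<notin> path_image p"
  obtains e M where "e > 0" "\<And>w. w \<in> ball \<mu> e \<Longrightarrow> w \<notin> path_image p \<and> norm (G w x) \<le> M"
proof -
  have "open (- path_image p)" using closed_valid_path_image[OF valid_loop] by blast
  then obtain e where e: "e > 0" "ball \<mu> e \<subseteq> - path_image p" using assms openE by blast
  obtain L where L: "L > 0" "\<And>(f :: complex \<Rightarrow> 'a) M. continuous_on (path_image p) f \<Longrightarrow>
     (\<And>z. z \<in> path_image p \<Longrightarrow> norm (f z) \<le> M) \<Longrightarrow> norm (vcontour_integral p f) \<le> L * M"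
    using vcontour_integral_bound[OF polynomial_loop(1)] by blast
  have "bounded ((\<lambda>z. R z x) ` path_image p)"
    using compact_continuous_image[OF continuous_on_loop_resolvent compact_valid_path_image[OF valid_loop]]
      compact_imp_bounded by blast
  then obtain N where N: "N > 0" "\<And>z. z \<in> path_image p \<Longrightarrow> norm (R z x) \<le> N"
    by (metis bounded_pos image_eqI)
  define c where "c = cmod (1 / (2 * of_real pi * \<i>))"
  show thesis
  \<comment> \<open>On the half ball the distance to the path is at least \<open>e / 2\<close>,
    which bounds the Cauchy kernel by \<open>2 / e\<close>.\<close>
  proof (rule that[of "e / 2" "c * (L * (2 / e * N))"], goal_cases)
    case 1 then show ?case using e by simp
  next
    case (2 w)
    then have "w \<in> ball \<mu> e" using e(1) by simp
    then have w: "w \<notin> path_image p" using e(2) by blast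
    have "norm (vcontour_integral p (\<lambda>z. (1 / (z - w)) *\<^sub>C R z x)) \<le> L * (2 / e * N)"
    proof (rule L(2)[OF continuous_on_loop_cauchy_kernel[OF w]])
      fix z assume z: "z \<in> path_image p"
      then have "z \<notin> ball \<mu> e" using e(2) by blast
      then have "dist z w \<ge> e / 2"
        using 2 dist_triangle[of \<mu> z w] by (simp add: dist_commute)
      then have "cmod (1 / (z - w)) \<le> 2 / e"
        using e(1) frac_le[of 1 1 "e / 2" "cmod (z - w)"] by (simp add: norm_divide dist_norm)
      then show "norm ((1 / (z - w)) *\<^sub>C R z x) \<le> 2 / e * N"
        unfolding norm_scaleC using N z e(1) by (intro mult_mono) auto
    qed
    from mult_left_mono[OF this, of c] w show ?case
      by (simp only: G_def norm_scaleC c_def norm_ge_zero simp_thms)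
  qed
qed

lemma commute_riesz:
  assumes "bounded_clinear_op B" "\<And>z y. z \<in> \<rho> \<Longrightarrow> R z (B y) = B (R z y)"
  shows "Q (B x) = B (Q x)"
proof -
  have "vcontour_integral p (\<lambda>z. R z (B x)) = vcontour_integral p (\<lambda>z. B (R z x))"
    by (rule vcontour_integral_cong) (use assms(2) loop_subset in auto)
  also have "\<dots> = B (vcontour_integral p (\<lambda>z. R z x))"
    by (rule vcontour_integral_linear[OF vcontour_integrable_resolvent assms(1)])
  finally show ?thesis by (simp add: riesz_def bounded_clinear_op_simps[OF assms(1)])
qed

lemma riesz_resolvent_commute: "w \<in> \<rho> \<Longrightarrow> Q (R w x) = R w (Q x)"
  by (rule commute_riesz) (auto simp: resolvent_bounded resolvent_commute)

text \<open>This is \<open>(\<mu> - A) (G \<mu> x) = winding_number p \<mu> *\<^sub>C x - Q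
  x\<close> after applying \<open>R w\<close>: in this form only bounded operators pass under the
  integral. There the resolvent identity splits the integrand into a Cauchy kernel, giving the
  winding number, and a resolvent, giving \<open>Q\<close>.\<close>

lemma cauchy_transform_resolvent:
  assumes l: "\<mu> \<notin> path_image p" and w: "w \<in> \<rho>"
  shows "(\<mu> - w) *\<^sub>C R w (G \<mu> x) + G \<mu> x = R w (winding_number p \<mu> *\<^sub>C x - Q x)"
proof -
  let ?c = "1 / (2 * of_real pi * \<i>) :: complex"
  let ?f = "\<lambda>z. (1 / (z - \<mu>)) *\<^sub>C R z x"
  note Rw = bounded_clinear_op_simps[OF resolvent_bounded[OF w]]
  have int: "vcontour_integrable p ?f" by (rule vcontour_integrable_cauchy_kernel[OF l])
  have cont: "continuous_on (path_image p) (\<lambda>z. 1 / (z - \<mu>))"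
    using l by (intro continuous_intros) auto
  have B: "bounded_clinear_op (\<lambda>y. (\<mu> - w) *\<^sub>C R w y + y)"
    by (intro bounded_clinear_op_intros resolvent_bounded w)
  have "(\<mu> - w) *\<^sub>C R w (vcontour_integral p ?f) + vcontour_integral p ?f
      = vcontour_integral p (\<lambda>z. (\<mu> - w) *\<^sub>C R w (?f z) + ?f z)"
    by (rule vcontour_integral_linear[OF int B, symmetric])
  also have "\<dots> = vcontour_integral p (\<lambda>z. (1 / (z - \<mu>)) *\<^sub>C R w x - R w (R z x))"
  proof (rule vcontour_integral_cong)
    fix z assume "z \<in> path_image p"
    then have z: "z \<in> \<rho>" "z - \<mu> \<noteq> 0" using l loop_subset by auto
    have Rz: "R z x = R w x - (z - w) *\<^sub>C R w (R z x)"
      using resolvent_identity[OF w z(1), of x] by (simp add: algebra_simps)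
    have "(\<mu> - w) *\<^sub>C R w (?f z) + ?f z = (1 / (z - \<mu>)) *\<^sub>C ((\<mu> - w) *\<^sub>C R w (R z x) + R z x)"
      by (simp add: Rw scaleC_add_right mult.commute)
    also have "(\<mu> - w) *\<^sub>C R w (R z x) + R z x = R w x - (z - \<mu>) *\<^sub>C R w (R z x)"
      by (subst (2) Rz) (simp add: cvs.scale_left_diff_distrib algebra_simps)
    also have "(1 / (z - \<mu>)) *\<^sub>C \<dots> = (1 / (z - \<mu>)) *\<^sub>C R w x - R w (R z x)"
      using z(2) by (simp add: cvs.scale_right_diff_distrib)
    finally show "(\<mu> - w) *\<^sub>C R w (?f z) + ?f z = (1 / (z - \<mu>)) *\<^sub>C R w x - R w (R z x)" .
  qed
  also have "\<dots> = vcontour_integral p (\<lambda>z. (1 / (z - \<mu>)) *\<^sub>C R w x) - vcontour_integral p (\<lambda>z. R w (R z x))"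
    using vcontour_integrable_linear[OF vcontour_integrable_resolvent resolvent_bounded[OF w]]
      vcontour_integrable_continuous[OF polynomial_loop(1)] cont
    by (intro vcontour_integral_diff) (auto intro!: continuous_on_scaleC continuous_on_const)
  also have "\<dots> = (2 * of_real pi * \<i> * winding_number p \<mu>) *\<^sub>C R w x - R w (vcontour_integral p (\<lambda>z. R z x))"
    using vcontour_integral_scaleC_const[OF polynomial_loop(1) cont]
      vcontour_integral_linear[OF vcontour_integrable_resolvent resolvent_bounded[OF w]]
      winding_number_loop[OF l] by simp
  finally have "?c *\<^sub>C ((\<mu> - w) *\<^sub>C R w (vcontour_integral p ?f) + vcontour_integral p ?f)
      = ?c *\<^sub>C ((2 * of_real pi * \<i> * winding_number p \<mu>) *\<^sub>C R w x - R w (vcontour_integral p (\<lambda>z. R z x)))"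
    by simp
  then show ?thesis
    by (simp add: G_def riesz_def Rw scaleC_add_right cvs.scale_right_diff_distrib mult.commute)
qed

lemma resolvent_riesz_complement:
  assumes "\<mu> \<notin> path_image p" "\<mu> \<in> \<rho>"
  shows "R \<mu> (winding_number p \<mu> *\<^sub>C x - Q x) = G \<mu> x"
  using cauchy_transform_resolvent[OF assms, of x] by simp

text \<open>Removes \<open>R w\<close> again: \<open>cauchy_transform_resolvent\<close> exhibits
  \<open>G \<mu> x\<close> as a value of \<open>R w\<close>, hence an element of \<open>D\<close>,
  so \<open>A\<close> never has to be interchanged with the integral.\<close>

lemma cauchy_transform_solves:
  assumes l: "\<mu> \<notin> path_image p"
  shows "G \<mu> x \<in> D" and "\<mu> *\<^sub>C G \<mu> x - A (G \<mu> x) = winding_number p \<mu> *\<^sub>C x - Q x"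
proof -
  obtain w where w: "w \<in> \<rho>" using loop_subset path_image_nonempty[of p] by blast
  let ?y = "winding_number p \<mu> *\<^sub>C x - Q x"
  have eq: "G \<mu> x = R w (?y - (\<mu> - w) *\<^sub>C G \<mu> x)"
    using cauchy_transform_resolvent[OF l w, of x]
    by (simp add: bounded_clinear_op_simps[OF resolvent_bounded[OF w]] algebra_simps)
  show "G \<mu> x \<in> D" by (subst eq) (rule resolvent_mem[OF w])
  have "w *\<^sub>C G \<mu> x - A (G \<mu> x) = ?y - (\<mu> - w) *\<^sub>C G \<mu> x"
    using resolvent_eq[OF w, of "?y - (\<mu> - w) *\<^sub>C G \<mu> x"] eq by simp
  then show "\<mu> *\<^sub>C G \<mu> x - A (G \<mu> x) = ?y"
    by (simp add: cvs.scale_left_diff_distrib algebra_simps)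
qed

text \<open>The pairings of \<open>R z x\<close> extend by \<open>g\<close> across the spectral
  points with nonzero winding number, so the loop is null-homologous in the enlarged domain and the
  homological Cauchy theorem applies to each pairing.\<close>

lemma riesz_eq_0_glue:
  assumes "open W" "\<And>u. g u holomorphic_on W"
    and "\<And>z u. z \<in> \<rho> \<inter> W \<Longrightarrow> cinner (R z x) u = g u z"
    and "\<And>z. z \<notin> \<rho> \<union> W \<Longrightarrow> winding_number p z = 0"
  shows "Q x = 0"
proof (rule cinner_eqI)
  fix u
  let ?h = "\<lambda>z. if z \<in> \<rho> then cinner (R z x) u else g u z"
  have "?h holomorphic_on (\<rho> \<union> W)"
    by (rule holomorphic_on_If_Un[OF holomorphic_on_cinner_resolvent assms(2) open_resolvent_set assms(1)])
      (use assms(3) in auto)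
  then have "(?h has_contour_integral 0) p"
    by (rule Cauchy_theorem_global[rotated])
      (use assms(1,4) open_resolvent_set valid_loop polynomial_loop loop_subset in auto)
  then have "contour_integral p (\<lambda>z. cinner (R z x) u) = 0"
    using contour_integral_cong[OF refl, of p ?h "\<lambda>z. cinner (R z x) u"] loop_subset
    by (simp add: contour_integral_unique subset_iff)
  then show "cinner (Q x) u = cinner 0 u"
    by (simp add: riesz_def cinner_scaleC_left cinner_vcontour_integral[OF vcontour_integrable_resolvent]
        cinner_left_simps)
qed

text \<open>Riemann's removable singularity theorem supplies the extensions for
  \<open>riesz_eq_0_glue\<close>; only boundedness of \<open>R z x\<close> near the points of
  \<open>L\<close> has to be shown.\<close>

lemma riesz_eq_0_bounded:
  assumes "finite L" "open (\<rho> \<union> L)" "L \<inter> \<rho> = {}"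
    and bd: "\<And>l. l \<in> L \<Longrightarrow> \<exists>e>0. \<exists>M. \<forall>z\<in>ball l e \<inter> \<rho>. norm (R z x) \<le> M"
    and "\<And>z. z \<notin> \<rho> \<union> L \<Longrightarrow> winding_number p z = 0"
  shows "Q x = 0"
proof -
  have "\<exists>g. g holomorphic_on (\<rho> \<union> L) \<and> (\<forall>z\<in>\<rho> \<union> L - L. g z = cinner (R z x) u)" for u
  proof (rule removable_singularities[OF assms(1)])
    show "L \<subseteq> interior (\<rho> \<union> L)" using assms(2) by (simp add: interior_open)
    show "(\<lambda>z. cinner (R z x) u) holomorphic_on (\<rho> \<union> L - L)"
      by (rule holomorphic_on_subset[OF holomorphic_on_cinner_resolvent]) auto
    fix l assume l: "l \<in> L"
    obtain e M where e: "e > 0" "\<And>z. z \<in> ball l e \<inter> \<rho> \<Longrightarrow> norm (R z x) \<le> M"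
      using bd[OF l] by blast
    \<comment> \<open>Deleting the other points of the finite set \<open>L\<close> leaves a
      neighbourhood of \<open>l\<close> whose remaining points are regular.\<close>
    have "open (\<rho> \<union> (L - (L - {l})))"
    proof -
      have "\<rho> \<union> (L - (L - {l})) = (\<rho> \<union> L) - (L - {l})" using assms(3) by auto
      then show ?thesis using assms(1,2) by (simp add: finite_imp_closed open_Diff)
    qed
    moreover have "L - (L - {l}) = {l}" using l by auto
    ultimately have "open (\<rho> \<union> {l})" by simp
    then have "open ((\<rho> \<union> {l}) \<inter> ball l e)" by (intro open_Int open_ball)
    from eventually_at_in_open[OF this, of l] e(1)
    have ev: "\<forall>\<^sub>F z in at l. z \<in> (\<rho> \<union> {l}) \<inter> ball l e - {l}" by simp
    obtain K where K: "\<And>y. norm (cinner y u) \<le> norm y * K" "K \<ge> 0"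
      using bounded_linear.nonneg_bounded[OF bounded_linear_cinner_left[of u]] by blast
    show "(\<lambda>z. cinner (R z x) u) \<in> O[at l](\<lambda>_. 1)"
    proof (rule bigoI[where c = "M * K"])
      show "\<forall>\<^sub>F z in at l. norm (cinner (R z x) u) \<le> M * K * norm (1::complex)"
        using ev
      proof eventually_elim
        case (elim z)
        then have "norm (R z x) * K \<le> M * K" using e(2)[of z] K(2) by (intro mult_right_mono) auto
        then show ?case using K(1)[of "R z x"] by simp
      qed
    qed
  qed
  then obtain g where g: "\<And>u. g u holomorphic_on (\<rho> \<union> L)"
    "\<And>u z. z \<in> \<rho> \<union> L - L \<Longrightarrow> g u z = cinner (R z x) u"
    by metis
  show ?thesis
  proof (rule riesz_eq_0_glue[where g = g, OF assms(2) g(1)])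
    show "cinner (R z x) u = g u z" if "z \<in> \<rho> \<inter> (\<rho> \<union> L)" for z u
      using that assms(3) by (intro g(2)[symmetric]) auto
  qed (use assms(5) in auto)
qed

lemma holomorphic_on_cinner_cauchy_transform:
  "(\<lambda>w. cinner (G w x) u) holomorphic_on (- path_image p)"
proof -
  let ?f = "\<lambda>z. cinner (R z x) u"
  obtain p' where p': "continuous_on {0..1} p'" "\<And>t. (p has_vector_derivative p' t) (at t)"
    using has_vector_derivative_polynomial_function[OF polynomial_loop(1)]
      continuous_on_polymonial_function by metis
  have "bounded (p' ` {0..1})"
    using compact_continuous_image[OF p'(1)] compact_imp_bounded by blast
  then obtain B where B: "\<And>t. t \<in> {0..1} \<Longrightarrow> norm (p' t) \<le> B"
    by (metis bounded_pos image_eqI)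
  have eq: "cinner (G w x) u = 1 / (2 * of_real pi * \<i>) * contour_integral p (\<lambda>z. ?f z / (z - w) ^ 1)"
    and int: "(\<lambda>z. ?f z / (z - w) ^ 1) contour_integrable_on p" if "w \<in> - path_image p" for w
  proof -
    have w: "w \<notin> path_image p" using that by simp
    have *: "cinner ((1 / (z - w)) *\<^sub>C R z x) u = ?f z / (z - w) ^ 1" for z
      by (simp add: cinner_scaleC_left)
    show "cinner (G w x) u = 1 / (2 * of_real pi * \<i>) * contour_integral p (\<lambda>z. ?f z / (z - w) ^ 1)"
      "(\<lambda>z. ?f z / (z - w) ^ 1) contour_integrable_on p"
      using cinner_vcontour_integral[OF vcontour_integrable_cauchy_kernel[OF w], of x u]
        contour_integrable_cinner[OF vcontour_integrable_cauchy_kernel[OF w], of x u]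
      unfolding * by (simp_all add: G_def cinner_scaleC_left)
  qed
  have "\<exists>D. ((\<lambda>w. contour_integral p (\<lambda>z. ?f z / (z - w) ^ 1)) has_field_derivative D) (at w)"
    if w: "w \<in> - path_image p" for w
  \<comment> \<open>The kernel carries the exponent 1 so that the differentiation theorem for
    Cauchy-type integrals applies with \<open>k = 1\<close>; its bound on the speed of the path
    holds because \<open>p\<close> is polynomial.\<close>
  proof (rule exI, rule Cauchy_next_derivative(2)[where S = UNIV and k = 1 and \<gamma> = p and f' = ?f and B = B])
    show "continuous_on (path_image p) ?f"
      by (rule bounded_linear.continuous_on[OF bounded_linear_cinner_left continuous_on_loop_resolvent])
    show "norm (vector_derivative p (at t)) \<le> B" if "t \<in> {0..1}" for t
      using B[OF that] vector_derivative_at[OF p'(2)] by simp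
    show "((\<lambda>z. ?f z / (z - v) ^ 1) has_contour_integral contour_integral p (\<lambda>z. ?f z / (z - v) ^ 1)) p"
      if "v \<in> UNIV - path_image p" for v
      using has_contour_integral_integral[OF int] that by simp
  qed (use w valid_loop in auto)
  then have "(\<lambda>w. contour_integral p (\<lambda>z. ?f z / (z - w) ^ 1)) holomorphic_on (- path_image p)"
    using closed_valid_path_image[OF valid_loop] by (subst holomorphic_on_open) auto
  then have "(\<lambda>w. 1 / (2 * of_real pi * \<i>) * contour_integral p (\<lambda>z. ?f z / (z - w) ^ 1))
      holomorphic_on (- path_image p)"
    by (intro holomorphic_intros)
  then show ?thesis by (rule holomorphic_transform) (use eq in auto)
qed

text \<open>Inside the loop the resolvent applied to $sx - Qx$ continues holomorphically as the Cauchy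
  transform, so $Q$ annihilates it.\<close>
lemma riesz_idempotent:
  assumes "s \<noteq> 0" "\<And>z. z \<notin> \<rho> \<Longrightarrow> winding_number p z = 0 \<or> winding_number p z = s"
  shows "Q (Q x) = s *\<^sub>C Q x"
proof -
  let ?W = "{z. z \<notin> path_image p \<and> winding_number p z = s}"
  have "Q (s *\<^sub>C x - Q x) = 0"
  proof (rule riesz_eq_0_glue)
    show "open ?W"
      by (rule open_winding_number_levelsets[OF valid_path_imp_path[OF valid_loop] polynomial_loop(2)])
    show "(\<lambda>w. cinner (G w x) u) holomorphic_on ?W" for u
      by (rule holomorphic_on_subset[OF holomorphic_on_cinner_cauchy_transform]) auto
    show "cinner (R z (s *\<^sub>C x - Q x)) u = cinner (G z x) u" if "z \<in> \<rho> \<inter> ?W" for z u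
      using resolvent_riesz_complement[of z x] that by auto
    show "winding_number p z = 0" if "z \<notin> \<rho> \<union> ?W" for z
      using assms(2)[of z] that loop_subset by auto
  qed
  then show ?thesis by (simp add: bounded_clinear_op_simps[OF riesz_bounded])
qed

end

section \<open>Rational functions of an operator\<close>

text \<open>Clearing denominators gives a polynomial whose degree is exactly \<open>card J\<close>,
  because \<open>c0\<close> is nonzero, so it has a root. At a pole \<open>a m\<close> only the
  \<open>m\<close>-th term survives, and it is nonzero; hence the root is not a pole.\<close>

lemma rational_function_has_zero:
  fixes c a :: "'i \<Rightarrow> complex"
  assumes J: "finite J" "J \<noteq> {}" "inj_on a J" and c0: "c0 \<noteq> 0" and c: "\<And>j. j \<in> J \<Longrightarrow> c j \<noteq> 0"
  obtains \<mu> where "\<mu> \<notin> a ` J" "c0 + (\<Sum>j\<in>J. c j / (a j - \<mu>)) = 0"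
proof -
  define f where "f j = [:a j, -1:]" for j
  have f: "f j \<noteq> 0" "degree (f j) = 1" "poly (f j) z = a j - z" for j z
    by (simp_all add: f_def)
  define q where "q = (\<Sum>j\<in>J. smult (c j) (\<Prod>k\<in>J - {j}. f k))"
  define p where "p = smult c0 (\<Prod>k\<in>J. f k) + q"
  have deg: "degree (\<Prod>k\<in>K. f k) = card K" if "finite K" for K
    using that f by (subst degree_prod_eq_sum_degree) auto
  have "degree q \<le> card J - 1"
    unfolding q_def
  proof (rule degree_sum_le)
    fix j assume "j \<in> J"
    then show "degree (smult (c j) (\<Prod>k\<in>J - {j}. f k)) \<le> card J - 1"
      using deg[of "J - {j}"] J(1) by (simp add: le_trans[OF degree_smult_le])
  qed (rule J(1))
  moreover have "card J > 0" using J by (simp add: card_gt_0_iff)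
  ultimately have "degree q < degree (smult c0 (\<Prod>k\<in>J. f k))"
    using c0 J(1) by (simp add: deg)
  then have "degree p = card J"
    unfolding p_def using c0 J(1) by (subst degree_add_eq_left) (simp_all add: deg)
  then obtain \<mu> where \<mu>: "poly p \<mu> = 0"
    using alg_closed_imp_poly_has_root[of p] \<open>card J > 0\<close> by auto
  have poly_p: "poly p z = c0 * (\<Prod>k\<in>J. a k - z) + (\<Sum>j\<in>J. c j * (\<Prod>k\<in>J - {j}. a k - z))" for z
    by (simp add: p_def q_def poly_sum poly_prod f)
  have "\<mu> \<notin> a ` J"
  proof
    assume "\<mu> \<in> a ` J"
    then obtain m where m: "m \<in> J" "\<mu> = a m" by blast
    have h1: "(\<Prod>k\<in>J. a k - \<mu>) = 0" using m J(1) by (auto simp: prod_zero_iff)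
    have h2: "(\<Sum>j\<in>J. c j * (\<Prod>k\<in>J - {j}. a k - \<mu>)) = (\<Sum>j\<in>J. if j = m then c m * (\<Prod>k\<in>J - {m}. a k - \<mu>) else 0)"
    proof (rule sum.cong[OF refl])
      fix j assume "j \<in> J"
      show "c j * (\<Prod>k\<in>J - {j}. a k - \<mu>) = (if j = m then c m * (\<Prod>k\<in>J - {m}. a k - \<mu>) else 0)"
        using m J(1) by (auto simp: prod_zero_iff)
    qed
    have "poly p \<mu> = c m * (\<Prod>k\<in>J - {m}. a k - \<mu>)"
      unfolding poly_p h1 h2 using m(1) J(1) by (simp add: sum.delta)
    then have "c m * (\<Prod>k\<in>J - {m}. a k - \<mu>) = 0" using \<mu> by simp
    then obtain k where "k \<in> J - {m}" "a k = a m" using c[OF m(1)] J(1) m by (auto simp: prod_zero_iff)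
    then show False using J(3) m(1) by (auto dest: inj_onD)
  qed
  moreover have "c0 + (\<Sum>j\<in>J. c j / (a j - \<mu>)) = 0"
  proof -
    have nz: "a k - \<mu> \<noteq> 0" if "k \<in> J" for k using \<open>\<mu> \<notin> a ` J\<close> that by auto
    have "poly p \<mu> = (\<Prod>k\<in>J. a k - \<mu>) * (c0 + (\<Sum>j\<in>J. c j / (a j - \<mu>)))"
      unfolding poly_p distrib_left sum_distrib_left
    proof (intro arg_cong2[where f = "(+)"] sum.cong)
      fix j assume j: "j \<in> J"
      show "c j * (\<Prod>k\<in>J - {j}. a k - \<mu>) = (\<Prod>k\<in>J. a k - \<mu>) * (c j / (a j - \<mu>))"
        using prod.remove[OF J(1) j, of "\<lambda>k. a k - \<mu>"] nz[OF j] by simp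
    qed simp_all
    then show ?thesis using \<mu> nz J(1) by (auto simp: prod_zero_iff)
  qed
  ultimately show thesis by (rule that)
qed

context clinear_operator
begin

text \<open>Encodes \<open>(\<mu> - A) (G x) = P x\<close> after applying \<open>R w\<close>, so
  that no domain condition is involved. The point \<open>\<mu>\<close> may be spectral.\<close>

definition reduced_resolvent :: "('a \<Rightarrow> 'a) \<Rightarrow> complex \<Rightarrow> ('a \<Rightarrow> 'a) \<Rightarrow> bool" where
  "reduced_resolvent P \<mu> G \<longleftrightarrow>
     bounded_clinear_op G \<and> (\<forall>w\<in>\<rho>. \<forall>x. (\<mu> - w) *\<^sub>C R w (G x) + G x = R w (P x))"

lemma reduced_resolvent_resolvent_set:
  assumes "bounded_clinear_op P" "\<mu> \<in> \<rho>"
  shows "reduced_resolvent P \<mu> (\<lambda>x. R \<mu> (P x))"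
  unfolding reduced_resolvent_def
  using resolvent_identity[OF _ assms(2)] bounded_clinear_op_compose[OF resolvent_bounded[OF assms(2)] assms(1)]
  by (metis add.commute diff_add_cancel)

text \<open>Splitting off one zero $\mu$ and one pole $a_m$ of the rational function leaves the factor
  $-1 + (a_m - \mu)/(a_m - z)$, whose operator version is inverted by a reduced resolvent at $\mu$.\<close>
lemma rational_function_invertible_mod:
  assumes P: "bounded_clinear_op P" "\<And>x. P (P x) = P x" "\<And>w x. w \<in> \<rho> \<Longrightarrow> P (R w x) = R w (P x)"
    and J: "finite J" "inj_on a J" "a ` J \<subseteq> \<rho>" and c0: "c0 \<noteq> 0"
    and zeros: "\<And>\<mu>. \<mu> \<notin> a ` J \<Longrightarrow> c0 + (\<Sum>j\<in>J. c j / (a j - \<mu>)) = 0 \<Longrightarrow> \<exists>G. reduced_resolvent P \<mu> G"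
  shows "\<exists>W. bounded_clinear_op W \<and> (\<forall>x. c0 *\<^sub>C W x + (\<Sum>j\<in>J. c j *\<^sub>C R (a j) (W x)) = P x)"
  using J c0 zeros
proof (induction "card J" arbitrary: J c0 c rule: less_induct)
  case less
  note J = less.prems(1-3)
  show ?case
  proof (cases "\<exists>m\<in>J. c m = 0")
    case True
    then obtain m where m: "m \<in> J" "c m = 0" by blast
    have drop: "(\<Sum>j\<in>J. c j / (a j - \<mu>)) = (\<Sum>j\<in>J - {m}. c j / (a j - \<mu>))"
      "(\<Sum>j\<in>J. c j *\<^sub>C R (a j) x) = (\<Sum>j\<in>J - {m}. c j *\<^sub>C R (a j) x)" for \<mu> x
      using m J(1) by (simp_all add: sum.remove)
    show ?thesis
      unfolding drop
    proof (rule less.hyps)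
      show "card (J - {m}) < card J" using m(1) J(1) by (rule card_Diff1_less[rotated])
      fix \<mu> assume \<mu>: "\<mu> \<notin> a ` (J - {m})" "c0 + (\<Sum>j\<in>J - {m}. c j / (a j - \<mu>)) = 0"
      \<comment> \<open>Dropping a zero coefficient makes \<open>a m\<close> a possible zero, about
        which the hypothesis on zeros is silent; but it lies in the resolvent set.\<close>
      show "\<exists>G. reduced_resolvent P \<mu> G"
      proof (cases "\<mu> = a m")
        case True
        then have "\<mu> \<in> \<rho>" using J(3) m(1) by auto
        then show ?thesis using reduced_resolvent_resolvent_set[OF P(1)] by blast
      next
        case False
        then show ?thesis using less.prems(5)[of \<mu>] \<mu> m(1) drop by auto
      qed
    qed (use J less.prems(4) in \<open>auto intro: inj_on_subset\<close>)
  next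
    case False
    show ?thesis
    proof (cases "J = {}")
      case True
      then show ?thesis
        using less.prems(4) bounded_clinear_op_scale[OF P(1), of "1 / c0"]
        by (intro exI[of _ "\<lambda>x. (1 / c0) *\<^sub>C P x"]) simp
    next
      case nonempty: False
      then obtain m where m: "m \<in> J" by blast
      obtain \<mu> where \<mu>: "\<mu> \<notin> a ` J" "c0 + (\<Sum>j\<in>J. c j / (a j - \<mu>)) = 0"
        using rational_function_has_zero[OF J(1) nonempty J(2) less.prems(4)] False by metis
      define w where "w = a m"
      define J' where "J' = J - {m}"
      \<comment> \<open>Partial fractions of the quotient by the factor
        \<open>-1 + (w - \<mu>) / (w - z)\<close>, up to the constant term; \<open>w - a j\<close>
        makes the coefficient at \<open>m\<close> vanish, so one pole fewer remains.\<close>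
      define c' where "c' j = c j * (w - a j) / (a j - \<mu>)" for j
      have w: "w \<in> \<rho>" using J(3) m by (auto simp: w_def)
      have mem: "a j \<in> \<rho>" if "j \<in> J" for j using J(3) that by auto
      have nz: "a j - \<mu> \<noteq> 0" if "j \<in> J" for j using \<mu>(1) that by auto
      have wm: "w - \<mu> \<noteq> 0" using nz[OF m] by (simp add: w_def)
      have fin: "finite J'" using J(1) by (simp add: J'_def)
      have split: "(\<Sum>j\<in>J. h j) = h m + (\<Sum>j\<in>J'. h j)" for h :: "_ \<Rightarrow> 'd::comm_monoid_add"
        using J(1) m by (simp add: sum.remove J'_def)
      have c0_eq: "- c0 = c m / (w - \<mu>) + (\<Sum>j\<in>J'. c j / (a j - \<mu>))"
        using \<mu>(2) unfolding split w_def by (metis add.inverse_unique)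
      note Rw = bounded_clinear_op_simps[OF resolvent_bounded[OF w]]
      \<comment> \<open>The scalar factorization shows that zeros of the reduced function are zeros
        of the original one, except possibly \<open>w\<close>.\<close>
      have scalar: "c0 + (\<Sum>j\<in>J. c j / (a j - z)) = (z - \<mu>) / (w - z) * (- c0 + (\<Sum>j\<in>J'. c' j / (a j - z)))"
        if z: "z \<notin> a ` J" for z
      proof -
        have z': "a j - z \<noteq> 0" if "j \<in> J" for j using z that by auto
        have wz: "w - z \<noteq> 0" using z'[OF m] by (simp add: w_def)
        have "c j / (a j - z) + (- (c j / (a j - \<mu>))) = (z - \<mu>) / (w - z) * (c j / (a j - \<mu>) + c' j / (a j - z))"
          if "j \<in> J" for j
        proof -
          have "c j / (a j - \<mu>) + c' j / (a j - z) = c j * (w - z) / ((a j - \<mu>) * (a j - z))"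
            using z'[OF that] nz[OF that] by (simp add: c'_def divide_simps) (simp add: algebra_simps)
          moreover have "c j / (a j - z) + (- (c j / (a j - \<mu>))) = c j * (z - \<mu>) / ((a j - \<mu>) * (a j - z))"
            using z'[OF that] nz[OF that] by (simp add: divide_simps) (simp add: algebra_simps)
          ultimately show ?thesis using wz by simp
        qed
        then have "(\<Sum>j\<in>J. c j / (a j - z) + (- (c j / (a j - \<mu>))))
            = (\<Sum>j\<in>J. (z - \<mu>) / (w - z) * (c j / (a j - \<mu>) + c' j / (a j - z)))"
          by (rule sum.cong[OF refl])
        then have "(\<Sum>j\<in>J. c j / (a j - z)) - (\<Sum>j\<in>J. c j / (a j - \<mu>))
            = (z - \<mu>) / (w - z) * ((\<Sum>j\<in>J. c j / (a j - \<mu>)) + (\<Sum>j\<in>J. c' j / (a j - z)))"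
          by (simp only: sum.distrib sum_negf sum_distrib_left[symmetric]) simp
        moreover have "(\<Sum>j\<in>J. c j / (a j - \<mu>)) = - c0" using \<mu>(2) by (metis add.inverse_unique)
        moreover have "c' m = 0" by (simp add: c'_def w_def)
        ultimately show ?thesis by (simp add: split[of "\<lambda>j. c' j / (a j - z)"]) (simp add: add.commute)
      qed
      have "\<exists>W. bounded_clinear_op W \<and> (\<forall>x. (- c0) *\<^sub>C W x + (\<Sum>j\<in>J'. c' j *\<^sub>C R (a j) (W x)) = P x)"
      proof (rule less.hyps)
        show "card J' < card J" unfolding J'_def using m J(1) by (rule card_Diff1_less[rotated])
        fix \<nu> assume \<nu>: "\<nu> \<notin> a ` J'" "- c0 + (\<Sum>j\<in>J'. c' j / (a j - \<nu>)) = 0"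
        show "\<exists>G. reduced_resolvent P \<nu> G"
        proof (cases "\<nu> = w")
          case True
          then show ?thesis using reduced_resolvent_resolvent_set[OF P(1)] w by blast
        next
          case False
          then have "\<nu> \<notin> a ` J" using \<nu>(1) by (auto simp: J'_def w_def)
          then show ?thesis using less.prems(5)[of \<nu>] scalar[of \<nu>] \<nu>(2) by simp
        qed
      qed (use J less.prems(4) in \<open>auto simp: J'_def intro: inj_on_subset\<close>)
      then obtain W where W: "bounded_clinear_op W"
        "\<And>x. (- c0) *\<^sub>C W x + (\<Sum>j\<in>J'. c' j *\<^sub>C R (a j) (W x)) = P x" by blast
      obtain G where G: "bounded_clinear_op G"
        "\<And>v x. v \<in> \<rho> \<Longrightarrow> (\<mu> - v) *\<^sub>C R v (G x) + G x = R v (P x)"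
        using less.prems(5)[OF \<mu>] unfolding reduced_resolvent_def by blast
      \<comment> \<open>\<open>B\<close> is the split-off factor evaluated at the operator;
        \<open>C\<close>, built from the reduced resolvent at \<open>\<mu>\<close>, is a right
        inverse of it modulo \<open>P\<close>.\<close>
      define B where "B v = (w - \<mu>) *\<^sub>C R w v - v" for v
      define C where "C x = (-1) *\<^sub>C (P x + (w - \<mu>) *\<^sub>C G x)" for x
      have B: "bounded_clinear_op B"
        unfolding B_def by (intro bounded_clinear_op_intros resolvent_bounded w)
      have C: "bounded_clinear_op C"
        unfolding C_def by (intro bounded_clinear_op_intros P(1) G(1))
      have BC: "B (C x) = P x" for x
      proof -
        have Rg: "R w (P x) = (\<mu> - w) *\<^sub>C R w (G x) + G x" using G(2)[OF w] by simp
        show ?thesis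
          by (simp add: B_def C_def Rw Rg scaleC_add_right cvs.scale_right_diff_distrib
              cvs.scale_left_diff_distrib algebra_simps)
      qed
      have factor: "B ((- c0) *\<^sub>C y + (\<Sum>j\<in>J'. c' j *\<^sub>C R (a j) y)) = c0 *\<^sub>C y + (\<Sum>j\<in>J. c j *\<^sub>C R (a j) y)" for y
      proof -
        have summand: "B (c' j *\<^sub>C R (a j) y) = c j *\<^sub>C R (a j) y - ((w - \<mu>) * (c j / (a j - \<mu>))) *\<^sub>C R w y"
          if "j \<in> J'" for j
        proof -
          have j: "j \<in> J" using that by (simp add: J'_def)
          have "(w - a j) *\<^sub>C R w (R (a j) y) = R (a j) y - R w y"
            using resolvent_identity[OF mem[OF j] w, of y] resolvent_commute[OF mem[OF j] w] by simp
          then have "((c j * (w - \<mu>)) / (a j - \<mu>)) *\<^sub>C (w - a j) *\<^sub>C R w (R (a j) y)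
              = ((c j * (w - \<mu>)) / (a j - \<mu>)) *\<^sub>C (R (a j) y - R w y)" by simp
          then have "(w - \<mu>) *\<^sub>C c' j *\<^sub>C R w (R (a j) y)
              = ((c j * (w - \<mu>)) / (a j - \<mu>)) *\<^sub>C R (a j) y - ((c j * (w - \<mu>)) / (a j - \<mu>)) *\<^sub>C R w y"
            by (simp add: c'_def cvs.scale_right_diff_distrib mult_ac)
          moreover have "(c j * (w - \<mu>)) / (a j - \<mu>) - c' j = c j"
          proof -
            have "(c j * (w - \<mu>)) / (a j - \<mu>) - c' j = (c j * (a j - \<mu>)) / (a j - \<mu>)"
              unfolding c'_def diff_divide_distrib[symmetric] by (simp add: algebra_simps)
            then show ?thesis using nz[OF j] by simp
          qed
          then have "((c j * (w - \<mu>)) / (a j - \<mu>)) *\<^sub>C R (a j) y - c' j *\<^sub>C R (a j) y = c j *\<^sub>C R (a j) y"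
            by (metis cvs.scale_left_diff_distrib)
          ultimately show ?thesis by (simp add: B_def Rw algebra_simps)
        qed
        have "B ((- c0) *\<^sub>C y + (\<Sum>j\<in>J'. c' j *\<^sub>C R (a j) y))
            = B ((- c0) *\<^sub>C y) + (\<Sum>j\<in>J'. B (c' j *\<^sub>C R (a j) y))"
          by (simp add: bounded_clinear_op_simps[OF B])
        also have "(\<Sum>j\<in>J'. B (c' j *\<^sub>C R (a j) y))
            = (\<Sum>j\<in>J'. c j *\<^sub>C R (a j) y) - ((w - \<mu>) * (\<Sum>j\<in>J'. c j / (a j - \<mu>))) *\<^sub>C R w y"
          by (simp add: summand sum_subtractf sum_distrib_left cvs.scale_sum_left)
        also have "(w - \<mu>) * (\<Sum>j\<in>J'. c j / (a j - \<mu>)) = - (w - \<mu>) * c0 - c m"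
        proof -
          have "(\<Sum>j\<in>J'. c j / (a j - \<mu>)) = - c0 - c m / (w - \<mu>)" using c0_eq by simp
          then show ?thesis using wm by (simp add: field_simps)
        qed
        also have "B ((- c0) *\<^sub>C y) + ((\<Sum>j\<in>J'. c j *\<^sub>C R (a j) y) - (- (w - \<mu>) * c0 - c m) *\<^sub>C R w y)
            = c0 *\<^sub>C y + (c m *\<^sub>C R w y + (\<Sum>j\<in>J'. c j *\<^sub>C R (a j) y))"
          by (simp add: B_def Rw cvs.scale_left_diff_distrib algebra_simps)
        finally show ?thesis by (simp add: split w_def)
      qed
      \<comment> \<open>\<open>W\<close> inverts the remaining factor and \<open>C\<close> the
        split-off one; \<open>B\<close> commutes with \<open>P\<close>, so the two copies of
        \<open>P\<close> merge.\<close>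
      have "c0 *\<^sub>C W (C x) + (\<Sum>j\<in>J. c j *\<^sub>C R (a j) (W (C x))) = P x" for x
      proof -
        have "c0 *\<^sub>C W (C x) + (\<Sum>j\<in>J. c j *\<^sub>C R (a j) (W (C x))) = B (P (C x))"
          by (simp only: factor[symmetric] W(2))
        also have "\<dots> = P (B (C x))"
          by (simp add: B_def P(3)[OF w, symmetric] bounded_clinear_op_simps[OF P(1)])
        finally show ?thesis by (simp add: BC P(2))
      qed
      then show ?thesis using bounded_clinear_op_compose[OF W(1) C] by blast
    qed
  qed
qed

end

section \<open>Spectral subspaces of an operator and of a rational function of it\<close>

locale rational_operator = clinear_operator +
  fixes N :: nat and \<omega> zs :: "nat \<Rightarrow> complex"
  assumes inj_poles: "inj_on zs {1..N}" and poles_resolvent_set: "zs ` {1..N} \<subseteq> \<rho>"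
begin

definition T :: "'a \<Rightarrow> 'a" where
  "T x = \<omega> 0 *\<^sub>C x + (\<Sum>j=1..N. \<omega> j *\<^sub>C R (zs j) x)"

abbreviation "r \<equiv> rfun N \<omega> zs"

lemma pole_mem: "j \<in> {1..N} \<Longrightarrow> zs j \<in> \<rho>"
  using poles_resolvent_set by auto

lemma bounded_T: "bounded_clinear_op T"
  unfolding T_def by (intro bounded_clinear_op_intros resolvent_bounded pole_mem)

sublocale T: clinear_operator UNIV T
  by (rule clinear_operator_bounded[OF bounded_T])

lemma T_commute:
  assumes B: "bounded_clinear_op B" and "\<And>w y. w \<in> \<rho> \<Longrightarrow> B (R w y) = R w (B y)"
  shows "B (T x) = T (B x)"
  unfolding T_def bounded_clinear_op_simps[OF B]
  using assms(2) pole_mem by (auto intro!: sum.cong arg_cong2[where f = "(+)"])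

text \<open>The right-hand side no longer contains \<open>R z\<close>: the difference
  \<open>r z - T\<close> is divisible by \<open>z - A\<close>. Hence it stays controlled as
  \<open>z\<close> approaches a spectral point.\<close>

lemma resolvent_rfun_minus_T:
  assumes z: "z \<in> \<rho>" "z \<notin> zs ` {1..N}"
  shows "R z (r z *\<^sub>C x - T x) = (\<Sum>j=1..N. (\<omega> j / (zs j - z)) *\<^sub>C R (zs j) x)"
proof -
  note Rz = bounded_clinear_op_simps[OF resolvent_bounded[OF z(1)]]
  have "r z *\<^sub>C x - T x = (\<Sum>j=1..N. \<omega> j *\<^sub>C ((1 / (zs j - z)) *\<^sub>C x - R (zs j) x))"
    by (simp add: T_def rfun_def scaleC_add_left cvs.scale_sum_left cvs.scale_right_diff_distrib sum_subtractf)
  then have "R z (r z *\<^sub>C x - T x) = (\<Sum>j=1..N. R z (\<omega> j *\<^sub>C ((1 / (zs j - z)) *\<^sub>C x - R (zs j) x)))"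
    by (simp only: Rz)
  also have "\<dots> = (\<Sum>j=1..N. (\<omega> j / (zs j - z)) *\<^sub>C R (zs j) x)"
  proof (rule sum.cong[OF refl])
    fix j assume j: "j \<in> {1..N}"
    have nz: "zs j - z \<noteq> 0" using z(2) j by auto
    have "R z x - R (zs j) x = (zs j - z) *\<^sub>C R z (R (zs j) x)"
      by (rule resolvent_identity[OF z(1) pole_mem[OF j]])
    then have "(1 / (zs j - z)) *\<^sub>C R z x - (1 / (zs j - z)) *\<^sub>C R (zs j) x = R z (R (zs j) x)"
      using nz by (simp add: cvs.scale_right_diff_distrib[symmetric])
    then have "R z ((1 / (zs j - z)) *\<^sub>C x - R (zs j) x) = (1 / (zs j - z)) *\<^sub>C R (zs j) x"
      by (simp add: Rz algebra_simps)
    then show "R z (\<omega> j *\<^sub>C ((1 / (zs j - z)) *\<^sub>C x - R (zs j) x)) = (\<omega> j / (zs j - z)) *\<^sub>C R (zs j) x"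
      by (simp add: Rz)
  qed
  finally show ?thesis .
qed

text \<open>The half of the spectral mapping theorem used here is elementary: an eigenvector of
  \<open>A\<close> is one of \<open>T\<close>, with eigenvalue transformed by
  \<open>r\<close>.\<close>

lemma eigenvalue_not_in_resolvent_set:
  assumes "x \<in> D" "x \<noteq> 0" "A x = \<mu> *\<^sub>C x"
  shows "\<mu> \<notin> \<rho>" and "r \<mu> \<notin> T.\<rho>"
proof -
  show \<mu>: "\<mu> \<notin> \<rho>"
  proof
    assume "\<mu> \<in> \<rho>"
    then have "R \<mu> 0 = x" using assms by (intro resolvent_eqI) auto
    then show False
      using \<open>\<mu> \<in> \<rho>\<close> assms(2) bounded_clinear_op_zero[OF resolvent_bounded] by simp
  qed
  have "R (zs j) x = (1 / (zs j - \<mu>)) *\<^sub>C x" if j: "j \<in> {1..N}" for j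
  proof (rule resolvent_eqI[OF pole_mem[OF j]])
    have "zs j - \<mu> \<noteq> 0" using pole_mem[OF j] \<mu> by auto
    then have "1 / (zs j - \<mu>) * zs j - 1 / (zs j - \<mu>) * \<mu> = 1"
      unfolding right_diff_distrib[symmetric] by simp
    then show "zs j *\<^sub>C (1 / (zs j - \<mu>)) *\<^sub>C x - A ((1 / (zs j - \<mu>)) *\<^sub>C x) = x"
      using assms by (simp add: op_scaleC cvs.scale_left_diff_distrib[symmetric] mult.commute)
  qed (simp add: dom_scaleC assms)
  then have "T x = r \<mu> *\<^sub>C x"
    by (simp add: T_def rfun_def scaleC_add_left cvs.scale_sum_left)
  then show "r \<mu> \<notin> T.\<rho>"
    using T.resolvent_eqI[of "r \<mu>" x 0] assms(2) bounded_clinear_op_zero[OF T.resolvent_bounded] by auto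
qed

end

text \<open>The loop \<open>q\<close> winds once positively around \<open>L\<close>, while
  \<open>p\<close> only has some nonzero winding number \<open>s\<close>, because no orientation of
  the curve around the image points is prescribed.\<close>

locale two_loops = rational_operator +
  fixes q p :: "real \<Rightarrow> complex" and L :: "complex set" and s :: complex
  assumes q_loop: "resolvent_loop D A q" and p_loop: "resolvent_loop UNIV T p"
    and L: "finite L" "\<And>l. l \<in> L \<Longrightarrow> \<exists>x\<in>D. x \<noteq> 0 \<and> A x = l *\<^sub>C x"
    and q_winding: "\<And>l. l \<in> L \<Longrightarrow> winding_number q l = 1"
      "\<And>z. z \<notin> \<rho> \<Longrightarrow> z \<notin> L \<Longrightarrow> winding_number q z = 0"
    and s_nz: "s \<noteq> 0"
    and p_winding: "\<And>l. l \<in> L \<Longrightarrow> winding_number p (r l) = s"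
      "\<And>z. z \<notin> T.\<rho> \<Longrightarrow> z \<notin> r ` L \<Longrightarrow> winding_number p z = 0"
    and w0: "\<omega> 0 \<notin> r ` L"
    and preimage: "(\<Union>\<mu>\<in>r ` L. rinv N \<omega> zs \<mu>) - \<rho> \<subseteq> L"
begin

sublocale q: resolvent_loop D A q by (rule q_loop)
sublocale p: resolvent_loop UNIV T p by (rule p_loop)

lemma L_disjoint: "L \<inter> \<rho> = {}"
  and rL_disjoint: "r ` L \<inter> T.\<rho> = {}"
  using L(2) eigenvalue_not_in_resolvent_set by blast+

lemma L_not_loop: "l \<in> L \<Longrightarrow> l \<notin> path_image q"
  and rL_not_loop: "l \<in> L \<Longrightarrow> r l \<notin> path_image p"
  using L_disjoint rL_disjoint q.loop_subset p.loop_subset by blast+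

lemma L_not_pole: "l \<in> L \<Longrightarrow> l \<notin> zs ` {1..N}"
  using L_disjoint poles_resolvent_set by blast

text \<open>Isolation of \<open>L\<close> comes from the loop itself: the points with winding number
  1 form an open set, and its spectral points are exactly \<open>L\<close>.\<close>

lemma open_L: "open (\<rho> \<union> L)"
proof -
  have "\<rho> \<union> L = \<rho> \<union> {z. z \<notin> path_image q \<and> winding_number q z = 1}"
    using L_not_loop q_winding by fastforce
  then show ?thesis
    using open_winding_number_levelsets[OF valid_path_imp_path[OF q.valid_loop] q.polynomial_loop(2)]
      open_resolvent_set by (simp add: open_Un)
qed

lemma open_rL: "open (T.\<rho> \<union> r ` L)"
proof -
  have "T.\<rho> \<union> r ` L = T.\<rho> \<union> {z. z \<notin> path_image p \<and> winding_number p z = s}"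
    using rL_not_loop p_winding s_nz by fastforce
  then show ?thesis
    using open_winding_number_levelsets[OF valid_path_imp_path[OF p.valid_loop] p.polynomial_loop(2)]
      T.open_resolvent_set by (simp add: open_Un)
qed

text \<open>Close to \<open>l\<close> the value \<open>r z\<close> still has winding number
  \<open>s\<close>, so the Cauchy transform at \<open>r z\<close> solves
  \<open>r z *\<^sub>C y - T y = s *\<^sub>C x - p.Q x\<close>. Then
  \<open>resolvent_rfun_minus_T\<close> expresses \<open>R z\<close> of the right side without
  \<open>R z\<close>, and the singularity at \<open>l\<close> is removable.\<close>

lemma q_annihilates: "q.Q (s *\<^sub>C x - p.Q x) = 0"
proof (rule q.riesz_eq_0_bounded[OF L(1) open_L L_disjoint])
  fix l assume l: "l \<in> L"
  obtain e M where e: "e > 0" "\<And>w. w \<in> ball (r l) e \<Longrightarrow> w \<notin> path_image p \<and> norm (p.G w x) \<le> M"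
    using p.cauchy_transform_locally_bounded[OF rL_not_loop[OF l]] by blast
  have M0: "M \<ge> 0" using e(2)[of "r l"] e(1) norm_ge_zero order_trans by (metis centre_in_ball)
  have "\<exists>K>0. \<forall>j\<in>{1..N}. \<forall>y. norm (R (zs j) y) \<le> K * norm y"
  proof -
    have "compact (zs ` {1..N})" by (simp add: finite_imp_compact)
    from resolvent_bounded_on_compact[OF this poles_resolvent_set] show ?thesis by (metis image_eqI)
  qed
  then obtain K where K: "K > 0" "\<And>j y. j \<in> {1..N} \<Longrightarrow> norm (R (zs j) y) \<le> K * norm y" by blast
  define f where "f z = (\<Sum>j=1..N. cmod (\<omega> j / (zs j - z)))" for z
  let ?W = "{z. z \<notin> path_image p \<and> winding_number p z = s}"
  have nz: "zs j - l \<noteq> 0" if "j \<in> {1..N}" for j using L_not_pole[OF l] that by auto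
  have "isCont f l" unfolding f_def using nz by (intro continuous_intros) auto
  then have "\<forall>\<^sub>F z in nhds l. f z < f l + 1"
    by (intro order_tendstoD(2)[where y = "f l"]) (auto simp: isCont_def tendsto_at_iff_tendsto_nhds)
  moreover have "isCont r l" unfolding rfun_def using nz by (intro continuous_intros) auto
  then have rl: "(r \<longlongrightarrow> r l) (nhds l)" by (simp add: isCont_def tendsto_at_iff_tendsto_nhds)
  have "\<forall>\<^sub>F z in nhds l. r z \<in> ball (r l) e \<inter> ?W"
  proof (rule topological_tendstoD[OF rl])
    show "open (ball (r l) e \<inter> ?W)"
      using open_winding_number_levelsets[OF valid_path_imp_path[OF p.valid_loop] p.polynomial_loop(2)]
      by (intro open_Int open_ball)
  qed (use e(1) p_winding(1)[OF l] rL_not_loop[OF l] in auto)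
  moreover have "\<forall>\<^sub>F z in nhds l. z \<in> - zs ` {1..N}"
    using L_not_pole[OF l] by (intro eventually_nhds_in_open open_Compl finite_imp_closed) auto
  ultimately have "\<forall>\<^sub>F z in nhds l. f z < f l + 1 \<and> r z \<in> ball (r l) e \<inter> ?W \<and> z \<in> - zs ` {1..N}"
    by eventually_elim auto
  then obtain d where d: "d > 0" "\<And>z. dist z l < d \<Longrightarrow> f z < f l + 1"
    "\<And>z. dist z l < d \<Longrightarrow> r z \<in> ball (r l) e \<inter> ?W" "\<And>z. dist z l < d \<Longrightarrow> z \<notin> zs ` {1..N}"
    unfolding eventually_nhds_metric by blast
  have "norm (R z (s *\<^sub>C x - p.Q x)) \<le> (f l + 1) * (K * M)" if "z \<in> ball l d \<inter> \<rho>" for z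
  proof -
    have z: "dist z l < d" "z \<in> \<rho>" using that by (auto simp: dist_commute)
    have "r z *\<^sub>C p.G (r z) x - T (p.G (r z) x) = s *\<^sub>C x - p.Q x"
      using p.cauchy_transform_solves(2)[of "r z" x] d(3)[OF z(1)] by simp
    then have "R z (s *\<^sub>C x - p.Q x) = (\<Sum>j=1..N. (\<omega> j / (zs j - z)) *\<^sub>C R (zs j) (p.G (r z) x))"
      using resolvent_rfun_minus_T[OF z(2) d(4)[OF z(1)], of "p.G (r z) x"] by simp
    also have "norm \<dots> \<le> (\<Sum>j=1..N. cmod (\<omega> j / (zs j - z)) * (K * M))"
    proof (rule sum_norm_le)
      fix j assume j: "j \<in> {1..N}"
      have "norm (R (zs j) (p.G (r z) x)) \<le> K * norm (p.G (r z) x)" by (rule K(2)[OF j])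
      also have "\<dots> \<le> K * M" using K(1) e(2)[of "r z"] d(3)[OF z(1)] by simp
      finally show "norm ((\<omega> j / (zs j - z)) *\<^sub>C R (zs j) (p.G (r z) x)) \<le> cmod (\<omega> j / (zs j - z)) * (K * M)"
        unfolding norm_scaleC by (rule mult_left_mono) simp
    qed
    also have "\<dots> = f z * (K * M)" by (simp add: f_def sum_distrib_right)
    also have "\<dots> \<le> (f l + 1) * (K * M)"
      using less_imp_le[OF d(2)[OF z(1)]] K(1) M0 by (intro mult_right_mono) auto
    finally show ?thesis .
  qed
  then show "\<exists>e>0. \<exists>M. \<forall>z\<in>ball l e \<inter> \<rho>. norm (R z (s *\<^sub>C x - p.Q x)) \<le> M"
    using d(1) by blast
qed (use q_winding(2) in auto)

lemma q_idempotent: "q.Q (q.Q x) = q.Q x"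
  using q.riesz_idempotent[of 1 x] q_winding by fastforce

lemma q_commute_T: "q.Q (T x) = T (q.Q x)"
  by (rule T_commute[OF q.riesz_bounded q.riesz_resolvent_commute])

lemma q_commute_p: "q.Q (p.Q x) = p.Q (q.Q x)"
  by (rule p.commute_riesz[OF q.riesz_bounded, symmetric], rule T.commute_resolvent)
    (simp_all add: q.riesz_bounded q_commute_T)

text \<open>The zeros of \<open>m - r\<close> are regular points or lie in \<open>L\<close>, by
  \<open>preimage\<close>; at the latter the Cauchy transform along \<open>q\<close> is a reduced
  resolvent for \<open>P = 1 - q.Q\<close>. The value \<open>m - \<omega> 0\<close> at infinity is
  nonzero by \<open>w0\<close>, as the factorization demands.\<close>

lemma T_invertible_mod:
  assumes m: "m \<in> r ` L"
  obtains W where "bounded_clinear_op W" "\<And>x. m *\<^sub>C W x - T (W x) = x - q.Q x"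
    "\<And>x. W x - q.Q (W x) = W x"
proof -
  define P where "P x = x - q.Q x" for x
  note Q = bounded_clinear_op_simps[OF q.riesz_bounded]
  have P: "bounded_clinear_op P"
    unfolding P_def by (intro bounded_clinear_op_intros q.riesz_bounded)
  have PP: "P (P x) = P x" for x by (simp add: P_def Q q_idempotent)
  have PR: "P (R w x) = R w (P x)" if "w \<in> \<rho>" for w x
    using that by (simp add: P_def q.riesz_resolvent_commute bounded_clinear_op_simps[OF resolvent_bounded])
  have "\<exists>W. bounded_clinear_op W \<and> (\<forall>x. (m - \<omega> 0) *\<^sub>C W x + (\<Sum>j=1..N. (- \<omega> j) *\<^sub>C R (zs j) (W x)) = P x)"
  proof (rule rational_function_invertible_mod[OF P PP PR _ inj_poles poles_resolvent_set])
    show "m - \<omega> 0 \<noteq> 0" using w0 m by (metis eq_iff_diff_eq_0)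
    fix \<mu> assume \<mu>: "\<mu> \<notin> zs ` {1..N}" "m - \<omega> 0 + (\<Sum>j=1..N. - \<omega> j / (zs j - \<mu>)) = 0"
    have "r \<mu> = m" using \<mu>(2) by (simp add: rfun_def sum_negf) (metis add.commute diff_add_cancel)
    then have "\<mu> \<in> rinv N \<omega> zs m" using \<mu>(1) by (simp add: rinv_def)
    then have "\<mu> \<in> \<rho> \<or> \<mu> \<in> L" using preimage m by blast
    then show "\<exists>G. reduced_resolvent P \<mu> G"
    proof
      assume "\<mu> \<in> \<rho>" then show ?thesis using reduced_resolvent_resolvent_set[OF P] by blast
    next
      assume l: "\<mu> \<in> L"
      then show ?thesis
        using q.cauchy_transform_resolvent[OF L_not_loop[OF l]] q.cauchy_transform_bounded[OF L_not_loop[OF l]]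
          q_winding(1)[OF l] by (auto simp: reduced_resolvent_def P_def)
    qed
  qed auto
  then obtain W where W: "bounded_clinear_op W"
    "\<And>x. (m - \<omega> 0) *\<^sub>C W x + (\<Sum>j=1..N. (- \<omega> j) *\<^sub>C R (zs j) (W x)) = P x" by blast
  have mW: "m *\<^sub>C W x - T (W x) = P x" for x
    using W(2)[of x] by (simp add: T_def cvs.scale_left_diff_distrib sum_negf algebra_simps)
  show thesis
  proof (rule that)
    \<comment> \<open>Composing with \<open>P\<close> places the inverse in the range of
      \<open>P\<close>; the equation survives because \<open>T\<close> commutes with
      \<open>P\<close>.\<close>
    show "bounded_clinear_op (\<lambda>x. P (W x))" by (rule bounded_clinear_op_compose[OF P W(1)])
    show "P (W x) - q.Q (P (W x)) = P (W x)" for x using PP[of "W x"] by (simp add: P_def)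
    have "m *\<^sub>C P (W x) - T (P (W x)) = P (m *\<^sub>C W x - T (W x))" for x
      by (simp add: P_def Q q_commute_T bounded_clinear_op_simps[OF bounded_T] cvs.scale_right_diff_distrib)
    then show "m *\<^sub>C P (W x) - T (P (W x)) = x - q.Q x" for x
      by (simp only: mW PP) (simp only: P_def)
  qed
qed

text \<open>The identity \<open>F = W + (m - z) F W\<close> compares the resolvent at
  \<open>z\<close> with the inverse at \<open>m\<close>. For each \<open>z\<close> the norm of
  \<open>F\<close> is finite, so within radius \<open>1 / (2 * K)\<close> it can be absorbed:
  \<open>onorm F \<le> K + onorm F / 2\<close> gives \<open>2 * K\<close>, uniformly in
  \<open>z\<close>.\<close>

lemma p_annihilates: "p.Q (x - q.Q x) = 0"
proof (rule p.riesz_eq_0_bounded[OF _ open_rL rL_disjoint])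
  show "finite (r ` L)" using L(1) by simp
  fix m assume "m \<in> r ` L"
  then obtain W where W: "bounded_clinear_op W" "\<And>x. m *\<^sub>C W x - T (W x) = x - q.Q x"
    "\<And>x. W x - q.Q (W x) = W x"
    using T_invertible_mod by blast
  obtain K where K: "K > 0" "\<And>x. norm (W x) \<le> K * norm x"
    using bounded_clinear_op_pos_bound[OF W(1)] by blast
  have bound: "norm (T.R z (x - q.Q x)) \<le> 2 * K * norm x" if z: "z \<in> ball m (1 / (2 * K))" "z \<in> T.\<rho>" for z x
  proof -
    define F where "F x = T.R z (x - q.Q x)" for x
    note Rz = bounded_clinear_op_simps[OF T.resolvent_bounded[OF z(2)]]
    have F: "bounded_clinear_op F"
      unfolding F_def
      by (intro bounded_clinear_op_compose[OF T.resolvent_bounded[OF z(2)]] bounded_clinear_op_intros q.riesz_bounded)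
    note blF = bounded_clinear_op_bounded_linear[OF F]
    have eq: "F x = W x + (m - z) *\<^sub>C F (W x)" for x
    proof -
      have "x - q.Q x = (z *\<^sub>C W x - T (W x)) + (m - z) *\<^sub>C (W x - q.Q (W x))"
        unfolding W(3) by (simp add: W(2)[of x, symmetric] cvs.scale_left_diff_distrib)
      then have "F x = T.R z (z *\<^sub>C W x - T (W x)) + (m - z) *\<^sub>C F (W x)"
        unfolding F_def by (simp only: Rz)
      then show ?thesis using T.resolvent_eqI[OF z(2), of "W x"] by simp
    qed
    have small: "cmod (m - z) * K \<le> 1 / 2" using z(1) K(1) by (simp add: dist_norm field_simps)
    have "norm (F x) \<le> (K + onorm F / 2) * norm x" for x
    proof -
      have "norm (F x) \<le> norm (W x) + cmod (m - z) * norm (F (W x))"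
        by (subst eq) (metis norm_scaleC norm_triangle_ineq)
      also have "\<dots> \<le> K * norm x + cmod (m - z) * (onorm F * (K * norm x))"
        using K(2)[of x] onorm[OF blF, of "W x"] onorm_pos_le[OF blF]
        by (intro add_mono mult_left_mono order_trans[OF onorm[OF blF]]) auto
      also have "\<dots> = K * norm x + (cmod (m - z) * K) * (onorm F * norm x)" by (simp add: mult_ac)
      also have "\<dots> \<le> K * norm x + 1 / 2 * (onorm F * norm x)"
        using small onorm_pos_le[OF blF] by (intro add_mono mult_right_mono) auto
      finally show ?thesis by (simp add: algebra_simps)
    qed
    then have "onorm F \<le> K + onorm F / 2"
      using K(1) onorm_pos_le[OF blF] by (intro onorm_bound) auto
    then have "onorm F \<le> 2 * K" by simp
    then show ?thesis
      using onorm[OF blF, of x] mult_right_mono[of "onorm F" "2 * K" "norm x"] unfolding F_def by simp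
  qed
  show "\<exists>e>0. \<exists>M. \<forall>z\<in>ball m e \<inter> T.\<rho>. norm (T.R z (x - q.Q x)) \<le> M"
    using bound K(1) by (intro exI[of _ "1 / (2 * K)"] conjI exI[of _ "2 * K * norm x"]) auto
qed (use p_winding(2) in auto)

text \<open>The two annihilation lemmas and commutation give
  \<open>s *\<^sub>C q.Q x = p.Q (q.Q x)\<close> and \<open>p.Q x = q.Q (p.Q x)\<close>, one
  inclusion each.\<close>

theorem range_riesz_eq: "range q.Q = range p.Q"
proof (intro equalityI subsetI)
  fix y assume "y \<in> range q.Q"
  then obtain x where x: "y = q.Q x" by blast
  have "s *\<^sub>C q.Q x = p.Q (q.Q x)"
    using q_annihilates[of x] by (simp add: bounded_clinear_op_simps[OF q.riesz_bounded] q_commute_p)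
  then have "p.Q ((1 / s) *\<^sub>C q.Q x) = y"
    using s_nz by (simp add: bounded_clinear_op_simps[OF p.riesz_bounded] x)
      (metis cvs.scale_one divide_self_if scaleC_scaleC times_divide_eq_left mult_1)
  then show "y \<in> range p.Q" by blast
next
  fix y assume "y \<in> range p.Q"
  then obtain x where x: "y = p.Q x" by blast
  have "p.Q x = p.Q (q.Q x)"
    using p_annihilates[of x] by (simp add: bounded_clinear_op_simps[OF p.riesz_bounded])
  then have "p.Q x = q.Q (p.Q x)" unfolding q_commute_p .
  then show "y \<in> range q.Q" using x by blast
qed

end

section \<open>Generalized Rayleigh quotients\<close>

lemma cinner_sum_left: "cinner (\<Sum>i\<in>I. f i) y = (\<Sum>i\<in>I. cinner (f i) y)"
  by (rule linear_sum[OF bounded_linear.linear[OF bounded_linear_cinner_left]])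

lemma cinner_sum_right: "cinner y (\<Sum>i\<in>I. f i) = (\<Sum>i\<in>I. cinner y (f i))"
  by (subst cinner_commute, simp only: cinner_sum_left cnj_sum, rule sum.cong[OF refl],
      rule cinner_commute[symmetric])

lemma norm_add_square:
  "(norm (u + w :: 'a::complex_inner))\<^sup>2 = (norm u)\<^sup>2 + (norm w)\<^sup>2 + 2 * Re (cinner u w)"
proof -
  have "complex_of_real ((norm (u + w))\<^sup>2) = cinner u u + cinner w w + (cinner u w + cnj (cinner u w))"
    by (simp add: cinner_self_norm[symmetric] cinner_add_left cinner_add_right cinner_commute[of w u]
        del: of_real_power)
  also have "\<dots> = complex_of_real ((norm u)\<^sup>2 + (norm w)\<^sup>2 + 2 * Re (cinner u w))"
    by (simp add: cinner_self_norm complex_add_cnj)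
  finally show ?thesis using of_real_eq_iff by blast
qed

text \<open>Coefficients are functions on a whole index type; forcing them to vanish off
  \<open>I\<close> puts the sphere into a product of compact factors, so that Tychonoff's theorem
  applies.\<close>

lemma compact_coefficient_sphere:
  assumes "finite I"
  shows "compact {y :: 'i \<Rightarrow> complex. (\<forall>i. i \<notin> I \<longrightarrow> y i = 0) \<and> (\<Sum>i\<in>I. (cmod (y i))\<^sup>2) = 1}"
proof -
  let ?B = "PiE UNIV (\<lambda>i. if i \<in> I then cball 0 1 else {0}) :: ('i \<Rightarrow> complex) set"
  have "compactin (product_topology (\<lambda>i. euclidean) UNIV) ?B"
    by (subst compactin_PiE) (auto simp: compactin_euclidean_iff)
  then have "compact ?B" by (simp add: euclidean_product_topology compactin_euclidean_iff)
  moreover have "closed {y :: 'i \<Rightarrow> complex. (\<Sum>i\<in>I. (cmod (y i))\<^sup>2) = 1}"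
    by (intro closed_Collect_eq continuous_intros continuous_on_product_coordinates)
  ultimately have "compact (?B \<inter> {y. (\<Sum>i\<in>I. (cmod (y i))\<^sup>2) = 1})" by (rule compact_Int_closed)
  also have "?B \<inter> {y. (\<Sum>i\<in>I. (cmod (y i))\<^sup>2) = 1}
      = {y. (\<forall>i. i \<notin> I \<longrightarrow> y i = 0) \<and> (\<Sum>i\<in>I. (cmod (y i))\<^sup>2) = 1}"
  proof -
    have "cmod (y i) \<le> 1" if "i \<in> I" "(\<Sum>i\<in>I. (cmod (y i))\<^sup>2) = 1" for y :: "'i \<Rightarrow> complex" and i
      using member_le_sum[of i I "\<lambda>i. (cmod (y i))\<^sup>2"] that assms by (simp add: power_le_one_iff abs_square_le_1)
    then show ?thesis by (auto simp: PiE_iff split: if_splits)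
  qed
  finally show ?thesis .
qed

context
  fixes e :: "nat \<Rightarrow> 'v::complex_inner" and L :: nat and U V :: "'v set" and F :: "'v \<Rightarrow> 'y::complex_inner"
  assumes basis: "is_cbasis U L e" and V: "csubspace V" "U \<subseteq> V" and F: "clinear_on V F"
begin

private abbreviation (input) "I \<equiv> {1..L}"

private definition comb :: "(nat \<Rightarrow> complex) \<Rightarrow> 'v" where "comb y = (\<Sum>i\<in>I. y i *\<^sub>C e i)"

lemma comb_surj: "w \<in> U \<Longrightarrow> \<exists>y. w = comb y"
proof -
  assume "w \<in> U"
  then have "w \<in> cspan (e ` I)" using basis by (simp add: is_cbasis_def)
  then obtain u where "w = (\<Sum>v\<in>e ` I. u v *\<^sub>C v)"
    unfolding cspan_def by (auto simp: cvs.span_finite)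
  then have "w = comb (\<lambda>i. u (e i))"
    using basis by (simp add: is_cbasis_def comb_def sum.reindex)
  then show ?thesis by blast
qed

lemma basis_mem: "i \<in> I \<Longrightarrow> e i \<in> U"
  using basis unfolding is_cbasis_def cspan_def by (auto intro: cvs.span_base)

lemma csubspace_U: "csubspace U"
  using basis unfolding is_cbasis_def cspan_def csubspace_def by (metis cvs.subspace_span)

lemma comb_mem: "comb y \<in> U"
  using csubspace_U basis_mem unfolding comb_def csubspace_def
  by (intro cvs.subspace_sum cvs.subspace_scale) auto

lemma comb_nonzero: "i \<in> I \<Longrightarrow> y i \<noteq> 0 \<Longrightarrow> comb y \<noteq> 0"
proof
  assume i: "i \<in> I" "y i \<noteq> 0" and 0: "comb y = 0"
  have inj: "inj_on e I" using basis by (simp add: is_cbasis_def)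
  let ?u = "\<lambda>v. y (inv_into I e v)"
  have "(\<Sum>v\<in>e ` I. ?u v *\<^sub>C v) = 0"
    using 0 inj by (simp add: sum.reindex comb_def)
  moreover have "\<exists>v\<in>e ` I. ?u v \<noteq> 0" using i inj by (intro bexI[of _ "e i"]) simp_all
  ultimately have "cdependent (e ` I)"
    unfolding cdependent_def cvs.dependent_finite[OF finite_imageI[OF finite_atLeastAtMost]]
    by (intro exI[of _ ?u] conjI)
  then show False using basis by (simp add: is_cbasis_def)
qed

lemma F_add: "u \<in> U \<Longrightarrow> w \<in> U \<Longrightarrow> F (u + w) = F u + F w"
  using F subsetD[OF V(2), of u] subsetD[OF V(2), of w] by (simp add: clinear_on_def)

lemma F_scaleC: "u \<in> U \<Longrightarrow> F (c *\<^sub>C u) = c *\<^sub>C F u"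
  using F subsetD[OF V(2), of u] by (simp add: clinear_on_def)

lemma F_comb: "F (comb y) = (\<Sum>i\<in>I. y i *\<^sub>C F (e i))"
proof -
  have 0: "F 0 = 0" using F_scaleC[of 0 0] csubspace_U by (simp add: csubspace_def cvs.subspace_0)
  have "F (\<Sum>i\<in>J. y i *\<^sub>C e i) = (\<Sum>i\<in>J. y i *\<^sub>C F (e i)) \<and> (\<Sum>i\<in>J. y i *\<^sub>C e i) \<in> U" if "J \<subseteq> I" for J
    using finite_subset[OF that finite_atLeastAtMost] that
  proof (induction J rule: finite_induct)
    case empty
    then show ?case using csubspace_U by (simp add: 0 csubspace_def cvs.subspace_0)
  next
    case (insert j J)
    then have m: "y j *\<^sub>C e j \<in> U" using basis_mem csubspace_U by (auto simp: csubspace_def intro: cvs.subspace_scale)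
    then show ?case
      using insert csubspace_U basis_mem
      by (auto simp: F_add F_scaleC csubspace_def intro: cvs.subspace_add)
  qed
  then show ?thesis by (simp add: comb_def)
qed

lemma gramG_mult: "(\<Sum>j\<in>I. gramG F e i j * y j) = cinner (F (comb y)) (F (e i))"
  and gramM_mult: "(\<Sum>j\<in>I. gramM e i j * y j) = cinner (comb y) (e i)"
  by (simp_all add: F_comb gramG_def gramM_def cinner_sum_left cinner_scaleC_left mult.commute)
    (simp add: comb_def cinner_sum_left cinner_scaleC_left mult.commute)

text \<open>A maximizer of the quotient $\|Fw\|^2/\|w\|^2$ is stationary, hence an eigenvector.\<close>
lemma rayleigh_maximum:
  assumes "L \<ge> 1"
  obtains m where "complex_of_real m \<in> gen_eigvals L (gramG F e) (gramM e)"
    "\<And>w. w \<in> U \<Longrightarrow> (norm (F w))\<^sup>2 \<le> m * (norm w)\<^sup>2"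
proof -
  define K where "K = {y :: nat \<Rightarrow> complex. (\<forall>i. i \<notin> I \<longrightarrow> y i = 0) \<and> (\<Sum>i\<in>I. (cmod (y i))\<^sup>2) = 1}"
  define f where "f y = (norm (F (comb y)))\<^sup>2 / (norm (comb y))\<^sup>2" for y
  have K_nz: "\<exists>i\<in>I. y i \<noteq> 0" if "y \<in> K" for y
    using that by (auto simp: K_def intro: ccontr)
  have nz: "comb y \<noteq> 0" if "y \<in> K" for y using K_nz[OF that] comb_nonzero by blast
  have scale: "\<exists>y'\<in>K. \<exists>c. c \<noteq> 0 \<and> comb y = c *\<^sub>C comb y'" if "comb y \<noteq> 0" for y
  proof -
    define n where "n = sqrt (\<Sum>i\<in>I. (cmod (y i))\<^sup>2)"
    have "\<exists>i\<in>I. y i \<noteq> 0"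
    proof (rule ccontr)
      assume "\<not> ?thesis"
      then have "comb y = 0" unfolding comb_def by (intro sum.neutral) simp
      then show False using that by simp
    qed
    then obtain i where "i \<in> I" "y i \<noteq> 0" by blast
    then have "(\<Sum>i\<in>I. (cmod (y i))\<^sup>2) > 0" by (intro sum_pos2[of I i]) auto
    then have n: "n > 0" "n\<^sup>2 = (\<Sum>i\<in>I. (cmod (y i))\<^sup>2)" by (simp_all add: n_def)
    define y' where "y' i = (if i \<in> I then y i / complex_of_real n else 0)" for i
    have "(\<Sum>i\<in>I. (cmod (y' i))\<^sup>2) = (\<Sum>i\<in>I. (cmod (y i))\<^sup>2) / n\<^sup>2"
      using n(1) by (simp add: y'_def norm_divide power_divide sum_divide_distrib)
    then have "y' \<in> K" using n by (auto simp: K_def y'_def)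
    moreover have "comb y = complex_of_real n *\<^sub>C comb y'"
      using n(1) by (simp add: comb_def cvs.scale_sum_right y'_def)
    moreover have "complex_of_real n \<noteq> 0" using n(1) by simp
    ultimately show ?thesis by blast
  qed
  have "comb (\<lambda>i. 1) \<noteq> 0" using comb_nonzero[of 1] assms by simp
  then have "K \<noteq> {}" using scale by blast
  have coord: "continuous_on K (\<lambda>y. y i)" for i
    by (rule continuous_on_subset[OF continuous_on_product_coordinates]) simp
  \<comment> \<open>No continuity of \<open>F\<close> is assumed; on combinations of the basis it is
    a finite sum in the coordinates.\<close>
  have "continuous_on K f"
    unfolding f_def F_comb
  proof (intro continuous_intros coord ballI)
    show "continuous_on K comb" unfolding comb_def by (intro continuous_intros coord)
  qed (simp add: nz)
  moreover have "compact K" unfolding K_def by (rule compact_coefficient_sphere) simp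
  ultimately obtain y0 where y0: "y0 \<in> K" "\<And>y. y \<in> K \<Longrightarrow> f y \<le> f y0"
    using continuous_attains_sup[of K f] \<open>K \<noteq> {}\<close> by blast
  define m where "m = f y0"
  define u where "u = comb y0"
  have u: "u \<in> U" "u \<noteq> 0" using comb_mem nz[OF y0(1)] by (auto simp: u_def)
  have le: "(norm (F w))\<^sup>2 \<le> m * (norm w)\<^sup>2" if w: "w \<in> U" for w
  proof (cases "w = 0")
    case True
    then show ?thesis using F_scaleC[OF w, of 0] by simp
  next
    case False
    obtain y where y: "w = comb y" using comb_surj[OF w] by blast
    then obtain y' c where c: "y' \<in> K" "c \<noteq> 0" "w = c *\<^sub>C comb y'" using scale False by blast
    have "(norm (F (comb y')))\<^sup>2 \<le> m * (norm (comb y'))\<^sup>2"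
      using y0(2)[OF c(1)] nz[OF c(1)] by (simp add: f_def m_def field_simps)
    then have "(cmod c)\<^sup>2 * (norm (F (comb y')))\<^sup>2 \<le> (cmod c)\<^sup>2 * (m * (norm (comb y'))\<^sup>2)"
      by (rule mult_left_mono) simp
    then show ?thesis
      by (simp add: c(3) F_scaleC comb_mem norm_scaleC power_mult_distrib mult_ac)
  qed
  have eq: "(norm (F u))\<^sup>2 = m * (norm u)\<^sup>2"
    using u(2) by (simp add: m_def f_def u_def)
  have stationary: "cinner (F u) (F w) = m * cinner u w" if w: "w \<in> U" for w
  proof (rule ccontr)
    assume ne: "\<not> ?thesis"
    define h where "h = cinner (F u) (F w) - m * cinner u w"
    define B where "B = m * (norm w)\<^sup>2 - (norm (F w))\<^sup>2"
    have B: "B \<ge> 0" using le[OF w] by (simp add: B_def)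
    \<comment> \<open>The step \<open>t = \<epsilon> h\<close> gains
      \<open>2 \<epsilon> |h|^2\<close> to first order against a loss
      \<open>\<epsilon>^2 B |h|^2\<close>, and this choice makes
      \<open>\<epsilon> B < 1\<close>.\<close>
    define \<epsilon> where "\<epsilon> = 1 / (B + 1)"
    define t where "t = complex_of_real \<epsilon> * h"
    have \<epsilon>: "\<epsilon> > 0" "\<epsilon> * B < 1" using B by (simp_all add: \<epsilon>_def)
    have h: "h \<noteq> 0" using ne by (simp add: h_def)
    have tw: "t *\<^sub>C w \<in> U" using w csubspace_U by (simp add: csubspace_def cvs.subspace_scale)
    have "u + t *\<^sub>C w \<in> U" using u tw csubspace_U by (simp add: csubspace_def cvs.subspace_add)
    from le[OF this] have "(norm (F u))\<^sup>2 + (cmod t)\<^sup>2 * (norm (F w))\<^sup>2 + 2 * Re (cnj t * cinner (F u) (F w))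
        \<le> m * ((norm u)\<^sup>2 + (cmod t)\<^sup>2 * (norm w)\<^sup>2 + 2 * Re (cnj t * cinner u w))"
      by (simp add: F_add[OF u(1) tw] F_scaleC[OF w] norm_add_square norm_scaleC power_mult_distrib cinner_scaleC_right)
    then have "2 * (Re (cnj t * cinner (F u) (F w)) - m * Re (cnj t * cinner u w)) \<le> (cmod t)\<^sup>2 * B"
      unfolding B_def eq by (simp add: algebra_simps)
    also have "Re (cnj t * cinner (F u) (F w)) - m * Re (cnj t * cinner u w) = Re (cnj t * h)"
      by (simp add: h_def algebra_simps)
    also have "cnj t * h = complex_of_real (\<epsilon> * (cmod h)\<^sup>2)"
      by (simp add: t_def mult.commute[of "cnj h"] complex_norm_square[symmetric] mult.assoc del: of_real_power)
    also have "(cmod t)\<^sup>2 = \<epsilon>\<^sup>2 * (cmod h)\<^sup>2"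
      using \<epsilon>(1) by (simp add: t_def norm_mult power_mult_distrib)
    finally have "2 * (\<epsilon> * (cmod h)\<^sup>2) \<le> (\<epsilon> * B) * (\<epsilon> * (cmod h)\<^sup>2)"
      by (simp only: Re_complex_of_real power2_eq_square mult_ac)
    moreover have "\<epsilon> * (cmod h)\<^sup>2 > 0" using \<epsilon>(1) h by simp
    ultimately have "2 \<le> \<epsilon> * B" by (rule mult_right_le_imp_le)
    then show False using \<epsilon>(2) by simp
  qed
  show thesis
  proof (rule that[OF _ le])
    show "complex_of_real m \<in> gen_eigvals L (gramG F e) (gramM e)"
      unfolding gen_eigvals_def gramG_mult gramM_mult mem_Collect_eq
      using K_nz[OF y0(1)] stationary[OF basis_mem] unfolding u_def by blast
  qed
qed

text \<open>Pairing the eigenvector equation with \<open>x\<close> identifies \<open>lam\<close> as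
  the Rayleigh quotient at \<open>comb x\<close>; the maximal quotient is itself an eigenvalue by
  \<open>rayleigh_maximum\<close>, so the top eigenvalue attains it.\<close>

lemma norm_le_top_eigenvector:
  assumes "is_top_gen_eigvec L (gramG F e) (gramM e) x" "w \<in> U"
  shows "norm (F w) \<le> norm (F (ehat L e x)) * norm w"
proof -
  obtain lam where lam: "\<And>\<mu>. \<mu> \<in> gen_eigvals L (gramG F e) (gramM e) \<Longrightarrow> Re \<mu> \<le> Re lam"
    "\<exists>i\<in>I. x i \<noteq> 0"
    "\<And>i. i \<in> I \<Longrightarrow> (\<Sum>j=1..L. gramG F e i j * x j) = lam * (\<Sum>j=1..L. gramM e i j * x j)"
    using assms(1) unfolding is_top_gen_eigvec_def by blast
  let ?X = "comb x"
  have X: "?X \<noteq> 0" "?X \<in> U" using lam(2) comb_nonzero comb_mem by auto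
  have eig: "cinner (F ?X) (F (e i)) = lam * cinner ?X (e i)" if "i \<in> I" for i
    using lam(3)[OF that] by (simp only: gramG_mult gramM_mult)
  have "cinner (F ?X) (F ?X) = (\<Sum>i\<in>I. cnj (x i) * cinner (F ?X) (F (e i)))"
    by (subst (2) F_comb) (simp add: cinner_sum_right cinner_scaleC_right)
  also have "\<dots> = lam * (\<Sum>i\<in>I. cnj (x i) * cinner ?X (e i))"
    by (simp add: eig sum_distrib_left mult.left_commute)
  also have "(\<Sum>i\<in>I. cnj (x i) * cinner ?X (e i)) = cinner ?X ?X"
    by (subst (3) comb_def) (simp add: cinner_sum_right cinner_scaleC_right)
  finally have "complex_of_real ((norm (F ?X))\<^sup>2) = lam * complex_of_real ((norm ?X)\<^sup>2)"
    by (simp only: cinner_self_norm)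
  then have "lam = complex_of_real ((norm (F ?X))\<^sup>2 / (norm ?X)\<^sup>2)"
    using X(1) by (simp add: field_simps)
  then have Re_lam: "Re lam = (norm (F ?X) / norm ?X)\<^sup>2" by (simp only: Re_complex_of_real power_divide)
  have "ehat L e x = complex_of_real (1 / norm ?X) *\<^sub>C ?X"
    by (simp add: ehat_def Let_def comb_def scaleR_scaleC)
  then have "F (ehat L e x) = complex_of_real (1 / norm ?X) *\<^sub>C F ?X"
    by (simp only: F_scaleC[OF X(2)])
  then have hat: "norm (F (ehat L e x)) = norm (F ?X) / norm ?X"
    by (simp add: norm_scaleC norm_divide)
  have "L \<ge> 1" using lam(2) by auto
  then obtain m where m: "complex_of_real m \<in> gen_eigvals L (gramG F e) (gramM e)"
    "\<And>w. w \<in> U \<Longrightarrow> (norm (F w))\<^sup>2 \<le> m * (norm w)\<^sup>2"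
    using rayleigh_maximum by blast
  have "(norm (F w))\<^sup>2 \<le> m * (norm w)\<^sup>2" by (rule m(2)[OF assms(2)])
  also have "\<dots> \<le> (norm (F (ehat L e x)))\<^sup>2 * (norm w)\<^sup>2"
    using lam(1)[OF m(1)] by (intro mult_right_mono) (simp_all add: Re_lam hat)
  finally have "(norm (F w))\<^sup>2 \<le> (norm (F (ehat L e x)) * norm w)\<^sup>2" by (simp add: power_mult_distrib)
  then show ?thesis by (rule power2_le_imp_le) simp
qed

end

section \<open>Operators on the embedded space\<close>

text \<open>The common shape of S_r and its discretizations: a multiple of the identity plus a map
  \<open>F\<close> with values in V. It acts on H as \<open>TH\<close> and on V as
  \<open>SV\<close>, intertwined by \<open>emb\<close>.\<close>

locale embedded_operator =
  fixes emb :: "'v::chilbert \<Rightarrow> 'h::chilbert" and w :: complex and F :: "'h \<Rightarrow> 'v"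
  assumes emb: "bounded_clinear_op emb" "inj emb" and F: "bounded_clinear_op F"
begin

definition TH :: "'h \<Rightarrow> 'h" where "TH x = w *\<^sub>C x + emb (F x)"
definition SV :: "'v \<Rightarrow> 'v" where "SV v = w *\<^sub>C v + F (emb v)"

lemmas emb_simps = bounded_clinear_op_simps[OF emb(1)]
lemmas F_simps = bounded_clinear_op_simps[OF F]

lemma bounded_TH: "bounded_clinear_op TH" and bounded_SV: "bounded_clinear_op SV"
  unfolding TH_def SV_def
  by (rule bounded_clinear_op_plus[OF bounded_clinear_op_scale[OF bounded_clinear_op_id]]
      bounded_clinear_op_compose[OF emb(1) F] bounded_clinear_op_compose[OF F emb(1)])+

sublocale H: clinear_operator UNIV TH by (rule clinear_operator_bounded[OF bounded_TH])
sublocale V: clinear_operator UNIV SV by (rule clinear_operator_bounded[OF bounded_SV])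

lemma emb_eq_iff: "emb u = emb v \<longleftrightarrow> u = v"
  using emb(2) by (auto dest: injD)

lemma TH_emb: "TH (emb v) = emb (SV v)"
  by (simp add: TH_def SV_def emb_simps)

text \<open>At \<open>z = w\<close> the operator \<open>z - TH\<close> reduces to
  \<open>- emb \<circ> F\<close>, so its surjectivity forces that of \<open>emb\<close>.\<close>

lemma surj_of_resolvent_set:
  assumes "w \<in> H.\<rho>" shows "range emb = UNIV"
proof -
  have "y \<in> range emb" for y
  proof -
    have "y = emb (- F (H.R w y))"
      using H.resolvent_eq[OF assms, of y] by (simp add: TH_def emb_simps)
    then show ?thesis by blast
  qed
  then show ?thesis by blast
qed

text \<open>For \<open>z \<noteq> w\<close> a solution in H with right-hand side in V lies in V,
  because \<open>(z - w) x = y + F x\<close> up to \<open>emb\<close>. In the other direction one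
  solves in V for \<open>F x\<close> and recovers \<open>x\<close> from it.\<close>

lemma resolvent_set_iff:
  assumes z: "z \<noteq> w \<or> range emb = UNIV"
  shows "z \<in> H.\<rho> \<longleftrightarrow> z \<in> V.\<rho>"
proof
  assume H: "z \<in> H.\<rho>"
  show "z \<in> V.\<rho>"
  proof (rule bounded_op_resolvent_setI[OF bounded_SV])
    fix y
    let ?x = "H.R z (emb y)"
    have x: "z *\<^sub>C ?x - TH ?x = emb y" using H.resolvent_eq[OF H] by simp
    have "?x \<in> range emb"
    proof (cases "z = w")
      case False
      have "(z - w) *\<^sub>C ?x = emb (y + F ?x)"
        using x by (simp add: TH_def cvs.scale_left_diff_distrib emb_simps algebra_simps)
      then have "(1 / (z - w)) *\<^sub>C (z - w) *\<^sub>C ?x = emb ((1 / (z - w)) *\<^sub>C (y + F ?x))"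
        by (simp only: emb_simps)
      then show ?thesis using False by simp
    qed (use z in auto)
    then obtain v where v: "?x = emb v" by blast
    show "\<exists>!v. z *\<^sub>C v - SV v = y"
    proof (rule ex1I[of _ v])
      show "z *\<^sub>C v - SV v = y"
        using x unfolding v TH_emb emb_eq_iff[symmetric] by (simp add: emb_simps)
      fix u assume u: "z *\<^sub>C u - SV u = y"
      then have "z *\<^sub>C emb u - TH (emb u) = emb y"
        unfolding u[symmetric] TH_emb by (simp add: emb_simps)
      then have "?x = emb u" using H.resolvent_eqI[OF H, of "emb u" "emb y"] by simp
      then show "u = v" using v emb_eq_iff by simp
    qed
  qed
next
  assume V: "z \<in> V.\<rho>"
  have inj: "x = 0" if x: "z *\<^sub>C x - TH x = 0" for x
  proof -
    have "x \<in> range emb"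
    proof (cases "z = w")
      case False
      have "(z - w) *\<^sub>C x = emb (F x)"
        using x by (simp add: TH_def cvs.scale_left_diff_distrib algebra_simps)
      then have "(1 / (z - w)) *\<^sub>C (z - w) *\<^sub>C x = emb ((1 / (z - w)) *\<^sub>C F x)"
        by (simp only: emb_simps)
      then show ?thesis using False by simp
    qed (use z in auto)
    then obtain v where v: "x = emb v" by blast
    have "z *\<^sub>C v - SV v = 0"
      using x unfolding v TH_emb emb_eq_iff[symmetric] by (simp add: emb_simps)
    then have "v = 0"
      using V.resolvent_eqI[OF V, of v 0] bounded_clinear_op_zero[OF V.resolvent_bounded[OF V]] by simp
    then show ?thesis by (simp add: v emb_simps)
  qed
  show "z \<in> H.\<rho>"
  proof (rule bounded_op_resolvent_setI[OF bounded_TH])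
    fix y
    have "\<exists>x. z *\<^sub>C x - TH x = y"
    proof (cases "z = w")
      case True
      then obtain u where u: "y = emb u" using z by blast
      have "z *\<^sub>C emb (V.R z u) - TH (emb (V.R z u)) = emb (z *\<^sub>C V.R z u - SV (V.R z u))"
        by (simp add: TH_emb emb_simps)
      then show ?thesis using V.resolvent_eq[OF V] u by metis
    next
      case False
      let ?v = "V.R z (F y)"
      define x where "x = (1 / (z - w)) *\<^sub>C (y + emb ?v)"
      have v: "(z - w) *\<^sub>C ?v = F y + F (emb ?v)"
        using V.resolvent_eq[OF V, of "F y"] by (simp add: SV_def cvs.scale_left_diff_distrib algebra_simps)
      have "F x = (1 / (z - w)) *\<^sub>C (z - w) *\<^sub>C ?v" unfolding v x_def by (simp only: F_simps)
      then have Fx: "F x = ?v" using False by simp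
      have "z *\<^sub>C x - TH x = (z - w) *\<^sub>C x - emb (F x)"
        by (simp add: TH_def cvs.scale_left_diff_distrib)
      also have "\<dots> = y" unfolding Fx using False by (simp add: x_def)
      finally show ?thesis by blast
    qed
    then obtain x where x: "z *\<^sub>C x - TH x = y" by blast
    show "\<exists>!x. z *\<^sub>C x - TH x = y"
    proof (rule ex1I[of _ x])
      show "z *\<^sub>C x - TH x = y" by (rule x)
      fix u assume "z *\<^sub>C u - TH u = y"
      then have "z *\<^sub>C (u - x) - TH (u - x) = 0"
        using x by (simp add: bounded_clinear_op_simps[OF bounded_TH] cvs.scale_right_diff_distrib algebra_simps)
      then show "u = x" using inj by fastforce
    qed
  qed
qed

lemma emb_resolvent:
  assumes "z \<in> H.\<rho>" "z \<in> V.\<rho>" shows "emb (V.R z v) = H.R z (emb v)"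
proof (rule H.resolvent_eqI[OF assms(1), symmetric])
  have "z *\<^sub>C emb (V.R z v) - TH (emb (V.R z v)) = emb (z *\<^sub>C V.R z v - SV (V.R z v))"
    by (simp add: TH_emb emb_simps)
  then show "z *\<^sub>C emb (V.R z v) - TH (emb (V.R z v)) = emb v"
    by (simp add: V.resolvent_eq[OF assms(2)])
qed simp

end

section \<open>Riesz integrals seen from both spaces\<close>

locale embedded_loop = embedded_operator +
  fixes p :: "real \<Rightarrow> complex" and s :: complex
  assumes poly: "polynomial_function p" "pathfinish p = pathstart p"
    and H_path: "path_image p \<subseteq> H.\<rho>" and V_path: "path_image p \<subseteq> V.\<rho>"
    and s: "s \<noteq> 0" and winding: "\<And>z. z \<notin> H.\<rho> \<Longrightarrow> winding_number p z = 0 \<or> winding_number p z = s"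
begin

sublocale HL: resolvent_loop UNIV TH p by unfold_locales (rule poly H_path)+
sublocale VL: resolvent_loop UNIV SV p by unfold_locales (rule poly V_path)+

lemma emb_riesz: "emb (VL.Q v) = HL.Q (emb v)"
proof -
  have "emb (vcontour_integral p (\<lambda>z. V.R z v)) = vcontour_integral p (\<lambda>z. emb (V.R z v))"
    by (rule vcontour_integral_linear[OF VL.vcontour_integrable_resolvent emb(1), symmetric])
  also have "\<dots> = vcontour_integral p (\<lambda>z. H.R z (emb v))"
    by (rule vcontour_integral_cong) (use H_path V_path emb_resolvent in blast)
  finally show ?thesis by (simp add: riesz_def emb_simps)
qed

text \<open>Since the integral squares to \<open>s\<close> times itself, its range is its eigenspace
  for \<open>s\<close>; such an equation passes to V by injectivity of \<open>emb\<close>.\<close>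

lemma vimage_range_riesz: "emb -` range HL.Q = {v. VL.Q v = s *\<^sub>C v}"
proof -
  have "emb v \<in> range HL.Q \<longleftrightarrow> HL.Q (emb v) = s *\<^sub>C emb v" for v
  proof
    assume "emb v \<in> range HL.Q"
    then show "HL.Q (emb v) = s *\<^sub>C emb v" using HL.riesz_idempotent[OF s winding] by auto
  next
    assume "HL.Q (emb v) = s *\<^sub>C emb v"
    then have "HL.Q ((1 / s) *\<^sub>C emb v) = emb v"
      using s by (simp add: bounded_clinear_op_simps[OF HL.riesz_bounded])
    then show "emb v \<in> range HL.Q" by (metis rangeI)
  qed
  moreover have "HL.Q (emb v) = s *\<^sub>C emb v \<longleftrightarrow> VL.Q v = s *\<^sub>C v" for v
    by (simp add: emb_eq_iff flip: emb_riesz emb_simps(2))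
  ultimately show ?thesis by auto
qed

lemma VL_idempotent: "VL.Q (VL.Q v) = s *\<^sub>C VL.Q v"
  using HL.riesz_idempotent[OF s winding, of "emb v"]
  by (simp add: emb_eq_iff flip: emb_riesz emb_simps(2))

text \<open>Since \<open>SV - w = F \<circ> emb\<close>, the Cauchy transform at $w$ writes the Riesz projection as a value of $F$.\<close>
lemma riesz_range_F:
  assumes "w \<in> V.\<rho> \<or> (w \<notin> path_image p \<and> winding_number p w = 0)"
    and v: "VL.Q v = s *\<^sub>C v"
  shows "v \<in> range F"
  using assms(1)
proof
  assume "w \<in> V.\<rho>"
  from V.resolvent_eq[OF this, of v] have "v = F (- emb (V.R w v))"
    by (simp add: SV_def F_simps)
  then show ?thesis by blast
next
  assume w: "w \<notin> path_image p \<and> winding_number p w = 0"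
  then have "F (emb (VL.G w v)) = s *\<^sub>C v"
    using VL.cauchy_transform_solves(2)[of w v] v by (simp add: SV_def)
  then have "F ((1 / s) *\<^sub>C emb (VL.G w v)) = v" using s by (simp add: F_simps)
  then show ?thesis by (metis rangeI)
qed

end

text \<open>The resolvent difference is written with the resolvent of \<open>B\<close> on the right,
  so \<open>S - B\<close> is evaluated only at the vectors \<open>cresolvent UNIV B z x\<close>. The
  bound \<open>\<delta>\<close> may therefore exploit membership of \<open>x\<close> in a spectral
  subspace.\<close>

lemma riesz_difference_bound:
  fixes S B :: "'a::chilbert \<Rightarrow> 'a"
  assumes S: "clinear_operator UNIV S" and B: "clinear_operator UNIV B"
    and poly: "polynomial_function p" and path: "path_image p \<subseteq> cresolvent_set UNIV S"
      "path_image p \<subseteq> cresolvent_set UNIV B"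
    and L: "L > 0" "\<And>f M. continuous_on (path_image p) f \<Longrightarrow>
       (\<And>z. z \<in> path_image p \<Longrightarrow> norm (f z :: 'a) \<le> M) \<Longrightarrow> norm (vcontour_integral p f) \<le> L * M"
    and M: "\<And>z y. z \<in> path_image p \<Longrightarrow> norm (cresolvent UNIV S z y) \<le> M * norm y" "M \<ge> 0"
    and \<delta>: "\<And>z. z \<in> path_image p \<Longrightarrow>
      norm (S (cresolvent UNIV B z x) - B (cresolvent UNIV B z x)) \<le> \<delta>"
  shows "norm (riesz UNIV S p x - riesz UNIV B p x) \<le> L * M * \<delta>"
proof -
  interpret S: clinear_operator UNIV S by (rule S)
  interpret B: clinear_operator UNIV B by (rule B)
  have cont: "continuous_on (path_image p) (\<lambda>z. S.R z x)" "continuous_on (path_image p) (\<lambda>z. B.R z x)"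
    using S.continuous_on_resolvent B.continuous_on_resolvent path continuous_on_subset by blast+
  have "norm (S.R z x - B.R z x) \<le> M * \<delta>" if z: "z \<in> path_image p" for z
  proof -
    have zS: "z \<in> S.\<rho>" and zB: "z \<in> B.\<rho>" using path z by auto
    let ?u = "B.R z x"
    note R = bounded_clinear_op_simps[OF S.resolvent_bounded[OF zS]]
    have "z *\<^sub>C ?u - S ?u = x - (S ?u - B ?u)"
      using B.resolvent_eq[OF zB, of x] by (simp add: algebra_simps)
    then have "S.R z (x - (S ?u - B ?u)) = ?u"
      by (intro S.resolvent_eqI[OF zS]) auto
    then have "S.R z x - ?u = S.R z (S ?u - B ?u)" by (simp only: R) (simp add: algebra_simps)
    then show ?thesis
      using M(1)[OF z, of "S ?u - B ?u"] mult_left_mono[OF \<delta>[OF z] M(2)] by simp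
  qed
  then have "norm (vcontour_integral p (\<lambda>z. S.R z x - B.R z x)) \<le> L * (M * \<delta>)"
    using L(2)[OF continuous_on_diff[OF cont], of "M * \<delta>"] by blast
  moreover have "vcontour_integral p (\<lambda>z. S.R z x - B.R z x)
      = vcontour_integral p (\<lambda>z. S.R z x) - vcontour_integral p (\<lambda>z. B.R z x)"
    by (intro vcontour_integral_diff vcontour_integrable_continuous poly cont)
  ultimately have "norm (riesz UNIV S p x - riesz UNIV B p x) \<le> cmod (1 / (2 * of_real pi * \<i>)) * (L * (M * \<delta>))"
    by (simp only: riesz_def cvs.scale_right_diff_distrib[symmetric] norm_scaleC mult_left_mono norm_ge_zero)
  also have "\<dots> \<le> 1 * (L * (M * \<delta>))"
  proof (rule mult_right_mono)
    show "cmod (1 / (2 * of_real pi * \<i>)) \<le> 1"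
      using pi_gt3 by (simp add: norm_divide norm_mult field_simps)
    obtain z where "z \<in> path_image p" using path_image_nonempty[of p] by blast
    then have "\<delta> \<ge> 0" using \<delta> norm_ge_zero order_trans by blast
    then show "0 \<le> L * (M * \<delta>)" using L(1) M(2) by simp
  qed
  finally show ?thesis by (simp add: mult.assoc)
qed

text \<open>The distance from $E = \mathrm{ran}\, P$ to $E_h = \mathrm{ran}\, P_h$ needs no dimension count: $1 - P(P - P_h)$ is invertible, so
  every $v \in E$ is $Pw$ for some $w \in E_h$ of comparable norm.\<close>
lemma sgap_le_of_projections:
  fixes P Ph :: "'v::chilbert \<Rightarrow> 'v"
  assumes P: "bounded_clinear_op P" "\<And>v. P (P v) = P v"
    and Ph: "bounded_clinear_op Ph" "\<And>v. Ph (Ph v) = Ph v"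
    and near: "\<And>v. v \<in> {v. Ph v = v} \<Longrightarrow> norm (P v - v) \<le> \<kappa> * norm v"
    and small: "\<And>v. norm (P (P v - Ph v)) \<le> norm v / 2"
    and C: "C \<ge> 1" "\<And>v. norm (Ph v) \<le> C * norm v" and \<kappa>: "\<kappa> \<ge> 0"
  shows "sgap {v. Ph v = v} {v. P v = v} \<le> 2 * C * \<kappa>"
proof -
  have 0: "0 \<le> 2 * C * \<kappa>" "\<kappa> \<le> 2 * C * \<kappa>" using C(1) \<kappa> mult_right_mono[of 1 "2 * C" \<kappa>] by auto
  have "infdist v {v. P v = v} \<le> 2 * C * \<kappa>" if v: "Ph v = v" "norm v = 1" for v
  proof -
    have "infdist v {v. P v = v} \<le> dist v (P v)" by (rule infdist_le) (simp add: P(2))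
    also have "\<dots> \<le> \<kappa>" using near[of v] v by (simp add: dist_norm norm_minus_commute)
    finally show ?thesis using 0(2) by linarith
  qed
  moreover have "infdist v {v. Ph v = v} \<le> 2 * C * \<kappa>" if v: "P v = v" "norm v = 1" for v
  proof -
    note P_simps = bounded_clinear_op_simps[OF P(1)] and Ph_simps = bounded_clinear_op_simps[OF Ph(1)]
    let ?f = "\<lambda>x. P (P x - Ph x)"
    have lin: "?f (x - y) = ?f x - ?f y" for x y by (simp add: P_simps Ph_simps algebra_simps)
    note sol = contraction_unique_solution[of ?f, OF lin small, where y = v]
    obtain x where x: "x = v + ?f x" using sol(1) by blast
    then have x_le: "norm x \<le> 2" using sol(2)[of x] v(2) by simp
    \<comment> \<open>Both \<open>v\<close> and the correction lie in the range of \<open>P\<close>,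
      hence so does \<open>x\<close>; the fixed point equation then collapses to
      \<open>P (Ph x) = v\<close>.\<close>
    have "P x = x"
      using arg_cong[OF x, of P] x by (simp add: P_simps P(2) v(1))
    then have w: "P (Ph x) = v"
      using x by (simp add: P_simps algebra_simps)
    have "infdist v {v. Ph v = v} \<le> dist v (Ph x)" by (rule infdist_le) (simp add: Ph(2))
    also have "\<dots> \<le> \<kappa> * norm (Ph x)" using near[of "Ph x"] w Ph(2) by (simp add: dist_norm)
    also have "\<dots> \<le> \<kappa> * (C * 2)"
      using C x_le by (intro mult_left_mono \<kappa> order_trans[OF C(2)]) auto
    finally show ?thesis by (simp add: mult_ac)
  qed
  ultimately show ?thesis
    unfolding sgap_def sgap_delta_def using 0(1)
    by (intro max.boundedI cSup_least) auto
qed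

section \<open>The gap estimate\<close>

text \<open>Boundedness in the stronger norm comes from the closed graph theorem: a limit in V is
  also a limit in H, and injectivity identifies it.\<close>

lemma bounded_clinear_op_inv_emb:
  fixes emb :: "'v::chilbert \<Rightarrow> 'h::chilbert" and B :: "'h \<Rightarrow> 'h"
  assumes emb: "bounded_clinear_op emb" "inj emb" and B: "bounded_clinear_op B" "range B \<subseteq> range emb"
  shows "bounded_clinear_op (\<lambda>x. inv emb (B x))"
proof (rule closed_graph_bounded_clinear)
  note emb_simps = bounded_clinear_op_simps[OF emb(1)] and B_simps = bounded_clinear_op_simps[OF B(1)]
  have e: "emb (inv emb (B x)) = B x" for x
    using B(2) by (intro f_inv_into_f) auto
  have eI: "inv emb (B x) = v" if "emb v = B x" for x v
    using that emb(2) by (metis inv_f_f)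
  show "inv emb (B (x + y)) = inv emb (B x) + inv emb (B y)" for x y
    by (rule eI) (simp add: emb_simps e B_simps)
  show "inv emb (B (c *\<^sub>C x)) = c *\<^sub>C inv emb (B x)" for c x
    by (rule eI) (simp add: emb_simps e B_simps)
  fix X x y assume X: "X \<longlonglongrightarrow> x" "(\<lambda>n. inv emb (B (X n))) \<longlonglongrightarrow> y"
  have "(\<lambda>n. emb (inv emb (B (X n)))) \<longlonglongrightarrow> emb y"
    by (rule bounded_linear.tendsto[OF bounded_clinear_op_bounded_linear[OF emb(1)] X(2)])
  moreover have "(\<lambda>n. B (X n)) \<longlonglongrightarrow> B x"
    by (rule bounded_linear.tendsto[OF bounded_clinear_op_bounded_linear[OF B(1)] X(1)])
  ultimately have "emb y = B x" unfolding e by (rule LIMSEQ_unique)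
  then show "inv emb (B x) = y" by (rule eI)
qed

text \<open>This is \<open>perturbed_equation\<close> with perturbation \<open>B - S\<close>; the
  bound \<open>2 * M\<close> does not depend on \<open>B\<close>, hence is uniform in the
  discretization.\<close>

lemma perturbed_resolvent:
  fixes S B :: "'v::chilbert \<Rightarrow> 'v"
  assumes S: "bounded_clinear_op S" and B: "bounded_clinear_op B" and z: "z \<in> cresolvent_set UNIV S"
    and M: "\<And>y. norm (cresolvent UNIV S z y) \<le> M * norm y" "M \<ge> 0"
    and \<eta>: "\<And>v. norm (S v - B v) \<le> \<eta> * norm v" "M * \<eta> \<le> 1 / 2"
  shows "z \<in> cresolvent_set UNIV B" and "norm (cresolvent UNIV B z y) \<le> 2 * M * norm y"
proof -
  interpret S: clinear_operator UNIV S by (rule clinear_operator_bounded[OF S])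
  interpret B: clinear_operator UNIV B by (rule clinear_operator_bounded[OF B])
  have d: "B (x - y) - S (x - y) = (B x - S x) - (B y - S y)" for x y
    by (simp add: bounded_clinear_op_simps[OF S] bounded_clinear_op_simps[OF B])
  have n: "norm (B x - S x) \<le> \<eta> * norm x" for x
    using \<eta>(1)[of x] by (simp add: norm_minus_commute)
  have eq: "z *\<^sub>C x - S x - (B x - S x) = z *\<^sub>C x - B x" for x by simp
  note p = S.perturbed_equation[OF z M, of "\<lambda>x. B x - S x", OF d n \<eta>(2), unfolded eq]
  have b: "norm x \<le> 2 * M * norm (z *\<^sub>C x - B x)" if "x \<in> UNIV" for x using p(2) that by blast
  show "z \<in> B.\<rho>" "norm (B.R z y) \<le> 2 * M * norm y"
    using B.resolvent_setI[OF p(1) b] by blast+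
qed

lemma riesz_norm_bound:
  fixes S :: "'a::chilbert \<Rightarrow> 'a"
  assumes S: "clinear_operator UNIV S" and path: "path_image p \<subseteq> cresolvent_set UNIV S"
    and L: "L > 0" "\<And>f M. continuous_on (path_image p) f \<Longrightarrow>
       (\<And>z. z \<in> path_image p \<Longrightarrow> norm (f z :: 'a) \<le> M) \<Longrightarrow> norm (vcontour_integral p f) \<le> L * M"
    and M: "\<And>z y. z \<in> path_image p \<Longrightarrow> norm (cresolvent UNIV S z y) \<le> M * norm y" "M \<ge> 0"
  shows "norm (riesz UNIV S p x) \<le> L * M * norm x"
proof -
  interpret S: clinear_operator UNIV S by (rule S)
  have "norm (vcontour_integral p (\<lambda>z. S.R z x)) \<le> L * (M * norm x)"
    by (rule L(2)[OF continuous_on_subset[OF S.continuous_on_resolvent path] M(1)])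
  then have "norm (riesz UNIV S p x) \<le> cmod (1 / (2 * of_real pi * \<i>)) * (L * (M * norm x))"
    by (simp only: riesz_def norm_scaleC mult_left_mono norm_ge_zero)
  also have "\<dots> \<le> 1 * (L * (M * norm x))"
    using pi_gt3 L(1) M(2) by (intro mult_right_mono) (simp_all add: norm_divide norm_mult field_simps)
  finally show ?thesis by (simp add: mult.assoc)
qed

text \<open>Two distances are kept apart. The global \<open>\<eta>\<close> only has to be small, to
  make \<open>P (P - Ph)\<close> a contraction; \<open>\<kappa>\<close>, valid on the spectral
  subspace of \<open>B\<close> alone, enters the result.\<close>

lemma sgap_riesz_le:
  fixes S B :: "'v::chilbert \<Rightarrow> 'v" and s :: complex
  assumes S: "resolvent_loop UNIV S p" "\<And>x. riesz UNIV S p (riesz UNIV S p x) = s *\<^sub>C riesz UNIV S p x"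
    and B: "resolvent_loop UNIV B p" "\<And>x. riesz UNIV B p (riesz UNIV B p x) = s *\<^sub>C riesz UNIV B p x"
    and s: "cmod s = 1"
    and L: "L > 0" "\<And>f M. continuous_on (path_image p) f \<Longrightarrow>
       (\<And>z. z \<in> path_image p \<Longrightarrow> norm (f z :: 'v) \<le> M) \<Longrightarrow> norm (vcontour_integral p f) \<le> L * M"
    and M: "M > 0" "\<And>z y. z \<in> path_image p \<Longrightarrow> norm (cresolvent UNIV S z y) \<le> M * norm y"
      "\<And>z y. z \<in> path_image p \<Longrightarrow> norm (cresolvent UNIV B z y) \<le> 2 * M * norm y"
    and \<eta>: "\<And>v. norm (S v - B v) \<le> \<eta> * norm v" "\<eta> \<ge> 0" "(L * M) * (L * M * (\<eta> * (2 * M))) \<le> 1 / 2"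
    and \<kappa>: "\<And>u. riesz UNIV B p u = s *\<^sub>C u \<Longrightarrow> norm (S u - B u) \<le> \<kappa> * norm u" "\<kappa> \<ge> 0"
  shows "sgap {v. riesz UNIV B p v = s *\<^sub>C v} {v. riesz UNIV S p v = s *\<^sub>C v}
    \<le> 2 * (1 + 2 * L * M) * (L * M * (\<kappa> * (2 * M)))"
proof -
  interpret S: resolvent_loop UNIV S p by (rule S)
  interpret B: resolvent_loop UNIV B p by (rule B)
  have s0: "s \<noteq> 0" using s by auto
  define P where "P v = (1 / s) *\<^sub>C S.Q v" for v
  define Ph where "Ph v = (1 / s) *\<^sub>C B.Q v" for v
  note SQ = bounded_clinear_op_simps[OF S.riesz_bounded] and BQ = bounded_clinear_op_simps[OF B.riesz_bounded]
  have fix_iff: "(1 / s) *\<^sub>C u = v \<longleftrightarrow> u = s *\<^sub>C v" for u v :: 'v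
    using s0 by auto
  have n1: "norm ((1 / s) *\<^sub>C u) = norm u" for u :: 'v
    using s by (simp add: norm_scaleC norm_divide)
  have nP: "norm (P v) \<le> L * M * norm v" for v
    unfolding P_def n1 using M by (intro riesz_norm_bound[OF S.clinear_operator_axioms S.loop_subset L]) auto
  have nPh: "norm (Ph v) \<le> L * (2 * M) * norm v" for v
    unfolding Ph_def n1 using M by (intro riesz_norm_bound[OF B.clinear_operator_axioms B.loop_subset L]) auto
  have diff: "norm (P v - Ph v) \<le> L * M * \<delta>"
    if "\<And>z. z \<in> path_image p \<Longrightarrow> norm (S (B.R z v) - B (B.R z v)) \<le> \<delta>" for v \<delta>
    unfolding P_def Ph_def cvs.scale_right_diff_distrib[symmetric] n1
    using M(1) by (intro riesz_difference_bound[OF S.clinear_operator_axioms B.clinear_operator_axioms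
          S.polynomial_loop(1) S.loop_subset B.loop_subset L M(2) _ that]) auto
  have "sgap {v. Ph v = v} {v. P v = v} \<le> 2 * (1 + 2 * L * M) * (L * M * (\<kappa> * (2 * M)))"
  proof (rule sgap_le_of_projections)
    show "bounded_clinear_op P" "bounded_clinear_op Ph"
      unfolding P_def Ph_def by (intro bounded_clinear_op_scale S.riesz_bounded B.riesz_bounded)+
    show "P (P v) = P v" "Ph (Ph v) = Ph v" for v
      using s0 by (simp_all add: P_def Ph_def SQ BQ S(2) B(2))
    show "norm (P v - v) \<le> L * M * (\<kappa> * (2 * M)) * norm v" if "v \<in> {v. Ph v = v}" for v
    proof -
      have v: "Ph v = v" using that by simp
      then have Bv: "B.Q v = s *\<^sub>C v" by (simp add: Ph_def fix_iff)
      have "norm (P v - Ph v) \<le> L * M * (\<kappa> * (2 * M * norm v))"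
      proof (rule diff)
        fix z assume z: "z \<in> path_image p"
        then have zB: "z \<in> B.\<rho>" using B.loop_subset by auto
        \<comment> \<open>Resolvents commute with the Riesz integral, so the vector stays in the
          subspace where \<open>\<kappa>\<close> applies.\<close>
        have "B.Q (B.R z v) = s *\<^sub>C B.R z v"
          by (simp add: B.riesz_resolvent_commute[OF zB] Bv bounded_clinear_op_simps[OF B.resolvent_bounded[OF zB]])
        from \<kappa>(1)[OF this] show "norm (S (B.R z v) - B (B.R z v)) \<le> \<kappa> * (2 * M * norm v)"
          using mult_left_mono[OF M(3)[OF z, of v] \<kappa>(2)] by linarith
      qed
      then show ?thesis by (simp only: v mult.assoc)
    qed
    show "norm (P (P v - Ph v)) \<le> norm v / 2" for v
    proof -
      have "norm (P v - Ph v) \<le> L * M * (\<eta> * (2 * M * norm v))"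
      proof (rule diff)
        fix z assume z: "z \<in> path_image p"
        show "norm (S (B.R z v) - B (B.R z v)) \<le> \<eta> * (2 * M * norm v)"
          using \<eta>(1)[of "B.R z v"] mult_left_mono[OF M(3)[OF z, of v] \<eta>(2)] by linarith
      qed
      then have "(L * M) * norm (P v - Ph v) \<le> (L * M) * (L * M * (\<eta> * (2 * M * norm v)))"
        using L(1) M(1) by (intro mult_left_mono) auto
      also have "\<dots> = ((L * M) * (L * M * (\<eta> * (2 * M)))) * norm v" by (simp add: mult_ac)
      also have "\<dots> \<le> 1 / 2 * norm v" by (rule mult_right_mono[OF \<eta>(3)]) simp
      finally show ?thesis using nP[of "P v - Ph v"] by simp
    qed
    show "norm (Ph v) \<le> (1 + 2 * L * M) * norm v" for v
      using nPh[of v] norm_ge_zero[of v] by (simp add: algebra_simps del: norm_ge_zero)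
  qed (use L(1) M(1) \<kappa>(2) in auto)
  then show ?thesis by (simp add: P_def Ph_def fix_iff)
qed

lemma riesz_polynomial_loop:
  assumes "clinear_operator D A" "valid_path \<gamma>" "valid_path p" "path_image \<gamma> \<subseteq> U" "path_image p \<subseteq> U" "open U"
    and "\<And>g. g holomorphic_on U \<Longrightarrow> contour_integral p g = contour_integral \<gamma> g"
    and "U \<subseteq> cresolvent_set D A"
  shows "riesz D A \<gamma> = riesz D A p"
proof
  fix x
  interpret clinear_operator D A by fact
  have "weakly_holomorphic_on (\<lambda>z. R z x) U"
    using continuous_on_subset[OF continuous_on_resolvent assms(8)]
      holomorphic_on_subset[OF holomorphic_on_cinner_resolvent assms(8)]
    by (simp add: weakly_holomorphic_on_def)
  from vcontour_integral_eqI[OF assms(2-7) this] show "riesz D A \<gamma> x = riesz D A p x"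
    by (simp add: riesz_def)
qed

theorem theorem3p10:
  fixes D :: "'h::chilbert set" and A :: "'h \<Rightarrow> 'h"
    and \<iota> :: "'v::chilbert \<Rightarrow> 'h"
    and \<Lambda> :: "complex set" and \<Gamma> \<Theta> :: "real \<Rightarrow> complex"
    and N :: nat and \<omega> :: "nat \<Rightarrow> complex" and zs :: "nat \<Rightarrow> complex"
    and hs :: "real set" and Vh :: "real \<Rightarrow> 'v set" and Rh :: "real \<Rightarrow> nat \<Rightarrow> 'h \<Rightarrow> 'v"
    and Eop :: "real \<Rightarrow> 'v \<Rightarrow> 'y::chilbert" and C0 :: real
  defines "R \<equiv> cresolvent D A"
    and "\<rho> \<equiv> cresolvent_set D A"
    and "\<sigma> \<equiv> cspectrum D A"
    and "E \<equiv> \<iota> -` range (riesz D A \<Gamma>)"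
    and "\<Upsilon> \<equiv> rfun N \<omega> zs ` \<Lambda>"
    and "Sr \<equiv> (\<lambda>x. \<omega> 0 *\<^sub>C x + (\<Sum>j=1..N. \<omega> j *\<^sub>C cresolvent D A (zs j) x))"
    and "SrV \<equiv> (\<lambda>v. \<omega> 0 *\<^sub>C v + (\<Sum>j=1..N. \<omega> j *\<^sub>C inv \<iota> (cresolvent D A (zs j) (\<iota> v))))"
    and "SrhV \<equiv> (\<lambda>h v. \<omega> 0 *\<^sub>C v + (\<Sum>j=1..N. \<omega> j *\<^sub>C Rh h j (\<iota> v)))"
    and "Eh \<equiv> (\<lambda>h. \<iota> -` range (riesz UNIV (\<lambda>x. \<omega> 0 *\<^sub>C x + (\<Sum>j=1..N. \<omega> j *\<^sub>C \<iota> (Rh h j x))) \<Theta>))"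
  assumes A_closed: "closed_operator D A"
    and V_embed: "bounded_clinear_op \<iota>" "inj \<iota>"
    and dom_in_V: "D \<subseteq> range \<iota>"
    and res_V: "\<forall>z\<in>\<rho>. \<forall>v. R z (\<iota> v) \<in> range \<iota>"
    and Lambda: "finite \<Lambda>" "\<forall>lam\<in>\<Lambda>. isolated_eigenvalue_finite_mult D A lam"
    and Gamma: "valid_path \<Gamma>" "simple_path \<Gamma>" "pathfinish \<Gamma> = pathstart \<Gamma>"
      "path_image \<Gamma> \<subseteq> \<rho>" "\<forall>lam\<in>\<Lambda>. winding_number \<Gamma> lam = 1"
      "\<forall>z\<in>\<sigma> - \<Lambda>. winding_number \<Gamma> z = 0"
    and E_in_V: "range (riesz D A \<Gamma>) \<subseteq> range \<iota>"
    and zs: "inj_on zs {1..N}" "zs ` {1..N} \<subseteq> \<rho>"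
    and Theta: "valid_path \<Theta>" "simple_path \<Theta>" "pathfinish \<Theta> = pathstart \<Theta>"
      "path_image \<Theta> \<inter> (cspectrum UNIV Sr \<union> {0}) = {}"
      "\<forall>\<mu>\<in>\<Upsilon>. winding_number \<Theta> \<mu> \<noteq> 0"
      "winding_number \<Theta> 0 = 0"
      "\<forall>\<mu>\<in>cspectrum UNIV Sr - \<Upsilon>. winding_number \<Theta> \<mu> = 0"
    and hs: "hs \<subseteq> {0<..}" "0 islimpt hs"
    and Vh: "\<forall>h\<in>hs. csubspace (Vh h) \<and> cfinite_dim (Vh h)"
    and Rh: "\<forall>h\<in>hs. \<forall>k\<in>{1..N}. bounded_clinear_op (Rh h k) \<and> range (Rh h k) \<subseteq> Vh h"
    and hyp_i: "\<omega> 0 \<notin> \<Upsilon>" "(\<Union>\<mu>\<in>\<Upsilon>. rinv N \<omega> zs \<mu>) \<inter> \<sigma> \<subseteq> \<Lambda>"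
    and hyp_ii: "\<forall>k\<in>{1..N}.
       ((\<lambda>h. onorm (\<lambda>v. Rh h k (\<iota> v) - inv \<iota> (R (zs k) (\<iota> v)))) \<longlongrightarrow> 0) (at 0 within hs)"
    and hyp_iii: "C0 > 0" "\<forall>h\<in>hs. clinear_on (Vh h) (Eop h)"
      "\<forall>h\<in>hs. \<forall>v\<in>Vh h. norm (SrV v - SrhV h v) \<le> C0 * norm (Eop h v)"
  shows "\<exists>h0>0. \<exists>C>0. \<forall>h\<in>hs. h < h0 \<longrightarrow>
           (\<forall>L e x. is_cbasis (Eh h) L e \<and> is_top_gen_eigvec L (gramG (Eop h) e) (gramM e) x \<longrightarrow>
              sgap (Eh h) E \<le> C * norm (Eop h (ehat L e x)))"
proof -
  interpret A: rational_operator D A N \<omega> zs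
    using A_closed zs by unfold_locales (auto simp: closed_operator_def \<rho>_def)
  have range_R: "range (A.R z) \<subseteq> range \<iota>" if "z \<in> A.\<rho>" for z
    using A.resolvent_mem[OF that] dom_in_V by auto
  define F0 where "F0 x = (\<Sum>j=1..N. \<omega> j *\<^sub>C inv \<iota> (A.R (zs j) x))" for x
  have F0j: "bounded_clinear_op (\<lambda>x. inv \<iota> (A.R (zs j) x))" if "j \<in> {1..N}" for j
    by (intro bounded_clinear_op_inv_emb V_embed A.resolvent_bounded range_R A.pole_mem that)
  have F0: "bounded_clinear_op F0"
    unfolding F0_def by (intro bounded_clinear_op_sum_op bounded_clinear_op_scale F0j)
  interpret S: embedded_operator \<iota> "\<omega> 0" F0
    by unfold_locales (rule V_embed F0)+
  have SV: "S.SV = SrV" by (simp add: fun_eq_iff S.SV_def SrV_def F0_def)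
  have "\<iota> (inv \<iota> (A.R (zs j) x)) = A.R (zs j) x" if "j \<in> {1..N}" for j x
    using range_R[OF A.pole_mem[OF that]] by (intro f_inv_into_f) auto
  then have TH: "S.TH = A.T"
    by (auto simp: fun_eq_iff S.TH_def A.T_def F0_def S.emb_simps intro!: sum.cong)
  have Sr: "Sr = A.T" by (simp add: fun_eq_iff Sr_def A.T_def)
  have \<rho>T: "S.H.\<rho> = A.T.\<rho>" "cspectrum UNIV Sr = - A.T.\<rho>"
    by (auto simp: TH Sr cspectrum_def)

  have eigen: "\<exists>x\<in>D. x \<noteq> 0 \<and> A x = l *\<^sub>C x" if "l \<in> \<Lambda>" for l
    using Lambda(2) that by (auto simp: isolated_eigenvalue_finite_mult_def)
  have \<Upsilon>_spec: "\<mu> \<notin> A.T.\<rho>" if "\<mu> \<in> \<Upsilon>" for \<mu>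
    using that eigen A.eigenvalue_not_in_resolvent_set(2) by (auto simp: \<Upsilon>_def)
  have \<Lambda>_spec: "l \<notin> A.\<rho>" if "l \<in> \<Lambda>" for l
    using that eigen A.eigenvalue_not_in_resolvent_set(1) by blast

  obtain q where q: "polynomial_function q" "pathfinish q = pathstart q" "path_image q \<subseteq> A.\<rho>"
    "\<And>f. f holomorphic_on A.\<rho> \<Longrightarrow> contour_integral q f = contour_integral \<Gamma> f"
    "\<And>z. z \<notin> A.\<rho> \<Longrightarrow> winding_number q z = winding_number \<Gamma> z"
    using polynomial_loop_approximation[OF Gamma(1,3) _ A.open_resolvent_set] Gamma(4)
    unfolding \<rho>_def by metis
  have riesz_q: "riesz D A \<Gamma> = riesz D A q"
    by (rule riesz_polynomial_loop[OF A.clinear_operator_axioms Gamma(1) valid_path_polynomial_function[OF q(1)]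
          _ q(3) A.open_resolvent_set q(4)]) (use Gamma(4) in \<open>auto simp: \<rho>_def\<close>)

  have path\<Theta>: "path \<Theta>" using Theta(1) by (rule valid_path_imp_path)
  have "path_image \<Theta> \<subseteq> A.T.\<rho>" using Theta(4) by (auto simp: \<rho>T)
  from compact_in_open_separated[OF path_image_nonempty compact_path_image[OF path\<Theta>] A.T.open_resolvent_set this]
  obtain \<epsilon> where \<epsilon>: "\<epsilon> > 0" "{x. infdist x (path_image \<Theta>) \<le> \<epsilon>} \<subseteq> A.T.\<rho>" by blast
  \<comment> \<open>A compact neighbourhood of the curve is kept regular: the curve and its
    polynomial replacement both lie in it, so the contour can be exchanged for every small
    \<open>h\<close> at once.\<close>
  define K where "K = {x. infdist x (path_image \<Theta>) \<le> \<epsilon>}"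
  define U where "U = {x. infdist x (path_image \<Theta>) < \<epsilon>}"
  have "compact K"
    unfolding K_def by (intro compact_infdist_le path_image_nonempty compact_path_image path\<Theta> \<epsilon>(1))
  have "U \<subseteq> K" "path_image \<Theta> \<subseteq> U" and KT: "K \<subseteq> A.T.\<rho>"
    using \<epsilon> by (auto simp: U_def K_def)
  have "open U" unfolding U_def by (intro open_Collect_less continuous_intros)
  obtain p where p: "polynomial_function p" "pathfinish p = pathstart p" "path_image p \<subseteq> U"
    "\<And>f. f holomorphic_on U \<Longrightarrow> contour_integral p f = contour_integral \<Theta> f"
    "\<And>z. z \<notin> U \<Longrightarrow> winding_number p z = winding_number \<Theta> z"
    using polynomial_loop_approximation[OF Theta(1,3) \<open>path_image \<Theta> \<subseteq> U\<close> \<open>open U\<close>] by metis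
  note vp = valid_path_polynomial_function[OF p(1)]

  \<comment> \<open>The winding number inside a simple closed curve is 1 or -1; dividing by this
    \<open>s\<close> will turn Riesz integrals into projections.\<close>
  obtain s where s: "cmod s = 1" "\<And>z. z \<in> inside (path_image \<Theta>) \<Longrightarrow> winding_number \<Theta> z = s"
    by (rule simple_closed_path_winding_number_inside[OF Theta(2)]) (use that[of 1] that[of "-1"] in auto)
  have s0: "s \<noteq> 0" using s(1) by auto
  have wind\<Theta>: "winding_number \<Theta> z = 0 \<or> winding_number \<Theta> z = s" if "z \<notin> path_image \<Theta>" for z
    using that s(2) winding_number_zero_in_outside[OF path\<Theta> Theta(3)] inside_Un_outside by blast
  have windp: "winding_number p z = winding_number \<Theta> z" "z \<notin> path_image \<Theta>" if "z \<notin> U" for z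
    using that p(5) \<open>path_image \<Theta> \<subseteq> U\<close> by auto

  \<comment> \<open>If \<open>\<omega> 0\<close> lies in \<open>K\<close>, it is regular for
    \<open>Sr\<close>, which forces \<open>\<iota>\<close> to be onto; the resolvent sets in H and V
    can then be compared there too.\<close>
  have surj: "z \<noteq> \<omega> 0 \<or> range \<iota> = UNIV" if "z \<in> K" for z
    using that KT S.surj_of_resolvent_set by (auto simp: \<rho>T)
  have KV: "K \<subseteq> S.V.\<rho>"
    using S.resolvent_set_iff[OF surj] KT by (auto simp: \<rho>T)
  \<comment> \<open>$\omega_0$ is a regular value only if \<open>\<iota>\<close> is onto (finite dimension, in effect); it is then kept
    regular for the perturbed operators, which forces $V_h = V$.\<close>
  define K' where "K' = K \<union> ({\<omega> 0} \<inter> S.V.\<rho>)"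
  have "compact K'" unfolding K'_def by (intro compact_Un \<open>compact K\<close> finite_imp_compact) simp
  moreover have "K' \<subseteq> S.V.\<rho>" using KV by (auto simp: K'_def)
  ultimately obtain M where M: "M > 0" "\<And>z y. z \<in> K' \<Longrightarrow> norm (S.V.R z y) \<le> M * norm y"
    using S.V.resolvent_bounded_on_compact by blast
  obtain L where L: "L > 0" "\<And>(f :: complex \<Rightarrow> 'v) M. continuous_on (path_image p) f \<Longrightarrow>
     (\<And>z. z \<in> path_image p \<Longrightarrow> norm (f z) \<le> M) \<Longrightarrow> norm (vcontour_integral p f) \<le> L * M"
    using vcontour_integral_bound[OF p(1)] by blast
  have pK: "path_image p \<subseteq> K" "path_image p \<subseteq> K'" using p(3) \<open>U \<subseteq> K\<close> by (auto simp: K'_def)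

  interpret SL: embedded_loop \<iota> "\<omega> 0" F0 p s
  proof
    show "path_image p \<subseteq> S.H.\<rho>" using pK(1) KT by (simp add: \<rho>T)
    show "path_image p \<subseteq> S.V.\<rho>" using pK(1) KV by simp
    show "winding_number p z = 0 \<or> winding_number p z = s" if "z \<notin> S.H.\<rho>" for z
    proof -
      have "z \<notin> U" using that \<open>U \<subseteq> K\<close> KT by (auto simp: \<rho>T)
      then show ?thesis using windp wind\<Theta> by auto
    qed
  qed (use p(1,2) s0 in auto)

  interpret TL: two_loops D A N \<omega> zs q p \<Lambda> s
  proof (intro two_loops.intro two_loops_axioms.intro A.rational_operator_axioms)
    show "resolvent_loop D A q"
      by unfold_locales (rule q(1,2,3))+
    show "resolvent_loop UNIV A.T p"
      using SL.HL.resolvent_loop_axioms unfolding TH .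
    show "winding_number q l = 1" if "l \<in> \<Lambda>" for l
      using q(5)[OF \<Lambda>_spec[OF that]] Gamma(5) that by simp
    show "winding_number q z = 0" if "z \<notin> A.\<rho>" "z \<notin> \<Lambda>" for z
      using q(5)[OF that(1)] Gamma(6) that by (simp add: \<sigma>_def cspectrum_def)
    show "winding_number p (A.r l) = s" if "l \<in> \<Lambda>" for l
    proof -
      \<comment> \<open>Spectral points stay out of \<open>U\<close>, so the winding number passes
        from \<open>\<Theta>\<close> to \<open>p\<close>; being nonzero, it equals
        \<open>s\<close>.\<close>
      have m: "A.r l \<in> \<Upsilon>" using that by (simp add: \<Upsilon>_def)
      then have "A.r l \<notin> U" using \<Upsilon>_spec \<open>U \<subseteq> K\<close> KT by blast
      then show ?thesis using windp wind\<Theta> Theta(5) m by metis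
    qed
    show "winding_number p z = 0" if "z \<notin> A.T.\<rho>" "z \<notin> A.r ` \<Lambda>" for z
    proof -
      have "z \<notin> U" using that(1) \<open>U \<subseteq> K\<close> KT by blast
      then show ?thesis using windp(1) Theta(7) that by (simp add: \<rho>T \<Upsilon>_def)
    qed
    show "\<omega> 0 \<notin> A.r ` \<Lambda>" using hyp_i(1) by (simp add: \<Upsilon>_def)
    show "(\<Union>\<mu>\<in>A.r ` \<Lambda>. rinv N \<omega> zs \<mu>) - A.\<rho> \<subseteq> \<Lambda>"
      using hyp_i(2) by (auto simp: \<Upsilon>_def \<sigma>_def cspectrum_def)
  qed (use Lambda(1) eigen s0 in auto)

  have E: "E = {v. riesz UNIV SrV p v = s *\<^sub>C v}"
    using SL.vimage_range_riesz TL.range_riesz_eq unfolding E_def riesz_q TH SV by simp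

  \<comment> \<open>The first entry keeps the perturbed resolvents bounded by \<open>2 * M\<close>;
    the second makes \<open>P (P - Ph)\<close> a contraction with factor 1/2.\<close>
  define \<eta> where "\<eta> = min (1 / (2 * M)) (1 / (2 * ((L * M) * (L * M * (2 * M)))))"
  have c0: "(L * M) * (L * M * (2 * M)) > 0" using L(1) M(1) by simp
  have \<eta>: "\<eta> > 0" "M * \<eta> \<le> 1 / 2" "(L * M) * (L * M * (\<eta> * (2 * M))) \<le> 1 / 2"
  proof -
    show "\<eta> > 0" using M(1) c0 by (simp add: \<eta>_def)
    have "M * \<eta> \<le> M * (1 / (2 * M))" using M(1) by (intro mult_left_mono) (auto simp: \<eta>_def)
    then show "M * \<eta> \<le> 1 / 2" using M(1) by simp
    have "((L * M) * (L * M * (2 * M))) * \<eta> \<le> ((L * M) * (L * M * (2 * M))) * (1 / (2 * ((L * M) * (L * M * (2 * M)))))"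
      using c0 by (intro mult_left_mono) (auto simp: \<eta>_def)
    also have "\<dots> = 1 / 2" using L(1) M(1) by simp
    finally show "(L * M) * (L * M * (\<eta> * (2 * M))) \<le> 1 / 2" by (simp add: mult_ac)
  qed

  define \<Delta> where "\<Delta> h k v = Rh h k (\<iota> v) - inv \<iota> (R (zs k) (\<iota> v))" for h k v
  have "((\<lambda>h. \<Sum>k=1..N. cmod (\<omega> k) * onorm (\<Delta> h k)) \<longlongrightarrow> (\<Sum>k=1..N. cmod (\<omega> k) * 0)) (at 0 within hs)"
    using hyp_ii unfolding \<Delta>_def by (intro tendsto_sum tendsto_mult tendsto_const) auto
  then have "\<forall>\<^sub>F h in at 0 within hs. (\<Sum>k=1..N. cmod (\<omega> k) * onorm (\<Delta> h k)) < \<eta>"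
    using \<eta>(1) by (intro order_tendstoD(2)) auto
  then obtain h0 where h0: "h0 > 0"
    "\<And>h. h \<in> hs \<Longrightarrow> h \<noteq> 0 \<Longrightarrow> dist h 0 < h0 \<Longrightarrow> (\<Sum>k=1..N. cmod (\<omega> k) * onorm (\<Delta> h k)) < \<eta>"
    unfolding eventually_at by blast

  \<comment> \<open>The constant of \<open>sgap_riesz_le\<close>, with \<open>\<kappa>\<close>
    contributing its factor \<open>C0\<close>; none of its ingredients depends on
    \<open>h\<close>.\<close>
  define C where "C = 2 * (1 + 2 * L * M) * (L * M * (C0 * (2 * M)))"
  have "C > 0" using L(1) M(1) hyp_iii(1) by (simp add: C_def add_pos_pos)
  moreover have "sgap (Eh h) E \<le> C * norm (Eop h (ehat l e x))"
    if h: "h \<in> hs" "h < h0" and e: "is_cbasis (Eh h) l e" "is_top_gen_eigvec l (gramG (Eop h) e) (gramM e) x"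
    for h l e x
  proof -
    have hpos: "h > 0" using h(1) hs(1) by auto
    have bRh: "bounded_clinear_op (Rh h k)" "range (Rh h k) \<subseteq> Vh h" if "k \<in> {1..N}" for k
      using Rh h(1) that by auto
    define Fh where "Fh x = (\<Sum>j=1..N. \<omega> j *\<^sub>C Rh h j x)" for x
    have Fh: "bounded_clinear_op Fh"
      unfolding Fh_def by (intro bounded_clinear_op_sum_op bounded_clinear_op_scale bRh)
    interpret B: embedded_operator \<iota> "\<omega> 0" Fh by unfold_locales (rule V_embed Fh)+
    have BSV: "B.SV = SrhV h" by (simp add: fun_eq_iff B.SV_def SrhV_def Fh_def)
    have BTH: "B.TH = (\<lambda>x. \<omega> 0 *\<^sub>C x + (\<Sum>j=1..N. \<omega> j *\<^sub>C \<iota> (Rh h j x)))"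
      by (simp add: fun_eq_iff B.TH_def Fh_def B.emb_simps)
    have close: "norm (S.SV v - B.SV v) \<le> \<eta> * norm v" for v
    proof -
      have "S.SV v - B.SV v = - (\<Sum>k=1..N. \<omega> k *\<^sub>C \<Delta> h k v)"
        by (simp add: S.SV_def B.SV_def F0_def Fh_def \<Delta>_def R_def cvs.scale_right_diff_distrib sum_subtractf)
      then have "norm (S.SV v - B.SV v) \<le> (\<Sum>k=1..N. norm (\<omega> k *\<^sub>C \<Delta> h k v))"
        by (simp add: norm_sum)
      also have "\<dots> \<le> (\<Sum>k=1..N. (cmod (\<omega> k) * onorm (\<Delta> h k)) * norm v)"
      proof (rule sum_mono)
        fix k assume k: "k \<in> {1..N}"
        have "bounded_clinear_op (\<Delta> h k)"
          unfolding \<Delta>_def R_def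
          by (rule bounded_clinear_op_minus_op[OF bounded_clinear_op_compose[OF bRh(1)[OF k] V_embed(1)]
                bounded_clinear_op_compose[OF F0j[OF k] V_embed(1)]])
        from onorm[OF bounded_clinear_op_bounded_linear[OF this], of v]
        show "norm (\<omega> k *\<^sub>C \<Delta> h k v) \<le> (cmod (\<omega> k) * onorm (\<Delta> h k)) * norm v"
          by (simp add: norm_scaleC mult.assoc mult_left_mono)
      qed
      also have "\<dots> = (\<Sum>k=1..N. cmod (\<omega> k) * onorm (\<Delta> h k)) * norm v" by (simp add: sum_distrib_right)
      also have "\<dots> \<le> \<eta> * norm v"
        using h0(2)[OF h(1)] hpos h(2) by (intro mult_right_mono) (auto simp: dist_norm)
      finally show ?thesis .
    qed
    have BK: "z \<in> B.V.\<rho>" "norm (B.V.R z y) \<le> 2 * M * norm y" if "z \<in> K'" for z y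
      using perturbed_resolvent[OF S.bounded_SV B.bounded_SV _ M(2)[OF that] _ close \<eta>(2)]
        that \<open>K' \<subseteq> S.V.\<rho>\<close> M(1) by auto
    have BKH: "K \<subseteq> B.H.\<rho>"
      using B.resolvent_set_iff[OF surj] BK(1) by (auto simp: K'_def)
    interpret BL: embedded_loop \<iota> "\<omega> 0" Fh p s
    proof
      show "path_image p \<subseteq> B.H.\<rho>" using pK(1) BKH by simp
      show "path_image p \<subseteq> B.V.\<rho>" using pK(2) BK(1) by blast
      show "winding_number p z = 0 \<or> winding_number p z = s" if "z \<notin> B.H.\<rho>" for z
      proof -
        have "z \<notin> U" using that \<open>U \<subseteq> K\<close> BKH by blast
        then show ?thesis using windp wind\<Theta> by auto
      qed
    qed (use p(1,2) s0 in auto)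
    have "riesz UNIV B.TH \<Theta> = riesz UNIV B.TH p"
      by (rule riesz_polynomial_loop[OF B.H.clinear_operator_axioms Theta(1) vp
            \<open>path_image \<Theta> \<subseteq> U\<close> p(3) \<open>open U\<close> p(4)]) (use \<open>U \<subseteq> K\<close> BKH in auto)
    then have Eh: "Eh h = {v. BL.VL.Q v = s *\<^sub>C v}"
      using BL.vimage_range_riesz unfolding Eh_def BTH by simp
    \<comment> \<open>This makes vectors of \<open>Eh h\<close> values of \<open>Fh\<close>. If
      \<open>\<omega> 0\<close> is regular, it belongs to \<open>K'\<close> and stays regular; if it
      is spectral, it lies outside \<open>\<Upsilon>\<close> by (i) and so has winding number
      0.\<close>
    have "\<omega> 0 \<in> B.V.\<rho> \<or> (\<omega> 0 \<notin> path_image p \<and> winding_number p (\<omega> 0) = 0)"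
    proof (cases "\<omega> 0 \<in> S.V.\<rho>")
      case True
      then show ?thesis using BK(1)[of "\<omega> 0"] by (simp add: K'_def)
    next
      case False
      then have w: "\<omega> 0 \<notin> A.T.\<rho>"
        using S.resolvent_set_iff[of "\<omega> 0"] S.surj_of_resolvent_set by (auto simp: \<rho>T)
      then have "\<omega> 0 \<notin> U" using \<open>U \<subseteq> K\<close> KT by blast
      then show ?thesis using windp(1) Theta(7) w hyp_i(1) p(3) by (auto simp: \<rho>T)
    qed
    from BL.riesz_range_F[OF this] have EhF: "Eh h \<subseteq> range Fh" by (auto simp: Eh)
    have subVh: "csubspace (Vh h)" using Vh h(1) by blast
    have "range Fh \<subseteq> Vh h"
      using subVh subsetD[OF bRh(2) rangeI] unfolding Fh_def csubspace_def
      by (auto intro!: cvs.subspace_sum cvs.subspace_scale)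
    \<comment> \<open>Hypothesis (iii) speaks of \<open>Vh h\<close> only; this inclusion makes it
      available on \<open>Eh h\<close>.\<close>
    with EhF have EhV: "Eh h \<subseteq> Vh h" by blast
    let ?\<kappa> = "C0 * norm (Eop h (ehat l e x))"
    have linE: "clinear_on (Vh h) (Eop h)" using hyp_iii(2) h(1) by blast
    have \<kappa>: "norm (S.SV u - B.SV u) \<le> ?\<kappa> * norm u" if "BL.VL.Q u = s *\<^sub>C u" for u
    proof -
      have u: "u \<in> Eh h" using that by (simp add: Eh)
      then have "norm (S.SV u - B.SV u) \<le> C0 * norm (Eop h u)"
        using hyp_iii(3) h(1) EhV unfolding SV BSV by blast
      also have "\<dots> \<le> C0 * (norm (Eop h (ehat l e x)) * norm u)"
        using norm_le_top_eigenvector[OF e(1) subVh EhV linE e(2) u] hyp_iii(1)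
        by (intro mult_left_mono) auto
      finally show ?thesis by (simp add: mult.assoc)
    qed
    have "sgap {v. BL.VL.Q v = s *\<^sub>C v} {v. SL.VL.Q v = s *\<^sub>C v}
        \<le> 2 * (1 + 2 * L * M) * (L * M * (?\<kappa> * (2 * M)))"
    proof (rule sgap_riesz_le[OF SL.VL.resolvent_loop_axioms SL.VL_idempotent
          BL.VL.resolvent_loop_axioms BL.VL_idempotent s(1) L M(1)])
      show "norm (S.V.R z y) \<le> M * norm y" if "z \<in> path_image p" for z y
        using M(2) pK(2) that by blast
      show "norm (B.V.R z y) \<le> 2 * M * norm y" if "z \<in> path_image p" for z y
        using BK(2) pK(2) that by blast
    qed (use close \<eta> \<kappa> hyp_iii(1) in auto)
    also have "\<dots> = C * norm (Eop h (ehat l e x))" by (simp only: C_def mult_ac)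
    finally show ?thesis unfolding E Eh SV .
  qed
  ultimately show ?thesis using h0(1) by blast
qed

end
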